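(* For distinct integers $k,\ell$ we have $$\mathrm{ex}(n,C_k,C_{\ell}) = \begin{cases} \Theta_{k}\big( n^{k/2} \big) & \text{if } k \geq 5,\ \ell = 4, \\ \Theta_{k}\big( \ell^{\lceil k/2 \rceil} n^{\lfloor k/2 \rfloor} \big) & \text{if } \ell \geq 6 \text{ is even and } k \geq 4, \\ \Theta_{k}\big( \ell^{\lceil k/2 \rceil} n^{\lfloor k/2 \rfloor} \big) & \text{if } k,\ell \text{ are odd and } 5 \leq k < \ell. \end{cases}$$ Here the constants implicit in $\Theta_k$ depend only on $k$ (in particular not on $\ell$ or $n$).
   Context: Graphs are finite and simple. $C_k$ denotes the cycle of length $k$. For graphs $T,H$, $\mathrm{ex}(n,T,H)$ is the maximum number of copies of $T$ (unlabeled copies, i.e. not necessarily induced subgraphs isomorphic to $T$) in an $n$-vertex graph that contains no copy of $H$ as a (not necessarily induced) subgraph. The notation $g(n,\ell)=\Theta_k(h(n,\ell))$ means: there are constants $0<a_k\le A_k$ depending only on $k$ such that $g(n,\ell)\le A_k h(n,\ell)$ for all $n \geq 1$, and $g(n,\ell)\ge a_k h(n,\ell)$ for all $n\ge n_0(k,\ell)$ (i.e. all sufficiently large $n$ given $k,\ell$). *)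

theory Defs
  imports Complex_Main
begin

type_synonym 'a ugraph = "'a set \<times> 'a set set"

definition simple_graph :: "'a ugraph \<Rightarrow> bool" where
  "simple_graph G \<longleftrightarrow> finite (fst G) \<and> (\<forall>e\<in>snd G. e \<subseteq> fst G \<and> card e = 2)"

definition subgraph :: "'a ugraph \<Rightarrow> 'a ugraph \<Rightarrow> bool" where
  "subgraph S G \<longleftrightarrow> simple_graph S \<and> fst S \<subseteq> fst G \<and> snd S \<subseteq> snd G"

definition isomorphic :: "'a ugraph \<Rightarrow> 'b ugraph \<Rightarrow> bool" where
  "isomorphic G H \<longleftrightarrow> (\<exists>f. bij_betw f (fst G) (fst H) \<and> (\<lambda>e. f ` e) ` snd G = snd H)"

definition copies :: "'t ugraph \<Rightarrow> 'a ugraph \<Rightarrow> 'a ugraph set" where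
  "copies T G = {S. subgraph S G \<and> isomorphic T S}"

definition cycle_graph :: "nat \<Rightarrow> nat ugraph" where
  "cycle_graph k = ({..<k}, {{i, Suc i mod k} |i. i < k})"

(* Host graphs have vertices in nat, which loses no generality since they are finite.
   The set under Max is finite by finite_copy_counts below; it is nonempty
   whenever H has an edge, because the edgeless graph is then H-free. *)
definition copy_counts :: "nat \<Rightarrow> 's ugraph \<Rightarrow> 't ugraph \<Rightarrow> nat set" where
  "copy_counts n T H =
     {card (copies T G) |G :: nat ugraph.
        simple_graph G \<and> card (fst G) = n \<and> copies H G = {}}"

definition gen_turan :: "nat \<Rightarrow> 's ugraph \<Rightarrow> 't ugraph \<Rightarrow> nat" where
  "gen_turan n T H = Max (copy_counts n T H)"

(* g = Theta(h) in n, with both constants uniform over l in L but the threshold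
   for the lower bound allowed to depend on l. *)
definition uniform_Theta ::
  "nat set \<Rightarrow> (nat \<Rightarrow> nat \<Rightarrow> real) \<Rightarrow> (nat \<Rightarrow> nat \<Rightarrow> real) \<Rightarrow> bool" where
  "uniform_Theta L g h \<longleftrightarrow>
     (\<exists>a A. 0 < a \<and> a \<le> A \<and>
        (\<forall>l\<in>L. (\<forall>n\<ge>1. g n l \<le> A * h n l) \<and>
               (\<exists>n\<^sub>0. \<forall>n\<ge>n\<^sub>0. a * h n l \<le> g n l)))"

lemma finite_copy_counts: "finite (copy_counts n T H)"
proof (rule finite_subset)
  show "copy_counts n T H \<subseteq> {..2 ^ n * 2 ^ 2 ^ n}"
  proof
    fix m assume "m \<in> copy_counts n T H"
    then obtain G :: "nat ugraph" where G: "simple_graph G" "card (fst G) = n"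
      and m: "m = card (copies T G)"
      unfolding copy_counts_def by blast
    have fin: "finite (fst G)" using G(1) by (simp add: simple_graph_def)
    have "copies T G \<subseteq> Pow (fst G) \<times> Pow (Pow (fst G))"
      using G(1) by (fastforce simp: copies_def subgraph_def simple_graph_def)
    then have "card (copies T G) \<le> card (Pow (fst G) \<times> Pow (Pow (fst G)))"
      using fin by (intro card_mono) auto
    then show "m \<in> {..2 ^ n * 2 ^ 2 ^ n}"
      using fin G(2) m by (simp add: card_cartesian_product card_Pow)
  qed
qed simp

lemma simple_graph_cycle: "simple_graph (cycle_graph k)" if "k \<ge> 3"
proof -
  have "i \<noteq> Suc i mod k" if "i < k" for i
    using that \<open>k \<ge> 3\<close> by (cases "Suc i = k") auto
  then show ?thesis
    using that by (auto simp: simple_graph_def cycle_graph_def)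
qed

end

theory Submission
  imports Defs "HOL-Library.FuncSet" "HOL-Library.Z2" "HOL-Algebra.Algebraic_Closure_Type"
begin

text \<open>
  Upper bounds. Colour the vertices with k colours and count closed sequences v whose entry v i has
  colour i mod k. Call position i + 1 of v rich if v i and v (i + 2) have more than 2 l common
  neighbours inside the family, and poor otherwise. A bipartite graph with more than l edges per
  vertex contains paths of every length up to l. Closing such a path up, through a fixed vertex if l
  is even and along a closed sequence of length k if l is odd, shows that rich triples starting at a
  vertex x number at most 2 l times the degree of x. Hence two consecutive steps can be chosen in
  O(l n) ways, and dropping an entry next to a rich position, or at a poor one, costs a factor O(l)
  only. For even k one entry is dropped. For odd k two entries are dropped such that the rest is a
  path with an odd number of vertices; this is possible when two rich positions are at distance 3,
  and otherwise there are two poor positions at distance 2, where it suffices that a vertex sees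
  O(l n) edges at distance two. If l = 4, all codegrees are at most 1 and the same count applies.

  Lower bounds. For l at least k + 2 take a clique on less than l / 2 vertices joined to an
  independent set, for smaller l blow up every second vertex of a k-cycle. For l = 4 join (a, b) to
  (c, d) in the plane over a field of order \<open>2 ^ m\<close> whenever b + d = a c; the k-cycles
  correspond to cyclic sequences of distinct a with vanishing sum of consecutive products, together
  with one free value b.
\<close>

section \<open>Cycles as cyclic lists\<close>

text \<open>At O(l n) per double step a path on 2 r + 1 vertices costs n (l n)^r. For even k, a path
  on k - 1 vertices and one further factor l give exactly l^(k/2) n^(k/2). For odd k, a walk over
  all k vertices has one factor n too many, and k - 1 vertices have the wrong parity; so two entries
  must go at the price of one factor l each, while the other k - 2 still have to be counted like one
  path. Which pair can go depends on where the rich and poor positions lie, and this is the source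
  of the case distinction. A rich triple is paid for with l times a degree, so products of two
  degrees have to be summed. Bounding them by squares leads to the number of three-vertex walks
  between two classes, which is O(l n^2). The field has characteristic two because the equation b +
  d = a c can then be summed around a cycle of either parity without signs: all second coordinates
  cancel and one of them stays free. Moreover some power of 4 lies within a factor 4 below any n, so
  nothing about the distribution of primes is involved.\<close>

definition cyc_lists :: "'a ugraph \<Rightarrow> nat \<Rightarrow> 'a list set" where
  "cyc_lists G k = {xs. length xs = k \<and> distinct xs \<and> set xs \<subseteq> fst G \<and>
     (\<forall>i<k. {xs ! i, xs ! (Suc i mod k)} \<in> snd G)}"

definition list_cycle :: "'a list \<Rightarrow> 'a ugraph" where
  "list_cycle xs =
     (set xs, {{xs ! i, xs ! (Suc i mod length xs)} |i. i < length xs})"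

lemma simple_graph_list_cycle:
  assumes "distinct xs" "length xs \<ge> 3"
  shows "simple_graph (list_cycle xs)"
proof -
  have "Suc i mod length xs \<noteq> i" if "i < length xs" for i
    using that assms by (cases "Suc i = length xs") auto
  moreover have "Suc i mod length xs < length xs" if "i < length xs" for i
    using that by (intro mod_less_divisor) auto
  ultimately have "xs ! i \<noteq> xs ! (Suc i mod length xs)" if "i < length xs" for i
    using assms(1) that by (metis nth_eq_iff_index_eq)
  then have "card {xs ! i, xs ! (Suc i mod length xs)} = 2" if "i < length xs" for i
    using that by simp
  moreover have "xs ! (Suc i mod length xs) \<in> set xs" if "i < length xs" for i
    using that by (intro nth_mem mod_less_divisor) auto
  ultimately show ?thesis
    by (auto simp: simple_graph_def list_cycle_def)
qed

text \<open>An isomorphism from the standard cycle amounts to a cyclic listing of the vertices of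
  the copy. Copies can therefore be handled through lists, although each has several
  listings.\<close>

lemma copies_cycle_graph:
  assumes "k \<ge> 3"
  shows "copies (cycle_graph k) G = list_cycle ` cyc_lists G k"
proof (intro equalityI subsetI)
  fix S assume "S \<in> copies (cycle_graph k) G"
  then obtain f where S: "fst S \<subseteq> fst G" "snd S \<subseteq> snd G"
    and f: "bij_betw f {..<k} (fst S)"
    and e: "(\<lambda>e. f ` e) ` {{i, Suc i mod k} |i. i < k} = snd S"
    by (auto simp: copies_def subgraph_def isomorphic_def cycle_graph_def)
  define xs where "xs = map f [0..<k]"
  have mk: "Suc i mod k < k" for i
    using assms by simp
  have edges: "snd S = {{xs ! i, xs ! (Suc i mod k)} |i. i < k}"
    unfolding e[symmetric] setcompr_eq_image image_image
    using mk by (intro image_cong) (auto simp: xs_def)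
  have "set xs = fst S"
    using f by (auto simp: xs_def bij_betw_def atLeast0LessThan)
  moreover have "distinct xs"
    using f by (auto simp: xs_def bij_betw_def distinct_map atLeast0LessThan)
  moreover have "length xs = k"
    by (simp add: xs_def)
  ultimately have "S = list_cycle xs" "xs \<in> cyc_lists G k"
    using S edges by (auto simp: list_cycle_def cyc_lists_def prod_eq_iff)
  then show "S \<in> list_cycle ` cyc_lists G k" by blast
next
  fix S assume "S \<in> list_cycle ` cyc_lists G k"
  then obtain xs where xs: "length xs = k" "distinct xs" "set xs \<subseteq> fst G"
    "\<And>i. i < k \<Longrightarrow> {xs ! i, xs ! (Suc i mod k)} \<in> snd G" and S: "S = list_cycle xs"
    by (auto simp: cyc_lists_def)
  have mk: "Suc i mod k < k" for i
    using assms by simp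
  have "bij_betw (\<lambda>i. xs ! i) {..<k} (set xs)"
    using xs by (intro bij_betw_nth) auto
  moreover have "(\<lambda>e. (\<lambda>i. xs ! i) ` e) ` {{i, Suc i mod k} |i. i < k} = snd S"
    using xs(1) mk unfolding S list_cycle_def snd_conv setcompr_eq_image image_image
    by (intro image_cong) auto
  ultimately have "isomorphic (cycle_graph k) S"
    by (auto simp: isomorphic_def cycle_graph_def S list_cycle_def intro!: exI[of _ "\<lambda>i. xs ! i"])
  moreover have "subgraph S G"
    using simple_graph_list_cycle[of xs] xs assms
    by (auto simp: subgraph_def S) (auto simp: list_cycle_def)
  ultimately show "S \<in> copies (cycle_graph k) G"
    by (simp add: copies_def)
qed

lemma cyc_lists_subset: "cyc_lists G k \<subseteq> {xs. set xs \<subseteq> fst G \<and> length xs = k}"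
  by (auto simp: cyc_lists_def)

lemma finite_cyc_lists: "simple_graph G \<Longrightarrow> finite (cyc_lists G k)"
  by (rule finite_subset[OF cyc_lists_subset])
    (auto simp: simple_graph_def intro: finite_lists_length_eq)

lemma finite_copies_cycle_graph:
  "simple_graph G \<Longrightarrow> k \<ge> 3 \<Longrightarrow> finite (copies (cycle_graph k) G)"
  by (simp add: copies_cycle_graph finite_cyc_lists)

lemma card_copies_le_cyc_lists:
  "simple_graph G \<Longrightarrow> k \<ge> 3 \<Longrightarrow> card (copies (cycle_graph k) G) \<le> card (cyc_lists G k)"
  by (simp add: copies_cycle_graph card_image_le finite_cyc_lists)

text \<open>Every listing of a copy is a word of length \<open>k\<close> over its \<open>k\<close>
  vertices. This crude multiplicity is good enough, since constants may depend on
  \<open>k\<close>.\<close>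

lemma card_cyc_lists_le_copies:
  assumes "simple_graph G" "k \<ge> 3"
  shows "card (cyc_lists G k) \<le> k ^ k * card (copies (cycle_graph k) G)"
proof -
  let ?C = "copies (cycle_graph k) G"
  have "cyc_lists G k \<subseteq> (\<Union>S\<in>?C. {xs. set xs \<subseteq> fst S \<and> length xs = k})"
    using assms(2) by (auto simp: copies_cycle_graph list_cycle_def cyc_lists_def)
  moreover have fin: "finite (fst S)" if "S \<in> ?C" for S
    using that by (simp add: copies_def subgraph_def simple_graph_def)
  moreover have "card (fst S) = k" if "S \<in> ?C" for S
    using that assms(2)
    by (auto simp: copies_cycle_graph list_cycle_def cyc_lists_def distinct_card)
  moreover have "finite ?C"
    using assms by (rule finite_copies_cycle_graph)
  ultimately have "card (cyc_lists G k) \<le> (\<Sum>S\<in>?C. card {xs. set xs \<subseteq> fst S \<and> length xs = k})"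
    by (intro order_trans[OF card_mono card_UN_le] finite_UN_I finite_lists_length_eq)
  also have "\<dots> = (\<Sum>S\<in>?C. k ^ k)"
    using fin \<open>\<And>S. S \<in> ?C \<Longrightarrow> card (fst S) = k\<close>
    by (intro sum.cong) (auto simp: card_lists_length_eq)
  finally show ?thesis by (simp add: mult.commute)
qed

lemma successively_iff_nth:
  "successively P xs \<longleftrightarrow> (\<forall>i. Suc i < length xs \<longrightarrow> P (xs ! i) (xs ! Suc i))"
proof (induction P xs rule: successively.induct)
  case (3 P x y zs)
  have "(\<forall>i. Suc i < length (x # y # zs) \<longrightarrow> P ((x # y # zs) ! i) ((x # y # zs) ! Suc i)) \<longleftrightarrow>
    P x y \<and> (\<forall>i. Suc i < length (y # zs) \<longrightarrow> P ((y # zs) ! i) ((y # zs) ! Suc i))"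
    by (auto simp: nth_Cons split: nat.splits)
  with 3 show ?case by simp
qed auto

lemma cyc_listsI:
  assumes "length xs = k" "k \<ge> 1" "distinct xs" "set xs \<subseteq> fst G"
    and "successively (\<lambda>x y. {x, y} \<in> snd G) xs" "{last xs, hd xs} \<in> snd G"
  shows "xs \<in> cyc_lists G k"
proof -
  have ne: "xs \<noteq> []" using assms(1,2) by auto
  have "{xs ! i, xs ! (Suc i mod k)} \<in> snd G" if "i < k" for i
  proof (cases "Suc i = k")
    case True
    then have "i = length xs - 1" using assms(1) by simp
    then have "xs ! i = last xs" "xs ! 0 = hd xs"
      using ne by (simp_all add: last_conv_nth hd_conv_nth)
    then show ?thesis using True assms(6) by simp
  next
    case False
    then have "Suc i < k" using that by simp
    then show ?thesis
      using assms(1,5) by (simp add: successively_iff_nth)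
  qed
  then show ?thesis using assms(1,3,4) by (simp add: cyc_lists_def)
qed

section \<open>Bounds for the extremal function\<close>

lemma copy_counts_nonempty:
  assumes "l \<ge> 3"
  shows "copy_counts n T (cycle_graph l) \<noteq> {}"
proof -
  let ?G = "({..<n}, {}) :: nat ugraph"
  have "cyc_lists ?G l = {}"
    using assms by (auto simp: cyc_lists_def intro!: exI[of _ 0])
  then have "copies (cycle_graph l) ?G = {}"
    using assms by (simp add: copies_cycle_graph)
  then show ?thesis
    unfolding copy_counts_def
    by (intro ex_in_conv[THEN iffD1]) (auto simp: simple_graph_def intro!: exI[of _ "{..<n}"] exI[of _ ?G])
qed

text \<open>Counting listings instead of copies only overestimates, so the upper bounds are proved
  for \<open>cyc_lists\<close> throughout.\<close>

lemma gen_turan_cycle_le: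
  assumes "k \<ge> 3" "l \<ge> 3"
    and "\<And>G :: nat ugraph. simple_graph G \<Longrightarrow> card (fst G) = n \<Longrightarrow> cyc_lists G l = {} \<Longrightarrow>
      card (cyc_lists G k) \<le> B"
  shows "gen_turan n (cycle_graph k) (cycle_graph l) \<le> B"
proof -
  have "gen_turan n (cycle_graph k) (cycle_graph l) \<in> copy_counts n (cycle_graph k) (cycle_graph l)"
    unfolding gen_turan_def using assms(2)
    by (intro Max_in finite_copy_counts copy_counts_nonempty)
  then obtain G :: "nat ugraph" where G: "simple_graph G" "card (fst G) = n"
    "copies (cycle_graph l) G = {}"
    and eq: "gen_turan n (cycle_graph k) (cycle_graph l) = card (copies (cycle_graph k) G)"
    by (auto simp: copy_counts_def)
  have "cyc_lists G l = {}"
    using G(3) assms(2) by (simp add: copies_cycle_graph)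
  with G assms(3)[of G] card_copies_le_cyc_lists[of G k] assms(1) eq show ?thesis
    by simp
qed

lemma gen_turan_cycle_ge:
  fixes G :: "'a ugraph"
  assumes "k \<ge> 3" "l \<ge> 3" "simple_graph G" "card (fst G) \<le> n" "cyc_lists G l = {}"
  shows "card (copies (cycle_graph k) G) \<le> gen_turan n (cycle_graph k) (cycle_graph l)"
proof -
  have "finite (fst G)" using assms by (simp add: simple_graph_def)
  then obtain f :: "'a \<Rightarrow> nat" where f: "bij_betw f (fst G) {0..<card (fst G)}"
    using ex_bij_betw_finite_nat by blast
  define H :: "nat ugraph" where "H = ({..<n}, (\<lambda>e. f ` e) ` snd G)"
  have inj: "inj_on f (fst G)" and ran: "f ` fst G \<subseteq> {..<n}"
    using f assms(4) by (auto simp: bij_betw_def)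
  have edge: "e \<subseteq> fst G" if "e \<in> snd G" for e
    using that assms(3) by (simp add: simple_graph_def)
  have H: "simple_graph H"
    unfolding simple_graph_def
  proof (intro conjI ballI)
    fix e assume "e \<in> snd H"
    then obtain e' where e': "e' \<in> snd G" "e = f ` e'" by (auto simp: H_def)
    then show "e \<subseteq> fst H" using ran edge by (force simp: H_def)
    have "card e' = 2" using assms(3) e' by (simp add: simple_graph_def)
    then show "card e = 2"
      using card_image[OF inj_on_subset[OF inj edge[OF e'(1)]]] e' by simp
  qed (simp add: H_def)
  have mod: "Suc i mod j < j" if "i < j" for i j
    using that by (cases j) auto
  have no: "cyc_lists H l = {}"
  proof (rule ccontr)
    assume "cyc_lists H l \<noteq> {}"
    then obtain ys where ys: "length ys = l" "distinct ys"
      "\<And>i. i < l \<Longrightarrow> {ys ! i, ys ! (Suc i mod l)} \<in> snd H"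
      by (auto simp: cyc_lists_def)
    define g where "g = inv_into (fst G) f"
    have gf: "g (f x) = x" if "x \<in> fst G" for x
      using that inj by (simp add: g_def)
    \<comment> \<open>All edges of \<open>H\<close> are images of edges of \<open>G\<close>, so a
      cycle of \<open>H\<close> stays inside the image of \<open>f\<close> and can be pulled
      back.\<close>
    have in_img: "ys ! i \<in> f ` fst G" "{g (ys ! i), g (ys ! (Suc i mod l))} \<in> snd G" if i: "i < l" for i
    proof -
      obtain e where e: "e \<in> snd G" "{ys ! i, ys ! (Suc i mod l)} = f ` e"
        using ys(3)[OF i] unfolding H_def snd_conv image_iff by blast
      have "f ` e \<subseteq> f ` fst G" using edge[OF e(1)] by blast
      then show "ys ! i \<in> f ` fst G" unfolding e(2)[symmetric] by simp
      have "{g (ys ! i), g (ys ! (Suc i mod l))} = g ` f ` e"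
        unfolding e(2)[symmetric] by simp
      also have "\<dots> = e"
        using gf edge[OF e(1)] by (force simp: image_image)
      finally show "{g (ys ! i), g (ys ! (Suc i mod l))} \<in> snd G" using e by simp
    qed
    have sub: "set ys \<subseteq> f ` fst G"
      using in_img(1) ys(1) by (auto simp: in_set_conv_nth)
    have "distinct (map g ys)"
      using ys(2) sub inj_on_inv_into[OF sub] by (simp add: distinct_map g_def)
    moreover have "set (map g ys) \<subseteq> fst G"
      using sub gf by auto
    ultimately have "map g ys \<in> cyc_lists G l"
      using ys(1) in_img(2) mod by (auto simp: cyc_lists_def)
    then show False using assms(5) by blast
  qed
  have "card (copies (cycle_graph k) G) \<le> card (copies (cycle_graph k) H)"
  proof (rule card_inj_on_le)
    let ?\<phi> = "\<lambda>S :: 'a ugraph. (f ` fst S, (\<lambda>e. f ` e) ` snd S)"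
    have sub: "fst S \<subseteq> fst G" "snd S \<subseteq> Pow (fst G)" if "S \<in> copies (cycle_graph k) G" for S
      using that edge by (auto simp: copies_def subgraph_def)
    show "inj_on ?\<phi> (copies (cycle_graph k) G)"
    proof (rule inj_onI)
      fix S T assume ST: "S \<in> copies (cycle_graph k) G" "T \<in> copies (cycle_graph k) G"
        and eq: "?\<phi> S = ?\<phi> T"
      have "fst S = fst T"
        using eq inj_on_image_eq_iff[OF inj sub(1)[OF ST(1)] sub(1)[OF ST(2)]] by simp
      moreover have "snd S = snd T"
        using eq inj_on_image_eq_iff[OF inj_on_image_Pow[OF inj] sub(2)[OF ST(1)] sub(2)[OF ST(2)]]
        by simp
      ultimately show "S = T" by (simp add: prod_eq_iff)
    qed
    show "?\<phi> ` copies (cycle_graph k) G \<subseteq> copies (cycle_graph k) H"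
    proof
      fix T assume "T \<in> ?\<phi> ` copies (cycle_graph k) G"
      then obtain xs where xs: "length xs = k" "distinct xs" "set xs \<subseteq> fst G"
        "\<And>i. i < k \<Longrightarrow> {xs ! i, xs ! (Suc i mod k)} \<in> snd G"
        and T: "T = ?\<phi> (list_cycle xs)"
        using assms(1) by (auto simp: copies_cycle_graph cyc_lists_def)
      have "{map f xs ! i, map f xs ! (Suc i mod k)} \<in> snd H" if "i < k" for i
      proof -
        have "{map f xs ! i, map f xs ! (Suc i mod k)} = f ` {xs ! i, xs ! (Suc i mod k)}"
          using that mod[OF that] xs(1) by simp
        then show ?thesis using xs(4)[OF that] by (simp only: H_def snd_conv imageI)
      qed
      then have "map f xs \<in> cyc_lists H k"
        using xs ran inj_on_subset[OF inj xs(3)]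
        by (simp add: cyc_lists_def distinct_map H_def) blast
      moreover have "T = list_cycle (map f xs)"
        using xs(1) mod unfolding T list_cycle_def setcompr_eq_image
        by (auto simp: image_image intro!: image_cong)
      ultimately show "T \<in> copies (cycle_graph k) H"
        using assms(1) by (auto simp: copies_cycle_graph)
    qed
    show "finite (copies (cycle_graph k) H)"
      using H assms(1) by (rule finite_copies_cycle_graph)
  qed
  also have "card (copies (cycle_graph k) H) \<in> copy_counts n (cycle_graph k) (cycle_graph l)"
  proof -
    have "card (fst H) = n" "copies (cycle_graph l) H = {}"
      using no assms(2) by (simp_all add: copies_cycle_graph) (simp add: H_def)
    then show ?thesis using H unfolding copy_counts_def by blast
  qed
  then have "card (copies (cycle_graph k) H) \<le> gen_turan n (cycle_graph k) (cycle_graph l)"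
    unfolding gen_turan_def by (intro Max_ge finite_copy_counts)
  finally show ?thesis .
qed

section \<open>Long paths in bipartite graphs with many edges\<close>

text \<open>Edges of a bipartite graph are kept as ordered pairs from one side to the other, so that
  \<open>card E\<close> counts each of them once; paths need both directions.\<close>

definition und :: "('a \<times> 'a) set \<Rightarrow> 'a \<Rightarrow> 'a \<Rightarrow> bool" where
  "und E x y \<longleftrightarrow> (x, y) \<in> E \<or> (y, x) \<in> E"

text \<open>Deleting a vertex of degree at most \<open>l\<close> destroys at most \<open>l\<close>
  edges, so the inequality between edges and vertices survives, and the deletions stop before the
  graph is empty.\<close>

lemma min_degree_subset:
  assumes "finite W" and asym: "\<And>x y. (x, y) \<in> E \<Longrightarrow> (y, x) \<notin> E"
    and "card (E \<inter> W \<times> W) > l * card W"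
  shows "\<exists>W'\<subseteq>W. W' \<noteq> {} \<and> (\<forall>x\<in>W'. card {y \<in> W'. und E x y} > l)"
  using assms(1,3)
proof (induction W rule: finite_psubset_induct)
  case (psubset W)
  show ?case
  proof (cases "\<forall>x\<in>W. card {y \<in> W. und E x y} > l")
    case True
    moreover have "W \<noteq> {}" using psubset.prems by auto
    ultimately show ?thesis by blast
  next
    case False
    then obtain x where x: "x \<in> W" "card {y \<in> W. und E x y} \<le> l" by force
    let ?W = "W - {x}" and ?D = "{e \<in> E \<inter> W \<times> W. fst e = x \<or> snd e = x}"
    \<comment> \<open>An edge at \<open>x\<close> is recovered from its other end because
      \<open>E\<close> contains no pair in both directions.\<close>
    have "inj_on (\<lambda>e. if fst e = x then snd e else fst e) ?D"
      using asym by (auto simp: inj_on_def)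
    moreover have "(\<lambda>e. if fst e = x then snd e else fst e) ` ?D \<subseteq> {y \<in> W. und E x y}"
      by (auto simp: und_def)
    moreover have "finite {y \<in> W. und E x y}" using psubset.hyps by simp
    ultimately have "card ?D \<le> card {y \<in> W. und E x y}"
      by (rule card_inj_on_le)
    then have D: "card ?D \<le> l" using x by simp
    have "E \<inter> W \<times> W \<subseteq> (E \<inter> ?W \<times> ?W) \<union> ?D"
    proof
      fix e assume "e \<in> E \<inter> W \<times> W"
      then show "e \<in> (E \<inter> ?W \<times> ?W) \<union> ?D" by (cases e) (simp, blast)
    qed
    moreover have "finite ((E \<inter> ?W \<times> ?W) \<union> ?D)"
      by (rule finite_subset[of _ "W \<times> W"]) (blast, simp add: psubset.hyps)
    ultimately have "card (E \<inter> W \<times> W) \<le> card ((E \<inter> ?W \<times> ?W) \<union> ?D)"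
      by (rule card_mono[rotated])
    also have "\<dots> \<le> card (E \<inter> ?W \<times> ?W) + card ?D"
      by (rule card_Un_le)
    finally have "card (E \<inter> W \<times> W) \<le> card (E \<inter> ?W \<times> ?W) + card ?D" .
    moreover have "card W = Suc (card ?W)"
      using x psubset.hyps by (metis card.remove)
    ultimately have "card (E \<inter> ?W \<times> ?W) > l * card ?W"
      using psubset.prems D by simp
    then obtain W' where "W' \<subseteq> ?W" "W' \<noteq> {}" "\<forall>x\<in>W'. card {y \<in> W'. und E x y} > l"
      using psubset.IH[of ?W] x by blast
    then show ?thesis by blast
  qed
qed

text \<open>The path is extended at its end as long as the forbidden vertices, those of
  \<open>U\<close> and those already used, number at most \<open>l\<close>. The start
  \<open>x\<close> itself may lie in \<open>U\<close>.\<close>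

lemma greedy_path:
  assumes "finite W" "\<And>x. x \<in> W \<Longrightarrow> card {y \<in> W. R x y} > l"
    and "x \<in> W" "finite U" "card U + t \<le> l"
  shows "\<exists>xs. length xs = Suc t \<and> hd xs = x \<and> distinct xs \<and> set xs \<subseteq> W \<and>
    set (tl xs) \<inter> U = {} \<and> successively R xs"
  using assms(5)
proof (induction t)
  case 0
  then show ?case using assms(3) by (intro exI[of _ "[x]"]) auto
next
  case (Suc t)
  then obtain xs where xs: "length xs = Suc t" "hd xs = x" "distinct xs" "set xs \<subseteq> W"
    "set (tl xs) \<inter> U = {}" "successively R xs" by auto
  have "last xs \<in> W" using xs by (metis Zero_not_Suc last_in_set list.size(3) subsetD)
  have "card (set xs \<union> U) \<le> l"
    using card_Un_le[of "set xs" U] xs Suc.prems by (simp add: distinct_card)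
  also have "l < card {y \<in> W. R (last xs) y}"
    using assms(2) \<open>last xs \<in> W\<close> by blast
  finally have "\<not> {y \<in> W. R (last xs) y} \<subseteq> set xs \<union> U"
    using assms(4) by (metis List.finite_set card_mono finite_UnI leD)
  then obtain y where "y \<in> W" "R (last xs) y" "y \<notin> set xs" "y \<notin> U" by blast
  then show ?case
    using xs by (intro exI[of _ "xs @ [y]"])
      (auto simp: successively_append_iff tl_append2 simp flip: length_greater_0_conv)
qed

lemma und_alternate:
  assumes "E \<subseteq> A \<times> B" "A \<inter> B = {}" "successively (und E) xs" "i < length xs"
  shows "(hd xs \<in> A \<longrightarrow> set xs \<subseteq> A \<union> B \<longrightarrow> (xs ! i \<in> (if even i then A else B)))"
    and "(hd xs \<in> B \<longrightarrow> set xs \<subseteq> A \<union> B \<longrightarrow> (xs ! i \<in> (if even i then B else A)))"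
proof -
  have *: "Suc i < length xs \<Longrightarrow> und E (xs ! i) (xs ! Suc i)" for i
    using assms(3) by (simp add: successively_iff_nth)
  have "xs \<noteq> []" using assms(4) by auto
  then have [simp]: "hd xs = xs ! 0" by (rule hd_conv_nth)
  show "(hd xs \<in> A \<longrightarrow> set xs \<subseteq> A \<union> B \<longrightarrow> (xs ! i \<in> (if even i then A else B)))"
    using assms(4)
  proof (induction i)
    case (Suc i)
    then show ?case using *[of i] assms(1,2) by (auto simp: und_def split: if_splits)
  qed simp
  show "(hd xs \<in> B \<longrightarrow> set xs \<subseteq> A \<union> B \<longrightarrow> (xs ! i \<in> (if even i then B else A)))"
    using assms(4)
  proof (induction i)
    case (Suc i)
    then show ?case using *[of i] assms(1,2) by (auto simp: und_def split: if_splits)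
  qed simp
qed

lemma bip_min_degree:
  assumes "finite E" "fst ` E \<inter> snd ` E = {}"
    and "card E > l * (card (fst ` E) + card (snd ` E))"
  obtains W where "finite W" "W \<subseteq> fst ` E \<union> snd ` E" "\<And>x. x \<in> W \<Longrightarrow> card {y \<in> W. und E x y} > l"
    and "W \<inter> fst ` E \<noteq> {}" "W \<inter> snd ` E \<noteq> {}"
proof -
  let ?V = "fst ` E \<union> snd ` E"
  have asym: "(y, x) \<notin> E" if "(x, y) \<in> E" for x y
    using assms(2) that by force
  have "E \<inter> ?V \<times> ?V = E" by force
  moreover have "card ?V = card (fst ` E) + card (snd ` E)"
    using assms(1,2) by (intro card_Un_disjoint) auto
  ultimately have "\<exists>W'\<subseteq>?V. W' \<noteq> {} \<and> (\<forall>x\<in>W'. card {y \<in> W'. und E x y} > l)"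
    using assms asym by (intro min_degree_subset) auto
  then obtain W where W: "W \<subseteq> ?V" "W \<noteq> {}" "\<And>x. x \<in> W \<Longrightarrow> card {y \<in> W. und E x y} > l"
    by blast
  obtain x where x: "x \<in> W" using W by blast
  have "{y \<in> W. und E x y} \<noteq> {}" using W(3)[OF x] by (metis card.empty not_less_zero)
  then obtain y where y: "y \<in> W" "und E x y" by blast
  have "finite W" using W(1) assms(1) finite_subset by blast
  moreover have "W \<inter> fst ` E \<noteq> {}" "W \<inter> snd ` E \<noteq> {}"
    using x y by (force simp: und_def)+
  ultimately show ?thesis using W that by blast
qed

lemma bip_path:
  assumes "finite E" "fst ` E \<inter> snd ` E = {}"
    and "card E > l * (card (fst ` E) + card (snd ` E))" "t \<le> l"
  obtains xs where "length xs = Suc t" "distinct xs" "successively (und E) xs"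
    "hd xs \<in> fst ` E" "last xs \<in> (if even t then fst ` E else snd ` E)"
    "\<And>i. i \<le> t \<Longrightarrow> xs ! i \<in> (if even i then fst ` E else snd ` E)"
proof -
  obtain W where W: "finite W" "W \<subseteq> fst ` E \<union> snd ` E"
    "\<And>x. x \<in> W \<Longrightarrow> card {y \<in> W. und E x y} > l" "W \<inter> fst ` E \<noteq> {}"
    using bip_min_degree[OF assms(1-3)] by metis
  obtain x where x: "x \<in> W" "x \<in> fst ` E" using W by blast
  obtain xs where xs: "length xs = Suc t" "hd xs = x" "distinct xs" "set xs \<subseteq> W"
    "successively (und E) xs"
    using greedy_path[where R = "und E" and U = "{}" and t = t, OF W(1,3) x(1)] assms(4) by auto
  have alt: "xs ! i \<in> (if even i then fst ` E else snd ` E)" if "i \<le> t" for i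
  proof -
    have "E \<subseteq> fst ` E \<times> snd ` E" by force
    moreover have "set xs \<subseteq> fst ` E \<union> snd ` E" using xs(4) W(2) by (rule order_trans)
    moreover have "hd xs \<in> fst ` E" "i < length xs" using xs x that by simp_all
    ultimately show ?thesis
      using und_alternate(1)[OF _ assms(2) xs(5)] by blast
  qed
  have "last xs = xs ! t" using xs(1) by (metis Zero_not_Suc diff_Suc_1 last_conv_nth list.size(3))
  then show ?thesis
    using that[of xs] xs x alt[of t] alt by simp
qed

text \<open>Once every vertex of one side has large degree, its contribution to the edge bound is absorbed.\<close>

lemma bip_edges_le:
  assumes "finite E" "fst ` E \<inter> snd ` E = {}"
    and "\<And>b. b \<in> snd ` E \<Longrightarrow> card {a. (a, b) \<in> E} > 2 * l"
    and "\<And>xs. length xs = Suc t \<Longrightarrow> distinct xs \<Longrightarrow> successively (und E) xs \<Longrightarrow>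
      hd xs \<in> fst ` E \<Longrightarrow> last xs \<in> (if even t then fst ` E else snd ` E) \<Longrightarrow>
      (\<And>i. i \<le> t \<Longrightarrow> xs ! i \<in> (if even i then fst ` E else snd ` E)) \<Longrightarrow> False"
    and "t \<le> l"
  shows "card E \<le> 2 * l * card (fst ` E)"
proof -
  have "\<not> card E > l * (card (fst ` E) + card (snd ` E))"
    using bip_path[OF assms(1,2) _ assms(5)] assms(4) by metis
  then have 1: "card E \<le> l * (card (fst ` E) + card (snd ` E))" by simp
  have "E = (\<Union>b\<in>snd ` E. (\<lambda>a. (a, b)) ` {a. (a, b) \<in> E})" by force
  moreover have "card (\<Union>b\<in>snd ` E. (\<lambda>a. (a, b)) ` {a. (a, b) \<in> E}) =
      (\<Sum>b\<in>snd ` E. card ((\<lambda>a. (a, b)) ` {a. (a, b) \<in> E}))"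
  proof (rule card_UN_disjoint)
    have "(\<lambda>a. (a, b)) ` {a. (a, b) \<in> E} \<subseteq> E" for b by auto
    then show "\<forall>b\<in>snd ` E. finite ((\<lambda>a. (a, b)) ` {a. (a, b) \<in> E})"
      using assms(1) finite_subset by blast
  qed (use assms(1) in auto)
  moreover have "\<dots> = (\<Sum>b\<in>snd ` E. card {a. (a, b) \<in> E})"
    by (intro sum.cong card_image) (auto simp: inj_on_def)
  ultimately have "card E = (\<Sum>b\<in>snd ` E. card {a. (a, b) \<in> E})" by simp
  also have "\<dots> \<ge> (\<Sum>b\<in>snd ` E. 2 * l)"
    using assms(3) by (intro sum_mono) (simp add: less_imp_le)
  finally have "2 * l * card (snd ` E) \<le> card E" by (simp add: mult.commute)
  \<comment> \<open>Doubling \<open>1\<close> turns the contribution of the second side into at most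
    \<open>card E\<close>, which is then subtracted.\<close>
  with 1 show ?thesis by (simp add: algebra_simps)
qed

lemma bip_edges_le':
  assumes "finite E" "fst ` E \<inter> snd ` E = {}"
    and "\<And>a. a \<in> fst ` E \<Longrightarrow> card {b. (a, b) \<in> E} > 2 * l"
    and "\<And>xs. length xs = Suc t \<Longrightarrow> distinct xs \<Longrightarrow> successively (und E) xs \<Longrightarrow>
      hd xs \<in> snd ` E \<Longrightarrow> last xs \<in> (if even t then snd ` E else fst ` E) \<Longrightarrow>
      (\<And>i. i \<le> t \<Longrightarrow> xs ! i \<in> (if even i then snd ` E else fst ` E)) \<Longrightarrow> False"
    and "t \<le> l"
  shows "card E \<le> 2 * l * card (snd ` E)"
proof -
  have 1: "fst ` (E\<inverse>) = snd ` E" "snd ` (E\<inverse>) = fst ` E" by force+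
  have 2: "und (E\<inverse>) = und E" by (auto simp: und_def fun_eq_iff)
  have "card (E\<inverse>) \<le> 2 * l * card (fst ` (E\<inverse>))"
  proof (rule bip_edges_le[where t = t])
    show "fst ` (E\<inverse>) \<inter> snd ` (E\<inverse>) = {}" unfolding 1 using assms(2) by blast
    fix xs assume "length xs = Suc t" "distinct xs" "successively (und (E\<inverse>)) xs"
      "hd xs \<in> fst ` (E\<inverse>)" "last xs \<in> (if even t then fst ` (E\<inverse>) else snd ` (E\<inverse>))"
      "\<And>i. i \<le> t \<Longrightarrow> xs ! i \<in> (if even i then fst ` (E\<inverse>) else snd ` (E\<inverse>))"
    then show False unfolding 1 2 by (rule assms(4))
  qed (use assms in \<open>simp_all only: 1 2 converse_iff finite_converse\<close>)
  then show ?thesis by (simp add: 1)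
qed

section \<open>Counting families of closed sequences\<close>

text \<open>The counting device behind the upper bounds: if \<open>f\<close> and \<open>g\<close>
  together determine \<open>h\<close>, then choosing the value of \<open>f\<close> first and that of
  \<open>g\<close> second overcounts the values of \<open>h\<close>. The number of choices for
  \<open>g\<close> may vary with the value of \<open>f\<close>, as degree weights require.\<close>

lemma card_image_fiber_sum:
  assumes "finite Z"
    and "\<And>v. v \<in> Z \<Longrightarrow> card (g ` {w \<in> Z. f w = f v}) \<le> M (f v)"
    and "\<And>w w'. w \<in> Z \<Longrightarrow> w' \<in> Z \<Longrightarrow> f w = f w' \<Longrightarrow> g w = g w' \<Longrightarrow> h w = h w'"
  shows "card (h ` Z) \<le> (\<Sum>y\<in>f ` Z. M y)"
proof -
  have "card (h ` {w \<in> Z. f w = f v}) \<le> M (f v)" if "v \<in> Z" for v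
  proof -
    let ?S = "{w \<in> Z. f w = f v}"
    \<comment> \<open>On one fibre of \<open>f\<close>, \<open>h\<close> factors through
      \<open>g\<close>; the choice operator supplies the factoring map.\<close>
    have "h ` ?S \<subseteq> (\<lambda>y. h (SOME w. w \<in> ?S \<and> g w = y)) ` g ` ?S"
    proof
      fix y assume "y \<in> h ` ?S"
      then obtain w where w: "w \<in> ?S" "y = h w" by blast
      define w' where "w' = (SOME w'. w' \<in> ?S \<and> g w' = g w)"
      have "w' \<in> ?S \<and> g w' = g w" unfolding w'_def by (rule someI[of _ w]) (use w in simp)
      then have "h w' = y" using w assms(3)[of w' w] by simp
      then show "y \<in> (\<lambda>y. h (SOME w. w \<in> ?S \<and> g w = y)) ` g ` ?S"
        using w(1) unfolding w'_def by blast
    qed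
    then have "card (h ` ?S) \<le> card (g ` ?S)"
    proof -
      assume "h ` ?S \<subseteq> (\<lambda>y. h (SOME w. w \<in> ?S \<and> g w = y)) ` g ` ?S"
      moreover have "finite (g ` ?S)" using assms(1) by simp
      ultimately show ?thesis by (meson card_image_le card_mono finite_imageI order_trans)
    qed
    then show ?thesis using assms(2)[OF that] by simp
  qed
  moreover have "h ` Z = (\<Union>y\<in>f ` Z. h ` {w \<in> Z. f w = y})" by blast
  moreover have "card (\<Union>y\<in>f ` Z. h ` {w \<in> Z. f w = y}) \<le> (\<Sum>y\<in>f ` Z. card (h ` {w \<in> Z. f w = y}))"
    using assms(1) by (intro card_UN_le) simp
  moreover have "\<dots> \<le> (\<Sum>y\<in>f ` Z. M y)"
    using calculation(1) by (intro sum_mono) auto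
  ultimately show ?thesis by simp
qed

lemma card_image_fiber:
  assumes "finite Z"
    and "\<And>v. v \<in> Z \<Longrightarrow> card (g ` {w \<in> Z. f w = f v}) \<le> M"
    and "\<And>w w'. w \<in> Z \<Longrightarrow> w' \<in> Z \<Longrightarrow> f w = f w' \<Longrightarrow> g w = g w' \<Longrightarrow> h w = h w'"
  shows "card (h ` Z) \<le> card (f ` Z) * M"
proof -
  have "card (h ` Z) \<le> (\<Sum>y\<in>f ` Z. M)"
    by (rule card_image_fiber_sum[where g = g]) (fact assms)+
  then show ?thesis by simp
qed

text \<open>Applied with \<open>A\<close> a set of walks and \<open>q\<close> one of their ends: a
  weight of the end vertex is multiplied by the number of walks that end there.\<close>

lemma sum_fiber_le:
  fixes \<phi> :: "'b \<Rightarrow> nat"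
  assumes "finite A" "finite D" "q ` A \<subseteq> D" "\<And>x. x \<in> D \<Longrightarrow> card {y \<in> A. q y = x} \<le> B x"
  shows "(\<Sum>y\<in>A. \<phi> (q y)) \<le> (\<Sum>x\<in>D. \<phi> x * B x)"
proof -
  have "(\<Sum>y\<in>A. \<phi> (q y)) = (\<Sum>x\<in>D. \<Sum>y\<in>{y \<in> A. q y = x}. \<phi> (q y))"
    using sum.group[OF assms(1-3), of "\<lambda>y. \<phi> (q y)"] by simp
  also have "\<dots> = (\<Sum>x\<in>D. \<phi> x * card {y \<in> A. q y = x})"
    by (intro sum.cong) auto
  also have "\<dots> \<le> (\<Sum>x\<in>D. \<phi> x * B x)"
    using assms(4) by (intro sum_mono mult_le_mono2)
  finally show ?thesis .
qed

section \<open>Rich and poor positions in a closed family\<close>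

definition mids :: "(nat \<Rightarrow> 'a) set \<Rightarrow> nat \<Rightarrow> 'a \<Rightarrow> 'a \<Rightarrow> 'a set" where
  "mids Z i a b = (\<lambda>w. w (i + 1)) ` {w \<in> Z. w i = a \<and> w (i + 2) = b}"

text \<open>The index is that of the left neighbour: \<open>rich L Z i\<close> is about the entry
  \<open>i + 1\<close>, and it depends only on the values at \<open>i\<close> and
  \<open>i + 2\<close>.\<close>

definition rich :: "nat \<Rightarrow> (nat \<Rightarrow> 'a) set \<Rightarrow> nat \<Rightarrow> (nat \<Rightarrow> 'a) \<Rightarrow> bool" where
  "rich L Z i v \<longleftrightarrow> card (mids Z i (v i) (v (i + 2))) > L"

text \<open>Degrees, like codegrees, are taken inside \<open>Z\<close>, so that the counting needs
  no reference to a graph.\<close>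

definition dplus :: "(nat \<Rightarrow> 'a) set \<Rightarrow> nat \<Rightarrow> 'a \<Rightarrow> nat" where
  "dplus Z i x = card ((\<lambda>w. w (i + 1)) ` {w \<in> Z. w i = x})"

definition dminus :: "(nat \<Rightarrow> 'a) set \<Rightarrow> nat \<Rightarrow> 'a \<Rightarrow> nat" where
  "dminus Z i x = card ((\<lambda>w. w i) ` {w \<in> Z. w (i + 1) = x})"

abbreviation tr :: "nat \<Rightarrow> nat \<Rightarrow> (nat \<Rightarrow> 'a) \<Rightarrow> 'a list" where
  "tr i j v \<equiv> map v [i..<j]"

lemma tr_eqD: "tr c d w = tr c d v \<Longrightarrow> c \<le> t \<Longrightarrow> t < d \<Longrightarrow> w t = v t"
  by simp

lemma tr_eqI: "(\<And>t. c \<le> t \<Longrightarrow> t < d \<Longrightarrow> w t = v t) \<Longrightarrow> tr c d w = tr c d v"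
  by simp

text \<open>The interface between graph theory and counting: what a forbidden cycle implies for
  closed sequences, at every position and without reduction modulo \<open>k\<close>. It is
  instantiated with \<open>L = 2 * l\<close>, for even and for odd \<open>l\<close> by different
  ways of closing up paths.\<close>

locale closed_family =
  fixes Z :: "(nat \<Rightarrow> 'a) set" and k L n :: nat
  assumes finZ: "finite Z"
    and per: "v \<in> Z \<Longrightarrow> v (i + k) = v i"
    and k_pos: "k > 0"
    and card_class: "card ((\<lambda>w. w i) ` Z) \<le> n"
    and rich_fwd: "card ((\<lambda>w. (w (i + 1), w (i + 2))) ` {w \<in> Z. w i = x \<and> rich L Z i w})
      \<le> L * dplus Z i x"
    and rich_bwd: "card ((\<lambda>w. (w i, w (i + 1))) ` {w \<in> Z. w (i + 2) = x \<and> rich L Z i w})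
      \<le> L * dminus Z (i + 1) x"
    and sum_dplus: "(\<Sum>x\<in>(\<lambda>w. w i) ` Z. (dplus Z i x)\<^sup>2) \<le> 3 * L * n\<^sup>2"
    and sum_dminus: "(\<Sum>x\<in>(\<lambda>w. w (i + 1)) ` Z. (dminus Z i x)\<^sup>2) \<le> 3 * L * n\<^sup>2"
begin

lemma per_mult: "v \<in> Z \<Longrightarrow> v (i + m * k) = v i"
proof (induction m)
  case (Suc m)
  then show ?case using per[of v "i + m * k"] by (simp add: algebra_simps)
qed simp

text \<open>A window of \<open>k\<close> consecutive entries determines the whole sequence, so each
  count may start where it is convenient.\<close>

lemma tr_inj: "inj_on (tr c (c + k)) Z"
proof (rule inj_onI)
  fix v w assume vw: "v \<in> Z" "w \<in> Z" "tr c (c + k) v = tr c (c + k) w"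
  have ge: "v t = w t" if "t \<ge> c" for t
    using that
  proof (induction t rule: less_induct)
    case (less t)
    show ?case
    proof (cases "t < c + k")
      case True
      then show ?thesis using vw(3) less.prems by simp
    next
      case False
      then have "v (t - k) = w (t - k)" using less k_pos by simp
      then show ?thesis using per[OF vw(1), of "t - k"] per[OF vw(2), of "t - k"] False by simp
    qed
  qed
  show "v = w"
  proof
    fix i
    \<comment> \<open>A shift by \<open>c\<close> periods moves every index beyond
      \<open>c\<close>.\<close>
    have "i + c * k \<ge> c" using k_pos by (cases k) auto
    then show "v i = w i" using ge[of "i + c * k"] per_mult[OF vw(1), of i c] per_mult[OF vw(2), of i c] by simp
  qed
qed

lemma card_eq_tr: "Y \<subseteq> Z \<Longrightarrow> card Y = card (tr c (c + k) ` Y)"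
  by (metis card_image inj_on_subset tr_inj)

lemma fin_sub: "Y \<subseteq> Z \<Longrightarrow> finite Y"
  using finZ finite_subset by blast

lemma per_image: "(\<lambda>w. w (i + k)) ` Z = (\<lambda>w. w i) ` Z"
  using per by (intro image_cong refl) blast

lemma mids_per: "mids Z (i + k) a b = mids Z i a b"
proof -
  have eqs: "w (i + k) = w i" "w (i + k + 1) = w (i + 1)" "w (i + k + 2) = w (i + 2)" if "w \<in> Z" for w
    using per[OF that, of i] per[OF that, of "i + 1"] per[OF that, of "i + 2"]
    by (simp_all add: ac_simps)
  have "{w \<in> Z. w (i + k) = a \<and> w (i + k + 2) = b} = {w \<in> Z. w i = a \<and> w (i + 2) = b}"
    using eqs(1,3) by metis
  then show ?thesis
    unfolding mids_def using eqs(2) by (intro image_cong) blast+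
qed

lemma dplus_per: "dplus Z (i + k) x = dplus Z i x"
proof -
  have eqs: "w (i + k) = w i" "w (i + k + 1) = w (i + 1)" if "w \<in> Z" for w
    using per[OF that, of i] per[OF that, of "i + 1"] by (simp_all add: ac_simps)
  have "{w \<in> Z. w (i + k) = x} = {w \<in> Z. w i = x}"
    using eqs(1) by metis
  then show ?thesis
    unfolding dplus_def using eqs(2) by (intro arg_cong[where f = card] image_cong) blast+
qed

lemma rich_per: "v \<in> Z \<Longrightarrow> rich L Z (i + k) v = rich L Z i v"
  using per[of v "i + 2"] per[of v i] unfolding rich_def mids_per by (simp add: ac_simps)

lemma card_image_class: "Y \<subseteq> Z \<Longrightarrow> card ((\<lambda>w. w i) ` Y) \<le> n"
  using card_class[of i] finZ
  by (meson card_mono finite_imageI image_mono order_trans)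

lemma dplus_le: "dplus Z i x \<le> n"
  unfolding dplus_def by (rule card_image_class) blast

lemma dminus_le: "dminus Z i x \<le> n"
  unfolding dminus_def by (rule card_image_class) blast

lemma poor_mid:
  assumes "Y \<subseteq> Z" "\<And>w. w \<in> Y \<Longrightarrow> w i = v i \<and> w (i + 2) = v (i + 2)" "v \<in> Z" "\<not> rich L Z i v"
  shows "card ((\<lambda>w. w (i + 1)) ` Y) \<le> L"
proof -
  have "(\<lambda>w. w (i + 1)) ` Y \<subseteq> mids Z i (v i) (v (i + 2))"
    unfolding mids_def using assms(1,2) by blast
  moreover have "finite (mids Z i (v i) (v (i + 2)))"
    using finZ by (simp add: mids_def)
  ultimately show ?thesis using assms(4) by (meson card_mono not_le order_trans rich_def)
qed

text \<open>Rich triples starting in \<open>x\<close> are bounded through the degree of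
  \<open>x\<close>, hence by \<open>L * n\<close>. For poor ones the far end is chosen in at most
  \<open>n\<close> ways and then the middle in at most \<open>L\<close> ways.\<close>

lemma two_step:
  "card ((\<lambda>w. (w (i + 1), w (i + 2))) ` {w \<in> Z. w i = x}) \<le> 2 * L * n"
proof -
  let ?g = "\<lambda>w. (w (i + 1), w (i + 2))"
  let ?A = "{w \<in> Z. w i = x \<and> rich L Z i w}" and ?B = "{w \<in> Z. w i = x \<and> \<not> rich L Z i w}"
  have "?g ` {w \<in> Z. w i = x} = ?g ` ?A \<union> ?g ` ?B" by blast
  then have "card (?g ` {w \<in> Z. w i = x}) \<le> card (?g ` ?A) + card (?g ` ?B)"
    by (simp only: card_Un_le)
  moreover have "card (?g ` ?A) \<le> L * n"
    by (rule order_trans[OF rich_fwd mult_le_mono2[OF dplus_le]])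
  moreover have "card (?g ` ?B) \<le> card ((\<lambda>w. w (i + 2)) ` ?B) * L"
  proof (rule card_image_fiber)
    fix v assume "v \<in> ?B"
    then show "card ((\<lambda>w. w (i + 1)) ` {w \<in> ?B. w (i + 2) = v (i + 2)}) \<le> L"
      by (intro poor_mid[where v = v]) auto
  qed (use finZ in auto)
  moreover have "card ((\<lambda>w. w (i + 2)) ` ?B) * L \<le> L * n"
    by (subst mult.commute, intro mult_le_mono2 card_image_class) blast
  moreover have "2 * L * n = L * n + L * n" by simp
  ultimately show ?thesis by linarith
qed

lemma two_step_back:
  "card ((\<lambda>w. (w i, w (i + 1))) ` {w \<in> Z. w (i + 2) = x}) \<le> 2 * L * n"
proof -
  let ?g = "\<lambda>w. (w i, w (i + 1))"
  let ?A = "{w \<in> Z. w (i + 2) = x \<and> rich L Z i w}" and ?B = "{w \<in> Z. w (i + 2) = x \<and> \<not> rich L Z i w}"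
  have "?g ` {w \<in> Z. w (i + 2) = x} = ?g ` ?A \<union> ?g ` ?B" by blast
  then have "card (?g ` {w \<in> Z. w (i + 2) = x}) \<le> card (?g ` ?A) + card (?g ` ?B)"
    by (simp only: card_Un_le)
  moreover have "card (?g ` ?A) \<le> L * n"
    by (rule order_trans[OF rich_bwd mult_le_mono2[OF dminus_le]])
  moreover have "card (?g ` ?B) \<le> card ((\<lambda>w. w i) ` ?B) * L"
  proof (rule card_image_fiber)
    fix v assume "v \<in> ?B"
    then show "card ((\<lambda>w. w (i + 1)) ` {w \<in> ?B. w i = v i}) \<le> L"
      by (intro poor_mid[where v = v]) auto
  qed (use finZ in auto)
  moreover have "card ((\<lambda>w. w i) ` ?B) * L \<le> L * n"
    by (subst mult.commute, intro mult_le_mono2 card_image_class) blast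
  moreover have "2 * L * n = L * n + L * n" by simp
  ultimately show ?thesis by linarith
qed

lemma card_image_subset_le: "A \<subseteq> B \<Longrightarrow> B \<subseteq> Z \<Longrightarrow> card (g ` B) \<le> m \<Longrightarrow> card (g ` A) \<le> m"
  using finZ card_mono[of "g ` B" "g ` A"] finite_subset[of B Z] by (simp add: image_mono)

lemma chain_fwd:
  assumes "Y \<subseteq> Z" "c \<le> d"
  shows "card (tr c (d + 1 + 2 * m) ` Y) \<le> card (tr c (d + 1) ` Y) * (2 * L * n) ^ m"
proof (induction m)
  case (Suc m)
  let ?e = "d + 2 * m"
  have "card (tr c (d + 1 + 2 * Suc m) ` Y) \<le> card (tr c (d + 1 + 2 * m) ` Y) * (2 * L * n)"
  proof (rule card_image_fiber[where g = "\<lambda>w. (w (?e + 1), w (?e + 2))"])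
    fix v assume "v \<in> Y"
    have "{w \<in> Y. tr c (d + 1 + 2 * m) w = tr c (d + 1 + 2 * m) v} \<subseteq> {w \<in> Z. w ?e = v ?e}"
      using assms tr_eqD[where c = c and d = "d + 1 + 2 * m" and v = v and t = ?e] by force
    then show "card ((\<lambda>w. (w (?e + 1), w (?e + 2))) ` {w \<in> Y. tr c (d + 1 + 2 * m) w = tr c (d + 1 + 2 * m) v})
        \<le> 2 * L * n"
      by (rule card_image_subset_le[OF _ _ two_step]) blast
  next
    fix w w' :: "nat \<Rightarrow> 'a"
    assume 1: "tr c (d + 1 + 2 * m) w = tr c (d + 1 + 2 * m) w'"
      and 2: "(w (?e + 1), w (?e + 2)) = (w' (?e + 1), w' (?e + 2))"
    have "w t = w' t" if "t \<ge> c" "t < d + 1 + 2 * Suc m" for t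
    proof (cases "t < d + 1 + 2 * m")
      case True
      with that show ?thesis by (intro tr_eqD[OF 1]) simp_all
    next
      case False
      then have "t = ?e + 1 \<or> t = ?e + 2" using that by auto
      then show ?thesis using 2 by auto
    qed
    then show "tr c (d + 1 + 2 * Suc m) w = tr c (d + 1 + 2 * Suc m) w'" by (rule tr_eqI)
  qed (use fin_sub assms in auto)
  also have "\<dots> \<le> card (tr c (d + 1) ` Y) * (2 * L * n) ^ m * (2 * L * n)"
    using Suc by (rule mult_le_mono1)
  finally show ?case by (simp add: algebra_simps)
qed simp

text \<open>Walks are also counted from their right end, because degree weights may sit there; once
  that end is fixed, the first factor is at most 1.\<close>

lemma chain_back:
  assumes "Y \<subseteq> Z"
  shows "card (tr c (c + 2 * m + 1) ` Y) \<le> card ((\<lambda>w. w (c + 2 * m)) ` Y) * (2 * L * n) ^ m"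
proof (induction m arbitrary: c)
  case 0
  have "card (tr c (c + 2 * 0 + 1) ` Y) = card ((\<lambda>x. [x]) ` (\<lambda>w. w c) ` Y)"
    by (simp add: image_image)
  also have "\<dots> \<le> card ((\<lambda>w. w c) ` Y)"
    using fin_sub[OF assms] by (intro card_image_le) simp
  finally show ?case by simp
next
  case (Suc m)
  have eq: "c + 2 * Suc m + 1 = c + 2 + 2 * m + 1" by simp
  have "card (tr c (c + 2 + 2 * m + 1) ` Y) \<le> card (tr (c + 2) (c + 2 + 2 * m + 1) ` Y) * (2 * L * n)"
  proof (rule card_image_fiber[where g = "\<lambda>w. (w c, w (c + 1))"])
    fix v assume "v \<in> Y"
    have "{w \<in> Y. tr (c + 2) (c + 2 + 2 * m + 1) w = tr (c + 2) (c + 2 + 2 * m + 1) v} \<subseteq>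
        {w \<in> Z. w (c + 2) = v (c + 2)}"
      using assms tr_eqD[where c = "c + 2" and d = "c + 2 + 2 * m + 1" and v = v and t = "c + 2"] by force
    then show "card ((\<lambda>w. (w c, w (c + 1))) `
        {w \<in> Y. tr (c + 2) (c + 2 + 2 * m + 1) w = tr (c + 2) (c + 2 + 2 * m + 1) v}) \<le> 2 * L * n"
      by (rule card_image_subset_le[OF _ _ two_step_back]) blast
  next
    fix w w' :: "nat \<Rightarrow> 'a"
    assume 1: "tr (c + 2) (c + 2 + 2 * m + 1) w = tr (c + 2) (c + 2 + 2 * m + 1) w'"
      and 2: "(w c, w (c + 1)) = (w' c, w' (c + 1))"
    have "w t = w' t" if "t \<ge> c" "t < c + 2 + 2 * m + 1" for t
    proof (cases "t \<ge> c + 2")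
      case True
      with that show ?thesis by (intro tr_eqD[OF 1]) simp_all
    next
      case False
      then have "t = c \<or> t = c + 1" using that by auto
      then show ?thesis using 2 by auto
    qed
    then show "tr c (c + 2 + 2 * m + 1) w = tr c (c + 2 + 2 * m + 1) w'" by (rule tr_eqI)
  qed (use fin_sub assms in auto)
  also have "\<dots> \<le> card ((\<lambda>w. w (c + 2 + 2 * m)) ` Y) * (2 * L * n) ^ m * (2 * L * n)"
    using Suc[of "c + 2"] by (rule mult_le_mono1)
  finally show ?case by (simp add: algebra_simps)
qed

end

lemma tr_single: "tr c (c + 1) w = [w c]"
  by simp

lemma card_le_1_subset: "A \<subseteq> {x} \<Longrightarrow> card A \<le> 1"
  using card_mono[of "{x}" A] by simp

lemma mult_le_sum_squares: "2 * (a * b) \<le> a\<^sup>2 + (b :: nat)\<^sup>2"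
proof -
  have "2 * (int a * int b) \<le> (int a)\<^sup>2 + (int b)\<^sup>2"
    using zero_le_power2[of "int a - int b"] by (simp add: power2_diff)
  then show ?thesis by (metis (no_types) of_nat_add of_nat_le_iff of_nat_mult of_nat_numeral of_nat_power)
qed

section \<open>Closed sequences of odd period\<close>

context closed_family
begin

text \<open>The entries \<open>i + 1\<close> and \<open>i + 3\<close> cost a factor \<open>L\<close>
  each. What remains is the single entry \<open>i + 2\<close> and the path from \<open>i + 4\<close>
  to \<open>i + k\<close>; the assumption \<open>second\<close> bridges the gap between
  \<open>i + 2\<close> and the edge at \<open>i + 4\<close>, so that both are counted as one
  path.\<close>

lemma card_poor_poor:
  assumes "odd k" "k \<ge> 5"
    and second: "\<And>i x. card ((\<lambda>w. (w (i + 2), w (i + 3))) ` {w \<in> Z. w i = x}) \<le> L * n"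
  shows "card {v \<in> Z. \<not> rich L Z i v \<and> \<not> rich L Z (i + 2) v}
    \<le> n * (L * n) * L * (2 * L * n) ^ ((k - 5) div 2) * L"
proof -
  let ?Y = "{v \<in> Z. \<not> rich L Z i v \<and> \<not> rich L Z (i + 2) v}" and ?c = "i + 2"
  let ?m = "(k - 5) div 2"
  have sub: "?Y \<subseteq> Z" by blast
  note fin = fin_sub[OF sub]
  have k: "k = 5 + 2 * ?m" using assms(1,2) by presburger
  have 2: "card ((\<lambda>w. (w ?c, w (?c + 2), w (?c + 3))) ` ?Y) \<le> card ((\<lambda>w. w ?c) ` ?Y) * (L * n)"
  proof (rule card_image_fiber[OF fin])
    fix v assume "v \<in> ?Y"
    show "card ((\<lambda>w. (w (?c + 2), w (?c + 3))) ` {w \<in> ?Y. w ?c = v ?c}) \<le> L * n"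
      by (rule card_image_subset_le[OF _ _ second]) blast+
  qed simp
  have 3: "card (tr ?c (?c + 3 + 1) ` ?Y) \<le> card ((\<lambda>w. (w ?c, w (?c + 2), w (?c + 3))) ` ?Y) * L"
  proof (rule card_image_fiber[OF fin])
    fix v assume v: "v \<in> ?Y"
    show "card ((\<lambda>w. w (?c + 1)) ` {w \<in> ?Y. (w ?c, w (?c + 2), w (?c + 3)) = (v ?c, v (?c + 2), v (?c + 3))}) \<le> L"
      by (rule poor_mid[where v = v]) (use v in auto)
  next
    fix w w' :: "nat \<Rightarrow> 'a"
    assume eq: "(w ?c, w (?c + 2), w (?c + 3)) = (w' ?c, w' (?c + 2), w' (?c + 3))"
      "w (?c + 1) = w' (?c + 1)"
    show "tr ?c (?c + 3 + 1) w = tr ?c (?c + 3 + 1) w'"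
    proof (rule tr_eqI)
      fix t assume "?c \<le> t" "t < ?c + 3 + 1"
      then have "t = ?c \<or> t = ?c + 1 \<or> t = ?c + 2 \<or> t = ?c + 3" by linarith
      then show "w t = w' t" using eq by auto
    qed
  qed
  have 4: "card (tr ?c (?c + 3 + 1 + 2 * ?m) ` ?Y) \<le> card (tr ?c (?c + 3 + 1) ` ?Y) * (2 * L * n) ^ ?m"
    by (rule chain_fwd[OF sub]) simp
  have 5: "card (tr ?c (?c + k) ` ?Y) \<le> card (tr ?c (?c + 3 + 1 + 2 * ?m) ` ?Y) * L"
  proof (rule card_image_fiber[OF fin])
    fix v assume v: "v \<in> ?Y"
    let ?F = "{w \<in> ?Y. tr ?c (?c + 3 + 1 + 2 * ?m) w = tr ?c (?c + 3 + 1 + 2 * ?m) v}"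
    \<comment> \<open>The last missing entry is \<open>i + 1\<close>, read one period later as
      \<open>i + k + 1\<close>. Its neighbours are the end of the window and, by periodicity, its
      start \<open>i + 2\<close>.\<close>
    have "w (i + k) = v (i + k) \<and> w (i + k + 2) = v (i + k + 2)" if "w \<in> ?F" for w
    proof -
      have eq: "w t = v t" if "?c \<le> t" "t < ?c + 3 + 1 + 2 * ?m" for t
        using \<open>w \<in> ?F\<close> tr_eqD that by blast
      have "w (i + k) = v (i + k)" by (rule eq) (use k in linarith)+
      moreover have "w (i + k + 2) = w (i + 2)" "v (i + k + 2) = v (i + 2)"
        using per[of w "i + 2"] per[of v "i + 2"] that v by (simp_all add: ac_simps)
      moreover have "w (i + 2) = v (i + 2)" by (rule eq) simp_all
      ultimately show ?thesis by simp
    qed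
    then show "card ((\<lambda>w. w (i + k + 1)) ` ?F) \<le> L"
      by (rule poor_mid[where v = v, rotated]) (use v in \<open>auto simp: rich_per\<close>)
  next
    fix w w' :: "nat \<Rightarrow> 'a"
    assume 1: "tr ?c (?c + 3 + 1 + 2 * ?m) w = tr ?c (?c + 3 + 1 + 2 * ?m) w'"
      "w (i + k + 1) = w' (i + k + 1)"
    show "tr ?c (?c + k) w = tr ?c (?c + k) w'"
    proof (rule tr_eqI)
      fix t assume t: "?c \<le> t" "t < ?c + k"
      show "w t = w' t"
      proof (cases "t = i + k + 1")
        case False
        show ?thesis by (rule tr_eqD[OF 1(1)]) (use t False k in linarith)+
      qed (use 1(2) in simp)
    qed
  qed
  have "card ?Y = card (tr ?c (?c + k) ` ?Y)" by (rule card_eq_tr[OF sub])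
  also note 5
  also note mult_le_mono1[OF 4]
  also note mult_le_mono1[OF mult_le_mono1[OF 3]]
  also note mult_le_mono1[OF mult_le_mono1[OF mult_le_mono1[OF 2]]]
  also have "card ((\<lambda>w. w ?c) ` ?Y) * (L * n) * L * (2 * L * n) ^ ?m * L \<le>
      n * (L * n) * L * (2 * L * n) ^ ?m * L"
    by (intro mult_le_mono1 card_image_class[OF sub])
  finally show ?thesis .
qed

text \<open>Only the window from \<open>i + 5\<close> to \<open>i + k\<close> is kept. Its first
  entry is the right end of one rich triple and its last, by periodicity, the left end of the other,
  so each triple costs \<open>L\<close> times a degree. The two degrees stand for the entries
  \<open>i + 4\<close> and \<open>i + 1\<close>; in effect only \<open>i + 2\<close> and
  \<open>i + 3\<close> are dropped.\<close>

lemma card_rich_rich: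
  assumes "odd k" "k \<ge> 5"
  shows "card {v \<in> Z. rich L Z i v \<and> rich L Z (i + 3) v}
    \<le> 3 * L ^ 3 * n\<^sup>2 * (2 * L * n) ^ ((k - 5) div 2)"
proof -
  let ?Y = "{v \<in> Z. rich L Z i v \<and> rich L Z (i + 3) v}" and ?c = "i + 5" and ?e = "i + k"
  let ?m = "(k - 5) div 2"
  let ?P = "(2 * L * n) ^ ?m"
  define f :: "(nat \<Rightarrow> 'a) \<Rightarrow> 'a list" where "f = tr ?c (?c + 2 * ?m + 1)"
  have sub: "?Y \<subseteq> Z" by blast
  note fin = fin_sub[OF sub]
  have k: "k = 5 + 2 * ?m" using assms(1,2) by presburger
  have e: "?e = ?c + 2 * ?m" using k by linarith
  have swap: "?c + 2 * ?m + 1 = ?c + 1 + 2 * ?m" by simp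
  have hd_f: "hd (f v) = v ?c" for v :: "nat \<Rightarrow> 'a" by (simp add: f_def hd_map del: upt_Suc)
  have last_f: "last (f v) = v ?e" for v :: "nat \<Rightarrow> 'a"
    unfolding e by (simp add: f_def last_map ac_simps del: upt_Suc)
  define d1 where "d1 = dplus Z ?e"
  define d2 where "d2 = dminus Z (i + 4)"
  have d1: "dplus Z i x = d1 x" for x
    unfolding d1_def by (rule dplus_per[symmetric])
  have "card (tr i (i + k) ` ?Y) \<le> (\<Sum>y\<in>f ` ?Y. (L * d1 (last y)) * (L * d2 (hd y)))"
  proof (rule card_image_fiber_sum[OF fin,
        where g = "\<lambda>w. ((w (i + 1), w (i + 2)), (w (i + 3), w (i + 4)))"])
    fix v assume v: "v \<in> ?Y"
    let ?F = "{w \<in> ?Y. f w = f v}"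
    let ?A = "(\<lambda>w. (w (i + 1), w (i + 2))) ` {w \<in> Z. w i = v i \<and> rich L Z i w}"
    let ?B = "(\<lambda>w. (w (i + 3), w (i + 3 + 1))) ` {w \<in> Z. w (i + 3 + 2) = v (i + 3 + 2) \<and> rich L Z (i + 3) w}"
    have "(\<lambda>w. ((w (i + 1), w (i + 2)), (w (i + 3), w (i + 4)))) ` ?F \<subseteq> ?A \<times> ?B"
    proof
      fix y assume "y \<in> (\<lambda>w. ((w (i + 1), w (i + 2)), (w (i + 3), w (i + 4)))) ` ?F"
      then obtain w where w: "w \<in> ?F" and y: "y = ((w (i + 1), w (i + 2)), (w (i + 3), w (i + 4)))"
        by (rule imageE)
      have "last (f w) = last (f v)" "hd (f w) = hd (f v)" using w by simp_all
      then have "w ?e = v ?e" "w ?c = v ?c" by (simp_all only: hd_f last_f)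
      then have "w i = v i" "w (i + 3 + 2) = v (i + 3 + 2)"
        using per[of w i] per[of v i] w v by (auto simp: ac_simps)
      then show "y \<in> ?A \<times> ?B" using w unfolding y by (force simp: eval_nat_numeral)
    qed
    then have "card ((\<lambda>w. ((w (i + 1), w (i + 2)), (w (i + 3), w (i + 4)))) ` ?F) \<le> card (?A \<times> ?B)"
      using finZ by (intro card_mono) auto
    also have "\<dots> = card ?A * card ?B" by (rule card_cartesian_product)
    also have "\<dots> \<le> (L * dplus Z i (v i)) * (L * dminus Z (i + 3 + 1) (v (i + 3 + 2)))"
      by (intro mult_le_mono rich_fwd rich_bwd)
    also have "\<dots> = (L * d1 (last (f v))) * (L * d2 (hd (f v)))"
      unfolding d1 d2_def hd_f last_f using per[of v i] v by (simp add: eval_nat_numeral)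
    finally show "card ((\<lambda>w. ((w (i + 1), w (i + 2)), (w (i + 3), w (i + 4)))) ` ?F) \<le>
        (L * d1 (last (f v))) * (L * d2 (hd (f v)))" .
  next
    fix w w' assume w: "w \<in> ?Y" "w' \<in> ?Y"
      and g_eq: "((w (i + 1), w (i + 2)), (w (i + 3), w (i + 4))) = ((w' (i + 1), w' (i + 2)), (w' (i + 3), w' (i + 4)))"
    assume "f w = f w'"
    then have f_eq: "tr ?c (?c + 2 * ?m + 1) w = tr ?c (?c + 2 * ?m + 1) w'" by (simp only: f_def)
    show "tr i (i + k) w = tr i (i + k) w'"
    proof (rule tr_eqI)
      fix t assume t: "i \<le> t" "t < i + k"
      then have "t = i \<or> (t = i + 1 \<or> t = i + 2 \<or> t = i + 3 \<or> t = i + 4) \<or> t \<ge> ?c"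
        by linarith
      then consider "t = i" | "t = i + 1 \<or> t = i + 2 \<or> t = i + 3 \<or> t = i + 4" | "t \<ge> ?c"
        by blast
      then show "w t = w' t"
      proof cases
        case 1
        have "w ?e = w' ?e" by (rule tr_eqD[OF f_eq]) (use e in linarith)+
        moreover have "w ?e = w i" "w' ?e = w' i" using per w by blast+
        ultimately show ?thesis using 1 by simp
      next
        case 2
        then show ?thesis using g_eq by auto
      next
        case 3
        show ?thesis by (rule tr_eqD[OF f_eq]) (use t 3 e in linarith)+
      qed
    qed
  qed
  \<comment> \<open>The factor 2 prepares \<open>mult_le_sum_squares\<close>, which separates the
    two weights. Each square is then summed over its own end of the window, with the window counted
    from that end.\<close>
  then have "2 * card ?Y \<le> 2 * (\<Sum>y\<in>f ` ?Y. (L * d1 (last y)) * (L * d2 (hd y)))"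
    unfolding card_eq_tr[OF sub, of i] by simp
  also have "\<dots> = L\<^sup>2 * (\<Sum>y\<in>f ` ?Y. 2 * (d1 (last y) * d2 (hd y)))"
    by (simp add: sum_distrib_left power2_eq_square algebra_simps)
  also have "\<dots> \<le> L\<^sup>2 * (\<Sum>y\<in>f ` ?Y. (d1 (last y))\<^sup>2 + (d2 (hd y))\<^sup>2)"
    by (intro mult_le_mono2 sum_mono mult_le_sum_squares)
  also have "\<dots> = L\<^sup>2 * ((\<Sum>y\<in>f ` ?Y. (d1 (last y))\<^sup>2) + (\<Sum>y\<in>f ` ?Y. (d2 (hd y))\<^sup>2))"
    by (simp add: sum.distrib)
  also have "(\<Sum>y\<in>f ` ?Y. (d1 (last y))\<^sup>2) \<le> (\<Sum>x\<in>(\<lambda>w. w ?e) ` Z. (d1 x)\<^sup>2 * ?P)"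
  proof (rule sum_fiber_le)
    show "last ` f ` ?Y \<subseteq> (\<lambda>w. w ?e) ` Z"
      unfolding image_image last_f by blast
    fix x
    have "{y \<in> f ` ?Y. last y = x} \<subseteq> f ` {v \<in> ?Y. v ?e = x}"
      unfolding last_f[symmetric] by blast
    then have "card {y \<in> f ` ?Y. last y = x} \<le> card (f ` {v \<in> ?Y. v ?e = x})"
      using finZ by (intro card_mono) auto
    also have "\<dots> \<le> card ((\<lambda>w. w (?c + 2 * ?m)) ` {v \<in> ?Y. v ?e = x}) * ?P"
      unfolding f_def by (rule chain_back[where c = ?c and m = ?m]) blast
    also have "\<dots> \<le> 1 * ?P"
    proof (rule mult_le_mono1)
      have "(\<lambda>w. w (?c + 2 * ?m)) ` {v \<in> ?Y. v ?e = x} \<subseteq> {x}"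
        unfolding e[symmetric] by blast
      then show "card ((\<lambda>w. w (?c + 2 * ?m)) ` {v \<in> ?Y. v ?e = x}) \<le> 1"
        by (rule card_le_1_subset)
    qed
    finally show "card {y \<in> f ` ?Y. last y = x} \<le> ?P" unfolding mult_1 .
  qed (use finZ in auto)
  also have "(\<Sum>y\<in>f ` ?Y. (d2 (hd y))\<^sup>2) \<le> (\<Sum>x\<in>(\<lambda>w. w ?c) ` Z. (d2 x)\<^sup>2 * ?P)"
  proof (rule sum_fiber_le)
    show "hd ` f ` ?Y \<subseteq> (\<lambda>w. w ?c) ` Z"
      unfolding image_image hd_f by blast
    fix x
    have "{y \<in> f ` ?Y. hd y = x} \<subseteq> f ` {v \<in> ?Y. v ?c = x}"
      unfolding hd_f[symmetric] by blast
    then have "card {y \<in> f ` ?Y. hd y = x} \<le> card (f ` {v \<in> ?Y. v ?c = x})"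
      using finZ by (intro card_mono) auto
    also have "\<dots> = card (tr ?c (?c + 1 + 2 * ?m) ` {v \<in> ?Y. v ?c = x})"
      unfolding f_def swap ..
    also have "\<dots> \<le> card (tr ?c (?c + 1) ` {v \<in> ?Y. v ?c = x}) * ?P"
      by (rule chain_fwd[where c = ?c and d = ?c and m = ?m]) (blast, simp)
    also have "\<dots> \<le> 1 * ?P"
    proof (rule mult_le_mono1)
      have "tr ?c (?c + 1) ` {v \<in> ?Y. v ?c = x} \<subseteq> {[x]}"
        unfolding tr_single by blast
      then show "card (tr ?c (?c + 1) ` {v \<in> ?Y. v ?c = x}) \<le> 1"
        by (rule card_le_1_subset)
    qed
    finally show "card {y \<in> f ` ?Y. hd y = x} \<le> ?P" unfolding mult_1 .
  qed (use finZ in auto)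
  also have "(\<Sum>x\<in>(\<lambda>w. w ?e) ` Z. (d1 x)\<^sup>2 * ?P) = (\<Sum>x\<in>(\<lambda>w. w ?e) ` Z. (d1 x)\<^sup>2) * ?P"
    by (simp add: sum_distrib_right)
  also have "\<dots> \<le> 3 * L * n\<^sup>2 * ?P"
    unfolding d1_def by (intro mult_le_mono1 sum_dplus)
  also have "(\<Sum>x\<in>(\<lambda>w. w ?c) ` Z. (d2 x)\<^sup>2 * ?P) = (\<Sum>x\<in>(\<lambda>w. w (i + 4 + 1)) ` Z. (d2 x)\<^sup>2) * ?P"
    by (simp add: sum_distrib_right eval_nat_numeral)
  also have "\<dots> \<le> 3 * L * n\<^sup>2 * ?P"
    unfolding d2_def by (intro mult_le_mono1 sum_dminus)
  finally have "2 * card ?Y \<le> L\<^sup>2 * (3 * L * n\<^sup>2 * ?P + 3 * L * n\<^sup>2 * ?P)"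
    by simp
  then show ?thesis by (simp add: power2_eq_square power3_eq_cube algebra_simps)
qed

theorem card_odd_family:
  assumes "odd k" "k \<ge> 5"
    and second: "\<And>i x. card ((\<lambda>w. (w (i + 2), w (i + 3))) ` {w \<in> Z. w i = x}) \<le> L * n"
  shows "card Z \<le> 6 * 2 ^ (k div 2) * L ^ (k div 2 + 1) * n ^ (k div 2)"
proof -
  let ?m = "(k - 5) div 2"
  let ?A = "\<lambda>i. {v \<in> Z. \<not> rich L Z i v \<and> \<not> rich L Z (i + 2) v}"
  let ?B = "\<lambda>i. {v \<in> Z. rich L Z i v \<and> rich L Z (i + 3) v}"
  have r: "k div 2 = ?m + 2" using assms(1,2) by presburger
  have "Z \<subseteq> (\<Union>i<6. ?A i \<union> ?B i)"
  proof
    fix v assume "v \<in> Z"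
    \<comment> \<open>No pattern of 9 positions avoids both two poor ones at distance 2 and two rich
      ones at distance 3: either value of \<open>\<rho> 0\<close> forces further values until they
      clash. For small \<open>k\<close> the positions wrap around, which does no harm.\<close>
    have *: "\<exists>i<6. (\<not> \<rho> i \<and> \<not> \<rho> (i + 2)) \<or> (\<rho> i \<and> \<rho> (i + 3))" for \<rho> :: "nat \<Rightarrow> bool"
    proof (rule ccontr)
      assume "\<not> ?thesis"
      then have *: "i < 6 \<Longrightarrow> (\<rho> i \<or> \<rho> (i + 2)) \<and> \<not> (\<rho> i \<and> \<rho> (i + 3))" for i by blast
      show False
        using *[of 0] *[of 1] *[of 2] *[of 3] *[of 4] *[of 5] by (auto simp: eval_nat_numeral)
    qed
    obtain i :: nat where "i < 6" "v \<in> ?A i \<union> ?B i"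
      using *[of "\<lambda>i. rich L Z i v"] \<open>v \<in> Z\<close> by auto
    then show "v \<in> (\<Union>i<6. ?A i \<union> ?B i)" by blast
  qed
  then have "card Z \<le> card (\<Union>i<6. ?A i \<union> ?B i)"
    using finZ by (intro card_mono) auto
  also have "\<dots> \<le> (\<Sum>i<6. card (?A i \<union> ?B i))"
    by (intro card_UN_le) simp
  also have "\<dots> \<le> (\<Sum>i<(6::nat). n * (L * n) * L * (2 * L * n) ^ ?m * L + 3 * L ^ 3 * n\<^sup>2 * (2 * L * n) ^ ?m)"
    by (intro sum_mono order_trans[OF card_Un_le] add_mono card_poor_poor card_rich_rich assms)
  also have "\<dots> = 6 * 2 ^ (?m + 2) * L ^ (?m + 2 + 1) * n ^ (?m + 2)"
    by (simp add: power_mult_distrib power_add power2_eq_square power3_eq_cube algebra_simps)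
  finally show ?thesis unfolding r .
qed

end

section \<open>Closed sequences of even period\<close>

context closed_family
begin

text \<open>Without the poor entry 1 there remains a path from 2 to \<open>k\<close> with an odd
  number of entries, which is counted by double steps; the poor entry then costs
  \<open>L\<close>.\<close>

lemma card_poor_even:
  assumes "even k" "k \<ge> 4"
  shows "card {v \<in> Z. \<not> rich L Z 0 v} \<le> n * (2 * L * n) ^ ((k - 2) div 2) * L"
proof -
  let ?Y = "{v \<in> Z. \<not> rich L Z 0 v}" and ?m = "(k - 2) div 2"
  have sub: "?Y \<subseteq> Z" by blast
  note fin = fin_sub[OF sub]
  have k: "k = 2 + 2 * ?m" using assms(1,2) by presburger
  have 1: "card (tr 2 (2 + 1) ` ?Y) \<le> n"
  proof -
    have "tr 2 (2 + 1) ` ?Y = (\<lambda>x. [x]) ` (\<lambda>w. w 2) ` ?Y"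
      unfolding tr_single image_image ..
    also have "card \<dots> \<le> card ((\<lambda>w. w 2) ` ?Y)"
      using fin by (intro card_image_le finite_imageI)
    finally show ?thesis using card_image_class[OF sub, of 2] by linarith
  qed
  have 2: "card (tr 2 (2 + 1 + 2 * ?m) ` ?Y) \<le> card (tr 2 (2 + 1) ` ?Y) * (2 * L * n) ^ ?m"
    by (rule chain_fwd[OF sub]) simp
  have 3: "card (tr 2 (2 + k) ` ?Y) \<le> card (tr 2 (2 + 1 + 2 * ?m) ` ?Y) * L"
  proof (rule card_image_fiber[OF fin])
    fix v assume v: "v \<in> ?Y"
    let ?F = "{w \<in> ?Y. tr 2 (2 + 1 + 2 * ?m) w = tr 2 (2 + 1 + 2 * ?m) v}"
    have "w (0 + k) = v (0 + k) \<and> w (0 + k + 2) = v (0 + k + 2)" if "w \<in> ?F" for w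
    proof -
      have eq: "w t = v t" if "2 \<le> t" "t < 2 + 1 + 2 * ?m" for t
        using \<open>w \<in> ?F\<close> tr_eqD that by blast
      have "w (0 + k) = v (0 + k)" by (rule eq) (use k assms(2) in linarith)+
      moreover have "w (0 + k + 2) = w 2" "v (0 + k + 2) = v 2"
        using per[of w 2] per[of v 2] that v by (simp_all add: ac_simps)
      moreover have "w 2 = v 2" by (rule eq) simp_all
      ultimately show ?thesis by simp
    qed
    then show "card ((\<lambda>w. w (0 + k + 1)) ` ?F) \<le> L"
      by (rule poor_mid[where v = v, rotated]) (use v rich_per[of v 0] in auto)
  next
    fix w w' :: "nat \<Rightarrow> 'a"
    assume 1: "tr 2 (2 + 1 + 2 * ?m) w = tr 2 (2 + 1 + 2 * ?m) w'"
      "w (0 + k + 1) = w' (0 + k + 1)"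
    show "tr 2 (2 + k) w = tr 2 (2 + k) w'"
    proof (rule tr_eqI)
      fix t assume t: "2 \<le> t" "t < 2 + k"
      show "w t = w' t"
      proof (cases "t = k + 1")
        case False
        show ?thesis by (rule tr_eqD[OF 1(1)]) (use t False k in linarith)+
      qed (use 1(2) in simp)
    qed
  qed
  have "card ?Y = card (tr 2 (2 + k) ` ?Y)" by (rule card_eq_tr[OF sub])
  also note 3
  also note mult_le_mono1[OF 2]
  also note mult_le_mono1[OF mult_le_mono1[OF 1]]
  finally show ?thesis .
qed

text \<open>The rich triple starts at entry 0, which equals entry \<open>k\<close>, and costs
  \<open>L\<close> times the forward degree there. The window from 3 to \<open>k\<close> has an even
  number of entries; its last edge contributes the backward degree at \<open>k\<close>, and an odd
  walk remains before it. The product of both degrees is then bounded by squares.\<close>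

lemma card_rich_even:
  assumes "even k" "k \<ge> 4"
  shows "card {v \<in> Z. rich L Z 0 v} \<le> 3 * L\<^sup>2 * n\<^sup>2 * (2 * L * n) ^ ((k - 4) div 2)"
proof -
  let ?Y = "{v \<in> Z. rich L Z 0 v}" and ?m = "(k - 4) div 2"
  let ?P = "(2 * L * n) ^ ?m"
  define f :: "(nat \<Rightarrow> 'a) \<Rightarrow> 'a list" where "f = tr 3 (k + 1)"
  have sub: "?Y \<subseteq> Z" by blast
  note fin = fin_sub[OF sub]
  have k: "k = 3 + 2 * ?m + 1" using assms(1,2) by presburger
  have split_f: "f v = tr 3 k v @ [v k]" for v
    using assms(2) by (simp add: f_def)
  have last_f: "last (f v) = v k" for v
    unfolding split_f by simp
  define d1 where "d1 = dplus Z 0"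
  define d2 where "d2 = dminus Z (k - 1)"
  have per0: "v k = v 0" if "v \<in> Z" for v
    using per[OF that, of 0] by simp
  have "card (tr 1 (1 + k) ` ?Y) \<le> (\<Sum>y\<in>f ` ?Y. L * d1 (last y))"
  proof (rule card_image_fiber_sum[OF fin, where g = "\<lambda>w. (w (0 + 1), w (0 + 2))"])
    fix v assume v: "v \<in> ?Y"
    have "w 0 = v 0" if "w \<in> ?Y" "f w = f v" for w
    proof -
      have "last (f w) = last (f v)" using that by simp
      then show ?thesis using per0[of w] per0[of v] v that(1) by (simp add: last_f)
    qed
    then have "card ((\<lambda>w. (w (0 + 1), w (0 + 2))) ` {w \<in> ?Y. f w = f v}) \<le> L * dplus Z 0 (v 0)"
      by (intro card_image_subset_le[OF _ _ rich_fwd]) blast+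
    then show "card ((\<lambda>w. (w (0 + 1), w (0 + 2))) ` {w \<in> ?Y. f w = f v}) \<le> L * d1 (last (f v))"
      using v per0[of v] by (simp add: last_f d1_def)
  next
    fix w w' :: "nat \<Rightarrow> 'a"
    assume g_eq: "(w (0 + 1), w (0 + 2)) = (w' (0 + 1), w' (0 + 2))"
    assume "f w = f w'"
    then have f_eq: "tr 3 (k + 1) w = tr 3 (k + 1) w'" by (simp only: f_def)
    show "tr 1 (1 + k) w = tr 1 (1 + k) w'"
    proof (rule tr_eqI)
      fix t assume t: "1 \<le> t" "t < 1 + k"
      then have "t = 0 + 1 \<or> t = 0 + 2 \<or> t \<ge> 3" by linarith
      then show "w t = w' t"
      proof (elim disjE)
        assume "t \<ge> 3"
        show ?thesis by (rule tr_eqD[OF f_eq]) (use t \<open>t \<ge> 3\<close> in linarith)+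
      qed (use g_eq in blast)+
    qed
  qed
  then have "card ?Y \<le> L * (\<Sum>y\<in>f ` ?Y. d1 (last y))"
    unfolding card_eq_tr[OF sub, of 1] sum_distrib_left .
  also have "(\<Sum>y\<in>f ` ?Y. d1 (last y)) \<le> (\<Sum>x\<in>(\<lambda>w. w k) ` Z. d1 x * (d2 x * ?P))"
  proof (rule sum_fiber_le)
    show "last ` f ` ?Y \<subseteq> (\<lambda>w. w k) ` Z"
      unfolding image_image last_f by blast
    fix x
    let ?S = "{v \<in> ?Y. v k = x}"
    have "{y \<in> f ` ?Y. last y = x} \<subseteq> (\<lambda>l. l @ [x]) ` tr 3 k ` ?S"
    proof
      fix y assume "y \<in> {y \<in> f ` ?Y. last y = x}"
      then obtain v where v: "v \<in> ?Y" "y = f v" "v k = x" by (auto simp: last_f)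
      then show "y \<in> (\<lambda>l. l @ [x]) ` tr 3 k ` ?S"
        unfolding v(2) split_f by blast
    qed
    then have "card {y \<in> f ` ?Y. last y = x} \<le> card ((\<lambda>l. l @ [x]) ` tr 3 k ` ?S)"
      using finZ by (intro card_mono) auto
    also have "\<dots> \<le> card (tr 3 k ` ?S)"
      using finZ by (intro card_image_le) auto
    also have "\<dots> = card (tr 3 (3 + 2 * ?m + 1) ` ?S)" unfolding k[symmetric] ..
    also have "\<dots> \<le> card ((\<lambda>w. w (3 + 2 * ?m)) ` ?S) * ?P"
      by (rule chain_back) blast
    also have "\<dots> \<le> d2 x * ?P"
    proof (rule mult_le_mono1)
      have "3 + 2 * ?m = k - 1" using k by linarith
      moreover have "{w \<in> Z. w (k - 1 + 1) = x} = {w \<in> Z. w k = x}"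
        using assms(2) by simp
      ultimately show "card ((\<lambda>w. w (3 + 2 * ?m)) ` ?S) \<le> d2 x"
        unfolding d2_def dminus_def using finZ by (intro card_mono) auto
    qed
    finally show "card {y \<in> f ` ?Y. last y = x} \<le> d2 x * ?P" .
  qed (use finZ in auto)
  also have "\<dots> = (\<Sum>x\<in>(\<lambda>w. w k) ` Z. d1 x * d2 x) * ?P"
    by (simp add: sum_distrib_right mult.assoc)
  also have "(\<Sum>x\<in>(\<lambda>w. w k) ` Z. d1 x * d2 x) \<le> 3 * L * n\<^sup>2"
  proof -
    have "2 * (\<Sum>x\<in>(\<lambda>w. w k) ` Z. d1 x * d2 x) = (\<Sum>x\<in>(\<lambda>w. w k) ` Z. 2 * (d1 x * d2 x))"
      by (simp add: sum_distrib_left)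
    also have "\<dots> \<le> (\<Sum>x\<in>(\<lambda>w. w k) ` Z. (d1 x)\<^sup>2 + (d2 x)\<^sup>2)"
      by (intro sum_mono mult_le_sum_squares)
    also have "\<dots> = (\<Sum>x\<in>(\<lambda>w. w 0) ` Z. (d1 x)\<^sup>2) + (\<Sum>x\<in>(\<lambda>w. w (k - 1 + 1)) ` Z. (d2 x)\<^sup>2)"
      using assms(2) per_image[of 0] by (simp add: sum.distrib)
    also have "\<dots> \<le> 3 * L * n\<^sup>2 + 3 * L * n\<^sup>2"
      unfolding d1_def d2_def by (intro add_mono sum_dplus sum_dminus)
    finally show ?thesis by linarith
  qed
  finally show ?thesis by (simp add: power2_eq_square algebra_simps)
qed

theorem card_even_family:
  assumes "even k" "k \<ge> 4"
  shows "card Z \<le> 5 * 2 ^ (k div 2) * L ^ (k div 2) * n ^ (k div 2)"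
proof -
  let ?m = "(k - 4) div 2"
  have r: "k div 2 = ?m + 2" "(k - 2) div 2 = ?m + 1" using assms by presburger+
  have "Z = {v \<in> Z. \<not> rich L Z 0 v} \<union> {v \<in> Z. rich L Z 0 v}" by blast
  then have "card Z \<le> card {v \<in> Z. \<not> rich L Z 0 v} + card {v \<in> Z. rich L Z 0 v}"
    by (metis card_Un_le)
  also have "\<dots> \<le> n * (2 * L * n) ^ (?m + 1) * L + 3 * L\<^sup>2 * n\<^sup>2 * (2 * L * n) ^ ?m"
    using card_poor_even[OF assms] card_rich_even[OF assms] unfolding r by (rule add_mono)
  also have "\<dots> = 5 * (2 ^ ?m * L ^ (?m + 2) * n ^ (?m + 2))"
    by (simp add: power_mult_distrib power_add power2_eq_square algebra_simps)
  also have "\<dots> \<le> 5 * (2 ^ (?m + 2) * L ^ (?m + 2) * n ^ (?m + 2))"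
    by (intro mult_le_mono le_refl power_increasing) simp_all
  finally show ?thesis unfolding r by (simp add: mult.assoc)
qed

end

section \<open>Coloured graphs without a cycle of given length\<close>

lemma und_converse: "und (E\<inverse>) = und E"
  by (auto simp: und_def fun_eq_iff)

lemma successively_und_mono:
  "successively (und E) xs \<Longrightarrow> E \<subseteq> E' \<Longrightarrow> successively (und E') xs"
  by (erule successively_mono) (auto simp: und_def)

text \<open>The sum counts triples of \<open>x\<close> with two neighbours \<open>a\<close> and
  \<open>b\<close>. For fixed \<open>a\<close> these are the edges \<open>(x, b)\<close> with
  \<open>x\<close> adjacent to \<open>a\<close>. Ends \<open>b\<close> with at most
  \<open>2 * l\<close> such edges are harmless; among the others a path of even length closes up
  through \<open>a\<close>.\<close>

lemma sum_degree_squares_le: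
  assumes "finite E" "fst ` E \<inter> snd ` E = {}" "card (fst ` E) \<le> n" "card (snd ` E) \<le> n"
    and "even t" "t \<le> l" "l \<ge> 1"
    and no: "\<And>a xs. length xs = Suc t \<Longrightarrow> distinct xs \<Longrightarrow> successively (und E) xs \<Longrightarrow> a \<notin> set xs \<Longrightarrow>
      set xs \<subseteq> fst ` E \<union> snd ` E \<Longrightarrow> (hd xs, a) \<in> E \<Longrightarrow> (last xs, a) \<in> E \<Longrightarrow> False"
  shows "(\<Sum>x\<in>fst ` E. (card {b. (x, b) \<in> E})\<^sup>2) \<le> 6 * l * n\<^sup>2"
proof -
  let ?A = "fst ` E" and ?B = "snd ` E"
  have fin: "finite ?A" "finite ?B" using assms(1) by auto
  define T where "T = (\<lambda>a. {e \<in> E. (fst e, a) \<in> E})"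
  have T: "card (T a) \<le> 5 * l * n" if "a \<in> ?B" for a
  proof -
    have fT: "finite (T a)" using assms(1) by (simp add: T_def)
    let ?deg = "\<lambda>b. card {x. (x, b) \<in> T a}"
    \<comment> \<open>Edges at \<open>a\<close> are split off because \<open>a\<close> must not lie
      on the path that it closes.\<close>
    let ?D = "{e \<in> T a. snd e = a}" and ?P = "{e \<in> T a. ?deg (snd e) \<le> 2 * l}"
    let ?R = "{e \<in> T a. snd e \<noteq> a \<and> ?deg (snd e) > 2 * l}"
    have "T a \<subseteq> ?D \<union> ?P \<union> ?R" by auto
    then have "card (T a) \<le> card (?D \<union> ?P \<union> ?R)"
      using fT by (intro card_mono) auto
    also have "\<dots> \<le> card ?D + card ?P + card ?R"
      using card_Un_le[of "?D \<union> ?P" ?R] card_Un_le[of ?D ?P] by linarith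
    also have "card ?D \<le> n"
    proof -
      have "card ?D \<le> card ?A"
        by (rule card_inj_on_le[of fst]) (auto simp: inj_on_def T_def fin)
      then show ?thesis using assms(3) by linarith
    qed
    also have "card ?P \<le> n * (2 * l)"
    proof -
      have "?P \<subseteq> (\<Union>b\<in>?B. {e \<in> ?P. snd e = b})" by (auto simp: T_def)
      then have "card ?P \<le> card (\<Union>b\<in>?B. {e \<in> ?P. snd e = b})"
        by (intro card_mono finite_UN_I fin) (simp add: fT)
      also have "\<dots> \<le> (\<Sum>b\<in>?B. card {e \<in> ?P. snd e = b})"
        using fin by (intro card_UN_le)
      also have "\<dots> \<le> (\<Sum>b\<in>?B. 2 * l)"
      proof (rule sum_mono)
        fix b
        show "card {e \<in> ?P. snd e = b} \<le> 2 * l"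
        proof (cases "{e \<in> ?P. snd e = b} = {}")
          case False
          then have "?deg b \<le> 2 * l" by blast
          moreover have "finite {x. (x, b) \<in> T a}"
            by (rule finite_subset[OF _ fin(1)]) (force simp: T_def)
          then have "card {e \<in> ?P. snd e = b} \<le> ?deg b"
            by (intro card_inj_on_le[of fst]) (auto simp: inj_on_def)
          ultimately show ?thesis by linarith
        next
          case True
          show ?thesis unfolding True by simp
        qed
      qed
      also have "\<dots> \<le> n * (2 * l)" using assms(4) by simp
      finally show ?thesis .
    qed
    also have "card ?R \<le> 2 * l * card (fst ` ?R)"
    proof (rule bip_edges_le[where t = t])
      show "finite ?R" using fT by simp
      have RE: "?R \<subseteq> E" by (auto simp: T_def)
      then have sub: "fst ` ?R \<subseteq> ?A" "snd ` ?R \<subseteq> ?B" by auto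
      then show "fst ` ?R \<inter> snd ` ?R = {}" using assms(2) by blast
      show "card {x. (x, b) \<in> ?R} > 2 * l" if b: "b \<in> snd ` ?R" for b
      proof -
        have "{x. (x, b) \<in> ?R} = {x. (x, b) \<in> T a}" using b by auto
        then show ?thesis using b by auto
      qed
      fix xs assume xs: "length xs = Suc t" "distinct xs" "successively (und ?R) xs"
        "hd xs \<in> fst ` ?R" "last xs \<in> (if even t then fst ` ?R else snd ` ?R)"
        "\<And>i. i \<le> t \<Longrightarrow> xs ! i \<in> (if even i then fst ` ?R else snd ` ?R)"
      have in_set: "set xs \<subseteq> fst ` ?R \<union> snd ` ?R"
      proof
        fix x assume "x \<in> set xs"
        then obtain i where "i < Suc t" "x = xs ! i" using xs(1) by (metis in_set_conv_nth)
        then show "x \<in> fst ` ?R \<union> snd ` ?R" using xs(6)[of i] by (simp split: if_splits)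
      qed
      have "a \<notin> fst ` ?R \<union> snd ` ?R" using that sub(1) assms(2) by auto
      then have "a \<notin> set xs" using in_set by blast
      moreover have "(x, a) \<in> E" if "x \<in> fst ` ?R" for x using that by (auto simp: T_def)
      moreover have "last xs \<in> fst ` ?R" using xs(5) assms(5) by simp
      moreover have "set xs \<subseteq> ?A \<union> ?B" using in_set sub by blast
      ultimately show False
        using no[OF xs(1,2) successively_und_mono[OF xs(3) RE], of a] xs(4) by blast
    qed (fact assms)
    also have "card (fst ` ?R) \<le> n"
    proof -
      have "card (fst ` ?R) \<le> card ?A" using fin by (intro card_mono) (auto simp: T_def)
      then show ?thesis using assms(3) by linarith
    qed
    finally have "card (T a) \<le> n + n * (2 * l) + 2 * l * n" by simp
    moreover have "n \<le> l * n" using assms(7) by simp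
    moreover have "n * (2 * l) = 2 * (l * n)" "2 * l * n = 2 * (l * n)" "5 * l * n = 5 * (l * n)"
      by simp_all
    ultimately show ?thesis by linarith
  qed
  have "(\<Sum>x\<in>?A. (card {b. (x, b) \<in> E})\<^sup>2) = (\<Sum>x\<in>?A. card ({b. (x, b) \<in> E} \<times> {b. (x, b) \<in> E}))"
    by (simp add: card_cartesian_product power2_eq_square)
  also have "\<dots> = card (SIGMA x:?A. {b. (x, b) \<in> E} \<times> {b. (x, b) \<in> E})"
  proof (rule card_SigmaI[symmetric])
    have "finite {b. (x, b) \<in> E}" for x
      by (rule finite_subset[OF _ fin(2)]) force
    then show "\<forall>x\<in>?A. finite ({b. (x, b) \<in> E} \<times> {b. (x, b) \<in> E})" by blast
  qed (use fin in simp)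
  also have "\<dots> \<le> card (SIGMA a:?B. T a)"
  proof (rule card_inj_on_le[of "\<lambda>(x, a, b). (a, (x, b))"])
    show "(\<lambda>(x, a, b). (a, (x, b))) ` (SIGMA x:?A. {b. (x, b) \<in> E} \<times> {b. (x, b) \<in> E}) \<subseteq> (SIGMA a:?B. T a)"
      by (force simp: T_def)
    show "finite (SIGMA a:?B. T a)"
      using assms(1) fin by (intro finite_SigmaI) (auto simp: T_def)
  qed (auto simp: inj_on_def)
  also have "\<dots> = (\<Sum>a\<in>?B. card (T a))"
    using assms(1) fin by (intro card_SigmaI) (auto simp: T_def)
  also have "\<dots> \<le> (\<Sum>a\<in>?B. 5 * l * n)" by (intro sum_mono T)
  \<comment> \<open>The factor 5 is rounded up to 6 to match \<open>3 * L\<close> with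
    \<open>L = 2 * l\<close>.\<close>
  also have "\<dots> \<le> 6 * l * n\<^sup>2"
  proof -
    have "card ?B * (5 * l * n) \<le> n * (6 * l * n)" using assms(4) by (intro mult_le_mono) auto
    then show ?thesis by (simp add: power2_eq_square ac_simps)
  qed
  finally show ?thesis .
qed

section \<open>Closed sequences through the colour classes of a graph\<close>

definition is_cycle :: "('a \<Rightarrow> 'a \<Rightarrow> bool) \<Rightarrow> nat \<Rightarrow> 'a list \<Rightarrow> bool" where
  "is_cycle adj l xs \<longleftrightarrow>
     length xs = l \<and> distinct xs \<and> successively adj xs \<and> adj (last xs) (hd xs)"

text \<open>The classes are indexed by all natural numbers, as the sequences are; their disjointness
  within one period provides the distinctness of vertices on the cycles to be built.\<close>

locale coloured_graph =
  fixes adj :: "'a \<Rightarrow> 'a \<Rightarrow> bool" and V :: "nat \<Rightarrow> 'a set" and k l n :: nat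
  assumes adj_sym: "adj x y \<Longrightarrow> adj y x"
    and V_disj: "i < j \<Longrightarrow> j < i + k \<Longrightarrow> V i \<inter> V j = {}"
    and finV: "finite (V i)" and cardV: "card (V i) \<le> n"
    and k4: "k \<ge> 4"
    and no_cycle: "\<not> is_cycle adj l xs"
begin

definition Z :: "(nat \<Rightarrow> 'a) set" where
  "Z = {v. \<forall>i. v i \<in> V i \<and> adj (v i) (v (Suc i)) \<and> v (i + k) = v i}"

lemma ZD: "v \<in> Z \<Longrightarrow> v i \<in> V i" "v \<in> Z \<Longrightarrow> adj (v i) (v (Suc i))" "v \<in> Z \<Longrightarrow> v (i + k) = v i"
  by (auto simp: Z_def)

lemma Z_period: "v \<in> Z \<Longrightarrow> v (i mod k) = v i"
proof (induction i rule: less_induct)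
  case (less i)
  show ?case
  proof (cases "i < k")
    case False
    then have "v (i - k) = v i" using ZD(3)[OF less.prems, of "i - k"] by simp
    moreover have "v ((i - k) mod k) = v (i - k)"
      using less False k4 by simp
    ultimately show ?thesis using False by (simp add: le_mod_geq)
  qed simp
qed

lemma finite_Z: "finite Z"
proof (rule finite_imageD)
  have "tr 0 k ` Z \<subseteq> {xs. set xs \<subseteq> (\<Union>i<k. V i) \<and> length xs = k}"
    using ZD(1) by fastforce
  then show "finite (tr 0 k ` Z)"
    by (rule finite_subset) (intro finite_lists_length_eq finite_UN_I finV finite_lessThan)
  show "inj_on (tr 0 k) Z"
  proof (rule inj_onI)
    fix v w assume vw: "v \<in> Z" "w \<in> Z" "tr 0 k v = tr 0 k w"
    have "v (i mod k) = w (i mod k)" for i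
      by (rule tr_eqD[OF vw(3)]) (use k4 in auto)
    then show "v = w" using Z_period[OF vw(1)] Z_period[OF vw(2)] by (metis ext)
  qed
qed

lemma image_Z_subset: "(\<lambda>w. w i) ` Z \<subseteq> V i"
  using ZD(1) by blast

lemma card_class: "card ((\<lambda>w. w i) ` Z) \<le> n"
  using card_mono[OF finV image_Z_subset] cardV order_trans by blast

lemma V_disj_near: "d \<in> {1, 2, 3} \<Longrightarrow> V i \<inter> V (i + d) = {}"
  using V_disj[of i "i + d"] k4 by auto

lemma successively_adj:
  "successively (und E) xs \<Longrightarrow> (\<And>a b. (a, b) \<in> E \<Longrightarrow> adj a b) \<Longrightarrow> successively adj xs"
  by (erule successively_mono) (auto simp: und_def intro: adj_sym)

definition edges :: "nat \<Rightarrow> ('a \<times> 'a) set" where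
  "edges i = (\<lambda>w. (w i, w (i + 1))) ` Z"

text \<open>The rich triples starting in \<open>x\<close>, seen as a bipartite graph between the
  next two classes.\<close>

definition fwd :: "nat \<Rightarrow> 'a \<Rightarrow> ('a \<times> 'a) set" where
  "fwd i x = (\<lambda>w. (w (i + 1), w (i + 2))) ` {w \<in> Z. w i = x \<and> rich (2 * l) Z i w}"

definition bwd :: "nat \<Rightarrow> 'a \<Rightarrow> ('a \<times> 'a) set" where
  "bwd i x = (\<lambda>w. (w i, w (i + 1))) ` {w \<in> Z. w (i + 2) = x \<and> rich (2 * l) Z i w}"

lemma edges_V: "fst ` edges i \<subseteq> V i" "snd ` edges i \<subseteq> V (i + 1)"
  and fwd_V: "fst ` fwd i x \<subseteq> V (i + 1)" "snd ` fwd i x \<subseteq> V (i + 2)"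
  and bwd_V: "fst ` bwd i x \<subseteq> V i" "snd ` bwd i x \<subseteq> V (i + 1)"
  unfolding edges_def fwd_def bwd_def image_image fst_conv snd_conv using ZD(1) by blast+

lemma edges_adj: "(a, b) \<in> edges i \<Longrightarrow> adj a b"
  and fwd_adj: "(a, b) \<in> fwd i x \<Longrightarrow> adj a b"
  and bwd_adj: "(a, b) \<in> bwd i x \<Longrightarrow> adj a b"
proof -
  show "(a, b) \<in> edges i \<Longrightarrow> adj a b"
    using ZD(2)[of _ i] by (auto simp: edges_def)
  show "(a, b) \<in> fwd i x \<Longrightarrow> adj a b"
    using ZD(2)[of _ "i + 1"] by (auto simp: fwd_def)
  show "(a, b) \<in> bwd i x \<Longrightarrow> adj a b"
    using ZD(2)[of _ i] by (auto simp: bwd_def)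
qed

lemma edges_disj: "fst ` edges i \<inter> snd ` edges i = {}"
  using edges_V[of i] V_disj_near[of 1 i] by blast

lemma fwd_disj: "fst ` fwd i x \<inter> snd ` fwd i x = {}"
  using fwd_V[of i x] V_disj_near[of 1 "i + 1"] by (simp add: numeral_2_eq_2) blast

lemma bwd_disj: "fst ` bwd i x \<inter> snd ` bwd i x = {}"
  using bwd_V[of i x] V_disj_near[of 1 i] by blast

text \<open>By richness every vertex on the far side has more than \<open>2 * l\<close> neighbours,
  so \<open>bip_edges_le\<close> leaves only the side next to \<open>x\<close>, whose size is at
  most the degree of \<open>x\<close>. How a long path produces a forbidden cycle is left open,
  since it depends on the parity of \<open>l\<close>.\<close>

lemma rich_fwd_bound:
  assumes "t \<le> l"
    and "\<And>xs. length xs = Suc t \<Longrightarrow> distinct xs \<Longrightarrow> successively adj xs \<Longrightarrow> hd xs \<in> fst ` fwd i x \<Longrightarrow>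
      last xs \<in> (if even t then fst ` fwd i x else snd ` fwd i x) \<Longrightarrow> set xs \<subseteq> V (i + 1) \<union> V (i + 2) \<Longrightarrow> False"
  shows "card (fwd i x) \<le> 2 * l * dplus Z i x"
proof -
  have "card (fwd i x) \<le> 2 * l * card (fst ` fwd i x)"
  proof (rule bip_edges_le[where t = t])
    show "finite (fwd i x)" unfolding fwd_def using finite_Z by simp
    show "card {a. (a, b) \<in> fwd i x} > 2 * l" if "b \<in> snd ` fwd i x" for b
    proof -
      from that obtain w where w: "w \<in> Z" "w i = x" "rich (2 * l) Z i w" "b = w (i + 2)"
        unfolding fwd_def image_image snd_conv by blast
      \<comment> \<open>Richness depends only on the two ends, so every sequence of \<open>Z\<close>
        leading from \<open>x\<close> to \<open>b\<close> is rich as well.\<close>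
      have "mids Z i x b \<subseteq> {a. (a, b) \<in> fwd i x}"
        using w by (auto simp: mids_def fwd_def rich_def image_iff)
      moreover have "finite {a. (a, b) \<in> fwd i x}"
        by (rule finite_subset[OF _ finV[of "i + 1"]]) (use fwd_V(1)[of i x] in force)
      ultimately have "card (mids Z i x b) \<le> card {a. (a, b) \<in> fwd i x}"
        by (rule card_mono[rotated])
      then show ?thesis using w by (simp add: rich_def)
    qed
    fix xs assume xs: "length xs = Suc t" "distinct xs" "successively (und (fwd i x)) xs"
      "hd xs \<in> fst ` fwd i x" "last xs \<in> (if even t then fst ` fwd i x else snd ` fwd i x)"
      "\<And>j. j \<le> t \<Longrightarrow> xs ! j \<in> (if even j then fst ` fwd i x else snd ` fwd i x)"
    have "set xs \<subseteq> V (i + 1) \<union> V (i + 2)"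
    proof
      fix y assume "y \<in> set xs"
      then obtain j where "j < Suc t" "y = xs ! j" using xs(1) by (metis in_set_conv_nth)
      then show "y \<in> V (i + 1) \<union> V (i + 2)"
        using xs(6)[of j] fwd_V[of i x] by (simp split: if_splits) blast+
    qed
    then show False
      using assms(2)[OF xs(1,2) successively_adj[OF xs(3)] xs(4,5)] fwd_adj by blast
  qed (rule fwd_disj assms)+
  also have "\<dots> \<le> 2 * l * dplus Z i x"
  proof (rule mult_le_mono2)
    have "fst ` fwd i x \<subseteq> (\<lambda>w. w (i + 1)) ` {w \<in> Z. w i = x}"
      unfolding fwd_def image_image fst_conv by blast
    then show "card (fst ` fwd i x) \<le> dplus Z i x"
      unfolding dplus_def using finite_Z by (intro card_mono) auto
  qed
  finally show ?thesis .
qed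

lemma rich_bwd_bound:
  assumes "t \<le> l"
    and "\<And>xs. length xs = Suc t \<Longrightarrow> distinct xs \<Longrightarrow> successively adj xs \<Longrightarrow> hd xs \<in> snd ` bwd i x \<Longrightarrow>
      last xs \<in> (if even t then snd ` bwd i x else fst ` bwd i x) \<Longrightarrow> set xs \<subseteq> V i \<union> V (i + 1) \<Longrightarrow> False"
  shows "card (bwd i x) \<le> 2 * l * dminus Z (i + 1) x"
proof -
  have "card (bwd i x) \<le> 2 * l * card (snd ` bwd i x)"
  proof (rule bip_edges_le'[where t = t])
    show "finite (bwd i x)" unfolding bwd_def using finite_Z by simp
    show "card {b. (a, b) \<in> bwd i x} > 2 * l" if "a \<in> fst ` bwd i x" for a
    proof -
      from that obtain w where w: "w \<in> Z" "w (i + 2) = x" "rich (2 * l) Z i w" "a = w i"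
        unfolding bwd_def image_image fst_conv by blast
      have "mids Z i a x \<subseteq> {b. (a, b) \<in> bwd i x}"
        using w by (auto simp: mids_def bwd_def rich_def image_iff)
      moreover have "finite {b. (a, b) \<in> bwd i x}"
        by (rule finite_subset[OF _ finV[of "i + 1"]]) (use bwd_V(2)[of i x] in force)
      ultimately have "card (mids Z i a x) \<le> card {b. (a, b) \<in> bwd i x}"
        by (rule card_mono[rotated])
      then show ?thesis using w by (simp add: rich_def)
    qed
    fix xs assume xs: "length xs = Suc t" "distinct xs" "successively (und (bwd i x)) xs"
      "hd xs \<in> snd ` bwd i x" "last xs \<in> (if even t then snd ` bwd i x else fst ` bwd i x)"
      "\<And>j. j \<le> t \<Longrightarrow> xs ! j \<in> (if even j then snd ` bwd i x else fst ` bwd i x)"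
    have "set xs \<subseteq> V i \<union> V (i + 1)"
    proof
      fix y assume "y \<in> set xs"
      then obtain j where "j < Suc t" "y = xs ! j" using xs(1) by (metis in_set_conv_nth)
      then show "y \<in> V i \<union> V (i + 1)"
        using xs(6)[of j] bwd_V[of i x] by (simp split: if_splits) blast+
    qed
    then show False
      using assms(2)[OF xs(1,2) successively_adj[OF xs(3)] xs(4,5)] bwd_adj by blast
  qed (rule bwd_disj assms)+
  also have "\<dots> \<le> 2 * l * dminus Z (i + 1) x"
  proof (rule mult_le_mono2)
    have "snd ` bwd i x \<subseteq> (\<lambda>w. w (i + 1)) ` {w \<in> Z. w (i + 1 + 1) = x}"
      unfolding bwd_def image_image snd_conv by auto
    then show "card (snd ` bwd i x) \<le> dminus Z (i + 1) x"
      unfolding dminus_def using finite_Z by (intro card_mono) auto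
  qed
  finally show ?thesis .
qed

lemma dplus_edges: "dplus Z i x = card {b. (x, b) \<in> edges i}"
proof -
  have "(\<lambda>w. w (i + 1)) ` {w \<in> Z. w i = x} = {b. (x, b) \<in> edges i}"
    by (auto simp: edges_def image_iff)
  then show ?thesis by (simp add: dplus_def)
qed

lemma dminus_edges: "dminus Z i x = card {b. (x, b) \<in> (edges i)\<inverse>}"
proof -
  have "(\<lambda>w. w i) ` {w \<in> Z. w (i + 1) = x} = {b. (x, b) \<in> (edges i)\<inverse>}"
    by (auto simp: edges_def image_iff)
  then show ?thesis by (simp add: dminus_def)
qed

lemma finite_edges: "finite (edges i)"
  using finite_Z by (simp add: edges_def)

lemma card_edges_ends: "card (fst ` edges i) \<le> n" "card (snd ` edges i) \<le> n"
  using edges_V[of i] finV cardV by (meson card_mono order_trans)+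

lemma sum_dplus_bound:
  assumes "even t" "t \<le> l" "l \<ge> 1"
    and "\<And>a xs. length xs = Suc t \<Longrightarrow> distinct xs \<Longrightarrow> successively adj xs \<Longrightarrow> a \<notin> set xs \<Longrightarrow>
      set xs \<subseteq> V i \<union> V (i + 1) \<Longrightarrow> (hd xs, a) \<in> edges i \<Longrightarrow> (last xs, a) \<in> edges i \<Longrightarrow> False"
  shows "(\<Sum>x\<in>(\<lambda>w. w i) ` Z. (dplus Z i x)\<^sup>2) \<le> 3 * (2 * l) * n\<^sup>2"
proof -
  have "(\<Sum>x\<in>fst ` edges i. (card {b. (x, b) \<in> edges i})\<^sup>2) \<le> 6 * l * n\<^sup>2"
  proof (rule sum_degree_squares_le[OF finite_edges edges_disj card_edges_ends assms(1-3)])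
    fix a xs
    assume xs: "length xs = Suc t" "distinct xs" "successively (und (edges i)) xs" "a \<notin> set xs"
      "set xs \<subseteq> fst ` edges i \<union> snd ` edges i" "(hd xs, a) \<in> edges i" "(last xs, a) \<in> edges i"
    have "set xs \<subseteq> V i \<union> V (i + 1)" using xs(5) edges_V[of i] by blast
    then show False
      using assms(4)[OF xs(1,2) successively_adj[OF xs(3)] xs(4)] edges_adj xs(6,7) by blast
  qed
  moreover have "(\<lambda>w. w i) ` Z = fst ` edges i"
    by (simp add: edges_def image_image)
  ultimately show ?thesis by (simp add: dplus_edges)
qed

lemma sum_dminus_bound:
  assumes "even t" "t \<le> l" "l \<ge> 1"
    and "\<And>a xs. length xs = Suc t \<Longrightarrow> distinct xs \<Longrightarrow> successively adj xs \<Longrightarrow> a \<notin> set xs \<Longrightarrow>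
      set xs \<subseteq> V i \<union> V (i + 1) \<Longrightarrow> (a, hd xs) \<in> edges i \<Longrightarrow> (a, last xs) \<in> edges i \<Longrightarrow> False"
  shows "(\<Sum>x\<in>(\<lambda>w. w (i + 1)) ` Z. (dminus Z i x)\<^sup>2) \<le> 3 * (2 * l) * n\<^sup>2"
proof -
  have conv: "fst ` ((edges i)\<inverse>) = snd ` edges i" "snd ` ((edges i)\<inverse>) = fst ` edges i"
    by force+
  have "(\<Sum>x\<in>fst ` ((edges i)\<inverse>). (card {b. (x, b) \<in> (edges i)\<inverse>})\<^sup>2) \<le> 6 * l * n\<^sup>2"
  proof (rule sum_degree_squares_le[OF _ _ _ _ assms(1-3)])
    show "finite ((edges i)\<inverse>)" using finite_edges by simp
    show "fst ` ((edges i)\<inverse>) \<inter> snd ` ((edges i)\<inverse>) = {}"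
      unfolding conv using edges_disj by blast
    show "card (fst ` ((edges i)\<inverse>)) \<le> n" "card (snd ` ((edges i)\<inverse>)) \<le> n"
      unfolding conv by (rule card_edges_ends)+
    fix a xs
    assume xs: "length xs = Suc t" "distinct xs" "successively (und ((edges i)\<inverse>)) xs" "a \<notin> set xs"
      "set xs \<subseteq> fst ` ((edges i)\<inverse>) \<union> snd ` ((edges i)\<inverse>)" "(hd xs, a) \<in> (edges i)\<inverse>" "(last xs, a) \<in> (edges i)\<inverse>"
    have "set xs \<subseteq> V i \<union> V (i + 1)" using xs(5) edges_V[of i] unfolding conv by blast
    then show False
      using assms(4)[OF xs(1,2) successively_adj[OF xs(3)[unfolded und_converse]] xs(4)] edges_adj
        xs(6,7) by blast
  qed
  moreover have "(\<lambda>w. w (i + 1)) ` Z = fst ` ((edges i)\<inverse>)"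
    unfolding conv by (simp add: edges_def image_image)
  ultimately show ?thesis by (simp add: dminus_edges)
qed

end

section \<open>Closing up paths, and the edges at distance two\<close>

context coloured_graph
begin

lemma closed_familyI:
  assumes "\<And>i x. card (fwd i x) \<le> 2 * l * dplus Z i x"
    and "\<And>i x. card (bwd i x) \<le> 2 * l * dminus Z (i + 1) x"
    and "\<And>i. (\<Sum>x\<in>(\<lambda>w. w i) ` Z. (dplus Z i x)\<^sup>2) \<le> 3 * (2 * l) * n\<^sup>2"
    and "\<And>i. (\<Sum>x\<in>(\<lambda>w. w (i + 1)) ` Z. (dminus Z i x)\<^sup>2) \<le> 3 * (2 * l) * n\<^sup>2"
  shows "closed_family Z k (2 * l) n"
proof
  show "finite Z" by (rule finite_Z)
  show "v \<in> Z \<Longrightarrow> v (i + k) = v i" for v i by (rule ZD(3))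
  show "k > 0" using k4 by simp
  show "card ((\<lambda>w. w i) ` Z) \<le> n" for i by (rule card_class)
  show "card ((\<lambda>w. (w (i + 1), w (i + 2))) ` {w \<in> Z. w i = x \<and> rich (2 * l) Z i w})
      \<le> 2 * l * dplus Z i x" for i x
    using assms(1) unfolding fwd_def .
  show "card ((\<lambda>w. (w i, w (i + 1))) ` {w \<in> Z. w (i + 2) = x \<and> rich (2 * l) Z i w})
      \<le> 2 * l * dminus Z (i + 1) x" for i x
    using assms(2) unfolding bwd_def .
qed (rule assms)+

lemma cycle_Cons:
  assumes "length xs = Suc t" "Suc (Suc t) = l" "distinct xs" "successively adj xs" "x \<notin> set xs"
    "adj x (hd xs)" "adj x (last xs)"
  shows False
proof -
  have "xs \<noteq> []" using assms(1) by auto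
  then have "is_cycle adj l (x # xs)"
    using assms adj_sym by (simp add: is_cycle_def successively_Cons)
  then show False using no_cycle by blast
qed

lemma fwd_ends: "a \<in> fst ` fwd i x \<Longrightarrow> adj x a"
  using ZD(2)[of _ i] by (auto simp: fwd_def)

lemma bwd_ends: "a \<in> snd ` bwd i x \<Longrightarrow> adj x a"
  using ZD(2)[of _ "i + 1"] by (auto simp: bwd_def intro: adj_sym)

text \<open>The set that the hypothesis \<open>second\<close> of \<open>card_odd_family\<close>
  bounds.\<close>

definition far :: "nat \<Rightarrow> 'a \<Rightarrow> ('a \<times> 'a) set" where
  "far i x = (\<lambda>w. (w (i + 2), w (i + 3))) ` {w \<in> Z. w i = x}"

lemma far_V: "fst ` far i x \<subseteq> V (i + 2)" "snd ` far i x \<subseteq> V (i + 3)"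
  unfolding far_def image_image fst_conv snd_conv using ZD(1) by blast+

lemma far_adj: "(a, b) \<in> far i x \<Longrightarrow> adj a b"
  using ZD(2)[of _ "i + 2"] by (auto simp: far_def eval_nat_numeral)

lemma far_disj: "fst ` far i x \<inter> snd ` far i x = {}"
  using far_V[of i x] V_disj_near[of 1 "i + 2"] by (simp add: eval_nat_numeral) blast

lemma finite_far: "finite (far i x)"
  using finite_Z by (simp add: far_def)

lemma card_far_le:
  assumes "\<not> card (far i x) > l * (card (fst ` far i x) + card (snd ` far i x))"
  shows "card (far i x) \<le> 2 * l * n"
proof -
  have "card (fst ` far i x) \<le> n" "card (snd ` far i x) \<le> n"
    using far_V[of i x] finV cardV by (meson card_mono order_trans)+
  then have "l * (card (fst ` far i x) + card (snd ` far i x)) \<le> l * (n + n)"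
    by (intro mult_le_mono2) linarith
  moreover have "l * (n + n) = 2 * l * n" by simp
  ultimately show ?thesis using assms by linarith
qed

end

subsection \<open>Forbidding an even cycle\<close>

locale coloured_even = coloured_graph +
  assumes even_l: "even l" and l6: "l \<ge> 6"
begin

sublocale closed_family Z k "2 * l" n
proof (rule closed_familyI)
  have l2: "Suc (Suc (l - 2)) = l" "even (l - 2)" "l - 2 \<le> l" "l \<ge> 1"
    using l6 even_l by auto
  show "card (fwd i x) \<le> 2 * l * dplus Z i x" for i x
  proof (cases "fwd i x = {}")
    case False
    then have x: "x \<in> V i" using ZD(1) by (auto simp: fwd_def)
    show ?thesis
    \<comment> \<open>A path on \<open>l - 1\<close> vertices has even length, so it ends on the
      side where it starts, and this is the side adjacent to \<open>x\<close>.\<close>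
    proof (rule rich_fwd_bound[OF l2(3)])
      fix xs assume xs: "length xs = Suc (l - 2)" "distinct xs" "successively adj xs"
        "hd xs \<in> fst ` fwd i x" "last xs \<in> (if even (l - 2) then fst ` fwd i x else snd ` fwd i x)"
        "set xs \<subseteq> V (i + 1) \<union> V (i + 2)"
      have "x \<notin> set xs"
        using x xs(6) V_disj_near[of 1 i] V_disj_near[of 2 i] by blast
      moreover have "last xs \<in> fst ` fwd i x" using xs(5) l2(2) by simp
      ultimately show False
        using cycle_Cons[OF xs(1) l2(1) xs(2,3)] fwd_ends xs(4) by blast
    qed
  qed simp
  show "card (bwd i x) \<le> 2 * l * dminus Z (i + 1) x" for i x
  proof (cases "bwd i x = {}")
    case False
    then have x: "x \<in> V (i + 2)" using ZD(1) by (auto simp: bwd_def)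
    show ?thesis
    proof (rule rich_bwd_bound[OF l2(3)])
      fix xs assume xs: "length xs = Suc (l - 2)" "distinct xs" "successively adj xs"
        "hd xs \<in> snd ` bwd i x" "last xs \<in> (if even (l - 2) then snd ` bwd i x else fst ` bwd i x)"
        "set xs \<subseteq> V i \<union> V (i + 1)"
      have "x \<notin> set xs"
        using x xs(6) V_disj_near[of 1 "i + 1"] V_disj_near[of 2 i] by (auto simp: eval_nat_numeral)
      moreover have "last xs \<in> snd ` bwd i x" using xs(5) l2(2) by simp
      ultimately show False
        using cycle_Cons[OF xs(1) l2(1) xs(2,3)] bwd_ends xs(4) by blast
    qed
  qed simp
  show "(\<Sum>x\<in>(\<lambda>w. w i) ` Z. (dplus Z i x)\<^sup>2) \<le> 3 * (2 * l) * n\<^sup>2" for i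
  proof (rule sum_dplus_bound[OF l2(2,3,4)])
    fix a xs assume xs: "length xs = Suc (l - 2)" "distinct xs" "successively adj xs" "a \<notin> set xs"
      "(hd xs, a) \<in> edges i" "(last xs, a) \<in> edges i"
    show False
      by (rule cycle_Cons[OF xs(1) l2(1) xs(2,3,4)]) (rule adj_sym, rule edges_adj, rule xs)+
  qed
  show "(\<Sum>x\<in>(\<lambda>w. w (i + 1)) ` Z. (dminus Z i x)\<^sup>2) \<le> 3 * (2 * l) * n\<^sup>2" for i
  proof (rule sum_dminus_bound[OF l2(2,3,4)])
    fix a xs assume xs: "length xs = Suc (l - 2)" "distinct xs" "successively adj xs" "a \<notin> set xs"
      "(a, hd xs) \<in> edges i" "(a, last xs) \<in> edges i"
    show False
      by (rule cycle_Cons[OF xs(1) l2(1) xs(2,3,4)]) (rule edges_adj, rule xs)+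
  qed
qed

text \<open>
  Every second neighbour of x gets a parent, a common neighbour with x. If some vertex of a dense
  bipartite graph on top of the second neighbours sees two parents, a path of length l - 5 from it
  closes up through x with the appropriate one of them; otherwise all parents along a path agree and
  a path of length l - 2 closes up through the common parent.
\<close>

lemma second_neighbours: "card (far i x) \<le> 2 * l * n"
proof (rule card_far_le, rule notI)
  let ?E = "far i x"
  let ?A = "fst ` ?E" and ?B = "snd ` ?E"
  assume dense: "card ?E > l * (card ?A + card ?B)"
  obtain W where W: "finite W" "W \<subseteq> ?A \<union> ?B" "\<And>y. y \<in> W \<Longrightarrow> card {z \<in> W. und ?E y z} > l"
    "W \<inter> ?A \<noteq> {}" "W \<inter> ?B \<noteq> {}"
    by (rule bip_min_degree[OF finite_far far_disj dense]) (rule that)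
  have "\<exists>p. \<forall>b\<in>?A. p b \<in> V (i + 1) \<and> adj x (p b) \<and> adj (p b) b"
  proof (rule bchoice, rule ballI)
    fix b assume "b \<in> ?A"
    then obtain w where "w \<in> Z" "w i = x" "w (i + 2) = b"
      unfolding far_def image_image fst_conv by blast
    then show "\<exists>p. p \<in> V (i + 1) \<and> adj x p \<and> adj p b"
      using ZD(1)[of w "i + 1"] ZD(2)[of w i] ZD(2)[of w "i + 1"]
      by (intro exI[of _ "w (i + 1)"]) auto
  qed
  then obtain p where p: "\<And>b. b \<in> ?A \<Longrightarrow> p b \<in> V (i + 1)" "\<And>b. b \<in> ?A \<Longrightarrow> adj x (p b)"
    "\<And>b. b \<in> ?A \<Longrightarrow> adj (p b) b" by blast
  have xV: "x \<in> V i" using W(4) ZD(1) by (auto simp: far_def)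
  have EAB: "?E \<subseteq> ?A \<times> ?B" by force
  have WV: "W \<subseteq> V (i + 2) \<union> V (i + 3)" using W(2) far_V[of i x] by blast
  have d1: "V i \<inter> V (i + 1) = {}" and d2: "V i \<inter> (V (i + 2) \<union> V (i + 3)) = {}"
    and d3: "V (i + 1) \<inter> (V (i + 2) \<union> V (i + 3)) = {}"
    using V_disj_near[of 1 i] V_disj_near[of 2 i] V_disj_near[of 3 i]
      V_disj_near[of 1 "i + 1"] V_disj_near[of 2 "i + 1"]
    by (simp_all add: eval_nat_numeral Int_Un_distrib)
  show False
  proof (cases "\<exists>y b b'. y \<in> W \<and> b \<in> W \<and> b' \<in> W \<and> (b, y) \<in> ?E \<and> (b', y) \<in> ?E \<and> p b \<noteq> p b'")
    case True
    then obtain y b b' where y: "y \<in> W" "b \<in> W" "b' \<in> W" "(b, y) \<in> ?E" "(b', y) \<in> ?E" "p b \<noteq> p b'"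
      by blast
    \<comment> \<open>Both \<open>b\<close> and \<open>b'\<close> are kept off the path, since only
      its last vertex decides which of them has the other parent.\<close>
    have "card {b, b'} + (l - 5) \<le> l"
      using l6 card_insert_le_m1[of 2 "{b'}" b] by simp
    then obtain xs where xs: "length xs = Suc (l - 5)" "hd xs = y" "distinct xs" "set xs \<subseteq> W"
      "set (tl xs) \<inter> {b, b'} = {}" "successively (und ?E) xs"
      using greedy_path[where R = "und ?E" and U = "{b, b'}" and t = "l - 5", OF W(1,3) y(1)] by auto
    have ne: "xs \<noteq> []" using xs(1) by auto
    have bA: "b \<in> ?A" "b' \<in> ?A" "y \<in> ?B" using y EAB by auto
    have out: "b \<notin> set xs" "b' \<notin> set xs"
      using ne xs(2,5) bA far_disj[of i x] by (cases xs; auto)+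
    have lastA: "last xs \<in> ?A"
    proof -
      have "odd (l - 5)" using even_l l6 by simp
      moreover have "last xs = xs ! (l - 5)" using xs(1) ne by (simp add: last_conv_nth)
      moreover have "set xs \<subseteq> ?A \<union> ?B" using xs(4) W(2) by blast
      ultimately show ?thesis
        using und_alternate(2)[OF EAB far_disj xs(6), of "l - 5"] xs(1,2) bA(3) by simp
    qed
    obtain \<beta> where \<beta>: "\<beta> \<in> {b, b'}" "p \<beta> \<noteq> p (last xs)" using y(6) by (metis insertCI)
    have \<beta>A: "\<beta> \<in> ?A" "\<beta> \<in> W" "\<beta> \<notin> set xs" "adj \<beta> y"
      using \<beta>(1) bA y out far_adj by auto
    \<comment> \<open>The path contributes \<open>l - 4\<close> vertices; \<open>x\<close>,
      \<open>\<beta>\<close> and two distinct parents complete the cycle.\<close>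
    let ?c = "x # p \<beta> # \<beta> # xs @ [p (last xs)]"
    have "length ?c = l" using xs(1) l6 by simp
    moreover have "distinct ?c"
    proof -
      have "p \<beta> \<in> V (i + 1)" "p (last xs) \<in> V (i + 1)" using p(1) \<beta>A lastA by blast+
      moreover have "set (\<beta> # xs) \<subseteq> V (i + 2) \<union> V (i + 3)" using WV xs(4) \<beta>A by auto
      ultimately show ?thesis
        using d1 d2 d3 xV xs(3) \<beta>A(3) \<beta>(2) by auto
    qed
    moreover have "successively adj ?c"
    proof -
      have "successively adj xs" by (rule successively_adj[OF xs(6)]) (rule far_adj)
      then show ?thesis
        using p \<beta>A lastA xs(2) ne by (simp add: successively_Cons successively_append_iff adj_sym)
    qed
    moreover have "adj (last ?c) (hd ?c)" using p(2)[OF lastA] by (simp add: adj_sym)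
    ultimately show False using no_cycle unfolding is_cycle_def by blast
  next
    case False
    obtain b where b: "b \<in> W" "b \<in> ?A" using W(4) by blast
    obtain xs where xs: "length xs = Suc (l - 2)" "hd xs = b" "distinct xs" "set xs \<subseteq> W"
      "successively (und ?E) xs"
      using greedy_path[where R = "und ?E" and U = "{}" and t = "l - 2", OF W(1,3) b(1)] by auto
    have alt: "xs ! j \<in> (if even j then ?A else ?B)" if "j \<le> l - 2" for j
      using und_alternate(1)[OF EAB far_disj xs(5), of j] xs(1,2,4) b(2) W(2) that by auto
    \<comment> \<open>Vertices two apart on the path share the neighbour between them, and in this
      case that neighbour sees one parent only.\<close>
    have same: "p (xs ! (2 * j)) = p b" if "2 * j \<le> l - 2" for j
      using that
    proof (induction j)
      case 0
      then show ?case using xs(1,2) by (metis hd_conv_nth length_0_conv mult_0_right nat.distinct(1))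
    next
      case (Suc j)
      let ?u = "xs ! (2 * j)" and ?y = "xs ! Suc (2 * j)" and ?v = "xs ! Suc (Suc (2 * j))"
      have len: "Suc (Suc (2 * j)) < length xs" using Suc.prems xs(1) by simp
      have "und ?E ?u ?y" "und ?E ?y ?v"
        using xs(5) len unfolding successively_iff_nth by auto
      moreover have "?u \<in> ?A" "?v \<in> ?A" "?y \<in> ?B"
        using alt[of "2 * j"] alt[of "Suc (2 * j)"] alt[of "Suc (Suc (2 * j))"] Suc.prems by auto
      ultimately have "(?u, ?y) \<in> ?E" "(?v, ?y) \<in> ?E"
        using far_disj[of i x] by (force simp: und_def)+
      moreover have "?u \<in> W" "?v \<in> W" "?y \<in> W" using xs(4) len by auto
      ultimately have "p ?u = p ?v" using False by blast
      then show ?case using Suc by simp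
    qed
    have "xs \<noteq> []" using xs(1) by auto
    then have "last xs = xs ! (l - 2)" using xs(1) by (simp add: last_conv_nth)
    moreover have "2 * ((l - 2) div 2) = l - 2" using even_l by simp
    ultimately have "last xs = xs ! (2 * ((l - 2) div 2))" by simp
    then have last: "p (last xs) = p b" "last xs \<in> ?A"
      using same[of "(l - 2) div 2"] alt[of "2 * ((l - 2) div 2)"] by simp_all
    have "p b \<notin> set xs" using p(1)[OF b(2)] d3 xs(4) WV by blast
    moreover have "successively adj xs" by (rule successively_adj[OF xs(5)]) (rule far_adj)
    moreover have "adj (p b) (hd xs)" "adj (p b) (last xs)"
      using p(3)[OF b(2)] p(3)[OF last(2)] last(1) xs(2) by simp_all
    moreover have "Suc (Suc (l - 2)) = l" using l6 by simp
    ultimately show False using cycle_Cons[OF xs(1) _ xs(3)] by blast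
  qed
qed

end

subsection \<open>Forbidding an odd cycle\<close>

locale coloured_odd = coloured_graph +
  assumes odd_k: "odd k" and odd_l: "odd l" and k_less_l: "k < l"
begin

text \<open>An edge of a closed sequence of length k is replaced by a path of length l - k + 1.\<close>

lemma odd_closing:
  assumes xs: "length xs = l - k + 2" "distinct xs" "successively adj xs" "set xs \<subseteq> V j \<union> V (j + 1)"
    and u: "\<And>m. j + 2 \<le> m \<Longrightarrow> m < j + k \<Longrightarrow> u m \<in> V m"
      "\<And>m. j + 2 \<le> m \<Longrightarrow> m + 1 < j + k \<Longrightarrow> adj (u m) (u (m + 1))"
      "adj (last xs) (u (j + 2))" "adj (u (j + k - 1)) (hd xs)"
  shows False
proof -
  let ?us = "map u [j + 2..<j + k]"
  have ne: "xs \<noteq> []" "?us \<noteq> []" using xs(1) k4 by auto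
  have "length (xs @ ?us) = l" using xs(1) k_less_l k4 by simp
  moreover have "distinct (xs @ ?us)"
  proof -
    have neq: "u m \<noteq> u m'" if "j + 2 \<le> m" "m < m'" "m' < j + k" for m m'
      using V_disj[of m m'] u(1)[of m] u(1)[of m'] that by auto
    have "inj_on u {j + 2..<j + k}"
    proof (rule inj_onI)
      fix m m' assume "m \<in> {j + 2..<j + k}" "m' \<in> {j + 2..<j + k}" "u m = u m'"
      then show "m = m'" using neq[of m m'] neq[of m' m] by (cases m m' rule: linorder_cases) auto
    qed
    moreover have "u m \<notin> set xs" if "j + 2 \<le> m" "m < j + k" for m
      using u(1)[OF that] xs(4) V_disj[of j m] V_disj[of "j + 1" m] that by auto
    ultimately show ?thesis using xs(2) by (auto simp: distinct_map)
  qed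
  moreover have "successively adj (xs @ ?us)"
  proof -
    have "successively adj ?us"
      unfolding successively_iff_nth using u(2) by simp
    moreover have "hd ?us = u (j + 2)" using k4 by (simp add: hd_map)
    ultimately show ?thesis
      using xs(3) u(3) by (simp add: successively_append_iff)
  qed
  moreover have "adj (last (xs @ ?us)) (hd (xs @ ?us))"
    using ne u(4) k4 by (simp add: last_map)
  ultimately show False using no_cycle unfolding is_cycle_def by blast
qed

lemma Z_tail:
  assumes "w \<in> Z"
  shows "\<And>m. w m \<in> V m" "\<And>m. adj (w m) (w (m + 1))" "adj (w (j + k - 1)) (w j)"
  using ZD(1)[OF assms] ZD(2)[OF assms] ZD(2)[OF assms, of "j + k - 1"] ZD(3)[OF assms, of j] k4
  by simp_all

sublocale closed_family Z k "2 * l" n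
proof (rule closed_familyI)
  have lk: "odd (l - k + 1)" "l - k + 1 \<le> l" "Suc (l - k + 1) = l - k + 2" "even (l - k)" "l - k \<le> l" "l \<ge> 1"
    using odd_k odd_l k_less_l k4 by auto
  show "card (fwd i x) \<le> 2 * l * dplus Z i x" for i x
  \<comment> \<open>The path has odd length, so it joins a neighbour of \<open>x\<close> to the
    entry \<open>w (i + 2)\<close> of a sequence \<open>w\<close> with \<open>w i = x\<close>; it
    takes the place of the edge of \<open>w\<close> between \<open>i + 1\<close> and
    \<open>i + 2\<close>.\<close>
  proof (rule rich_fwd_bound[OF lk(2)])
    fix xs assume xs: "length xs = Suc (l - k + 1)" "distinct xs" "successively adj xs"
      "hd xs \<in> fst ` fwd i x"
      "last xs \<in> (if even (l - k + 1) then fst ` fwd i x else snd ` fwd i x)"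
      "set xs \<subseteq> V (i + 1) \<union> V (i + 2)"
    obtain w where w: "w \<in> Z" "w i = x" "w (i + 2) = last xs"
      using xs(5) lk(1) by (auto simp: fwd_def)
    show False
    proof (rule odd_closing[where j = "i + 1" and u = w])
      show "set xs \<subseteq> V (i + 1) \<union> V (i + 1 + 1)" using xs(6) by simp
      show "adj (last xs) (w (i + 1 + 2))" using Z_tail(2)[OF w(1), of "i + 2"] w(3) by simp
      show "adj (w (i + 1 + k - 1)) (hd xs)"
        using fwd_ends[OF xs(4)] ZD(3)[OF w(1), of i] w(2) by simp
    qed (use xs lk Z_tail(1,2)[OF w(1)] in simp_all)
  qed
  show "card (bwd i x) \<le> 2 * l * dminus Z (i + 1) x" for i x
  proof (rule rich_bwd_bound[OF lk(2)])
    fix xs assume xs: "length xs = Suc (l - k + 1)" "distinct xs" "successively adj xs"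
      "hd xs \<in> snd ` bwd i x"
      "last xs \<in> (if even (l - k + 1) then snd ` bwd i x else fst ` bwd i x)"
      "set xs \<subseteq> V i \<union> V (i + 1)"
    have ne: "xs \<noteq> []" using xs(1) by auto
    obtain w where w: "w \<in> Z" "w (i + 2) = x" "w i = last xs"
      using xs(5) lk(1) by (auto simp: bwd_def)
    show False
    proof (rule odd_closing[where j = i and u = w and xs = "rev xs"])
      show "successively adj (rev xs)"
        using successively_mono[OF xs(3), of "\<lambda>x y. adj y x"] adj_sym by simp
      show "adj (last (rev xs)) (w (i + 2))"
        using bwd_ends[OF xs(4)] w(2) ne adj_sym by (simp add: last_rev)
      show "adj (w (i + k - 1)) (hd (rev xs))"
        using Z_tail(3)[OF w(1), of i] w(3) ne by (simp add: hd_rev)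
    qed (use xs lk Z_tail(1,2)[OF w(1)] in simp_all)
  qed
  show "(\<Sum>x\<in>(\<lambda>w. w i) ` Z. (dplus Z i x)\<^sup>2) \<le> 3 * (2 * l) * n\<^sup>2" for i
  \<comment> \<open>Here the path has even length; only together with \<open>a\<close> does it lead
    from one class to the next, as \<open>odd_closing\<close> requires.\<close>
  proof (rule sum_dplus_bound[OF lk(4,5,6)])
    fix a xs assume xs: "length xs = Suc (l - k)" "distinct xs" "successively adj xs" "a \<notin> set xs"
      "set xs \<subseteq> V i \<union> V (i + 1)" "(hd xs, a) \<in> edges i" "(last xs, a) \<in> edges i"
    have ne: "xs \<noteq> []" using xs(1) by auto
    obtain w where w: "w \<in> Z" "w i = hd xs" "w (i + 1) = a"
      using xs(6) by (auto simp: edges_def)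
    show False
    proof (rule odd_closing[where j = i and u = w and xs = "xs @ [a]"])
      show "successively adj (xs @ [a])"
        using xs(3,7) edges_adj by (simp add: successively_append_iff)
      show "set (xs @ [a]) \<subseteq> V i \<union> V (i + 1)"
        using xs(5,7) edges_V(2)[of i] by force
      show "adj (last (xs @ [a])) (w (i + 2))"
        using Z_tail(2)[OF w(1), of "i + 1"] w(3) by simp
      show "adj (w (i + k - 1)) (hd (xs @ [a]))"
        using Z_tail(3)[OF w(1), of i] w(2) ne by simp
    qed (use xs lk Z_tail(1,2)[OF w(1)] in simp_all)
  qed
  show "(\<Sum>x\<in>(\<lambda>w. w (i + 1)) ` Z. (dminus Z i x)\<^sup>2) \<le> 3 * (2 * l) * n\<^sup>2" for i
  proof (rule sum_dminus_bound[OF lk(4,5,6)])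
    fix a xs assume xs: "length xs = Suc (l - k)" "distinct xs" "successively adj xs" "a \<notin> set xs"
      "set xs \<subseteq> V i \<union> V (i + 1)" "(a, hd xs) \<in> edges i" "(a, last xs) \<in> edges i"
    have ne: "xs \<noteq> []" using xs(1) by auto
    obtain w where w: "w \<in> Z" "w i = a" "w (i + 1) = last xs"
      using xs(7) by (auto simp: edges_def)
    show False
    proof (rule odd_closing[where j = i and u = w and xs = "a # xs"])
      show "successively adj (a # xs)"
        using xs(3,6) edges_adj by (simp add: successively_Cons)
      show "set (a # xs) \<subseteq> V i \<union> V (i + 1)"
        using xs(5,7) edges_V(1)[of i] by force
      show "adj (last (a # xs)) (w (i + 2))"
        using Z_tail(2)[OF w(1), of "i + 1"] w(3) ne by simp
      show "adj (w (i + k - 1)) (hd (a # xs))"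
        using Z_tail(3)[OF w(1), of i] w(2) by simp
    qed (use xs lk Z_tail(1,2)[OF w(1)] in simp_all)
  qed
qed

lemma second_neighbours: "card (far i x) \<le> 2 * l * n"
proof (rule card_far_le, rule notI)
  assume dense: "card (far i x) > l * (card (fst ` far i x) + card (snd ` far i x))"
  have lk: "odd (l - k + 1)" "l - k + 1 \<le> l" using odd_k odd_l k_less_l k4 by auto
  obtain xs where xs: "length xs = Suc (l - k + 1)" "distinct xs" "successively (und (far i x)) xs"
    "hd xs \<in> fst ` far i x" "last xs \<in> (if even (l - k + 1) then fst ` far i x else snd ` far i x)"
    "\<And>j. j \<le> l - k + 1 \<Longrightarrow> xs ! j \<in> (if even j then fst ` far i x else snd ` far i x)"
    by (rule bip_path[OF finite_far far_disj dense lk(2)]) (rule that)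
  obtain v where v: "v \<in> Z" "v i = x" "v (i + 2) = hd xs" using xs(4) by (auto simp: far_def)
  obtain w where w: "w \<in> Z" "w i = x" "w (i + 3) = last xs" using xs(5) lk(1) by (auto simp: far_def)
  have meet: "w (i + k) = v (i + k)" using ZD(3)[OF v(1)] ZD(3)[OF w(1)] v w by simp
  show False
  \<comment> \<open>The two ends of \<open>xs\<close> come from different sequences through
    \<open>x\<close>. The remainder of the cycle follows \<open>w\<close> from the end of
    \<open>xs\<close> round to \<open>x\<close> at \<open>i + k\<close> and changes there to
    \<open>v\<close>, which leads to the start of \<open>xs\<close>.\<close>
  proof (rule odd_closing[where j = "i + 2" and u = "\<lambda>m. if m \<le> i + k then w m else v m"])
    show "successively adj xs" by (rule successively_adj[OF xs(3)]) (rule far_adj)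
    show "set xs \<subseteq> V (i + 2) \<union> V (i + 2 + 1)"
    proof
      fix y assume "y \<in> set xs"
      then obtain j where "j < Suc (l - k + 1)" "y = xs ! j" using xs(1) by (metis in_set_conv_nth)
      then show "y \<in> V (i + 2) \<union> V (i + 2 + 1)"
        using xs(6)[of j] far_V[of i x] by (simp add: eval_nat_numeral split: if_splits) blast+
    qed
    fix m
    show "(if m \<le> i + k then w m else v m) \<in> V m" using ZD(1) v(1) w(1) by simp
    show "adj (if m \<le> i + k then w m else v m) (if m + 1 \<le> i + k then w (m + 1) else v (m + 1))"
    proof (cases "m = i + k")
      case True
      then show ?thesis using meet Z_tail(2)[OF v(1), of m] by simp
    next
      case False
      then show ?thesis using Z_tail(2)[OF v(1), of m] Z_tail(2)[OF w(1), of m] by simp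
    qed
  next
    show "adj (last xs) (if i + 2 + 2 \<le> i + k then w (i + 2 + 2) else v (i + 2 + 2))"
      using Z_tail(2)[OF w(1), of "i + 3"] w(3) k4 by (simp add: eval_nat_numeral)
    have "i + 2 + k - 1 = i + k + 1" by simp
    moreover have "adj (v (i + k + 1)) (v (i + k + 1 + 1))" by (rule Z_tail(2)[OF v(1)])
    moreover have "v (i + k + 1 + 1) = hd xs"
      using ZD(3)[OF v(1), of "i + 2"] v(3) by (simp add: ac_simps)
    ultimately show "adj (if i + 2 + k - 1 \<le> i + k then w (i + 2 + k - 1) else v (i + 2 + k - 1)) (hd xs)"
      by simp
  qed (use xs in simp_all)
qed

end

section \<open>Upper bounds\<close>

lemma mod_neq_near: "i < j \<Longrightarrow> j < i + k \<Longrightarrow> i mod k \<noteq> j mod (k :: nat)"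
proof
  assume "i < j" "j < i + k" "i mod k = j mod k"
  then have "k dvd j - i" using mod_eq_dvd_iff_nat[of i j k] by simp
  then have "k \<le> j - i" using \<open>i < j\<close> by (intro dvd_imp_le) auto
  then show False using \<open>i < j\<close> \<open>j < i + k\<close> by linarith
qed

text \<open>A random colouring makes a given k-cycle colourful with probability \<open>k ^ -k\<close>.\<close>

lemma exists_colouring:
  fixes S :: "'a list set"
  assumes "finite A" "finite S" "k > 0"
    and S: "\<And>xs. xs \<in> S \<Longrightarrow> length xs = k \<and> distinct xs \<and> set xs \<subseteq> A"
  shows "\<exists>\<chi>. card S \<le> k ^ k * card {xs \<in> S. \<forall>i<k. \<chi> (xs ! i) = i}"
proof (cases "S = {}")
  case False
  define F where "F = (\<Pi>\<^sub>E x\<in>A. {..<k})"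
  define good where "good = (\<lambda>\<chi> xs. \<forall>i<k. \<chi> (xs ! i :: 'a) = i)"
  have finF: "finite F" using assms(1) by (simp add: F_def finite_PiE)
  have cardF: "card F = k ^ card A" using assms(1) by (simp add: F_def card_PiE)
  have kA: "k \<le> card A"
  proof -
    obtain xs where "xs \<in> S" using False by blast
    then have xs: "length xs = k" "distinct xs" "set xs \<subseteq> A" using S by auto
    then show ?thesis using card_mono[OF assms(1) xs(3)] by (simp add: distinct_card)
  qed
  \<comment> \<open>Prescribing the colours of the \<open>k\<close> vertices of the cycle leaves the
    other \<open>card A - k\<close> vertices free.\<close>
  have many: "k ^ (card A - k) \<le> card {\<chi> \<in> F. good \<chi> xs}" if "xs \<in> S" for xs
  proof -
    define idx where "idx = inv_into {..<k} (\<lambda>i. xs ! i)"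
    have xs: "length xs = k" "distinct xs" "set xs \<subseteq> A" using S[OF that] by auto
    have idx: "idx (xs ! i) = i" if "i < k" for i
      unfolding idx_def using xs that by (intro inv_into_f_f) (auto simp: inj_on_def nth_eq_iff_index_eq)
    define B where "B = (\<lambda>x. if x \<in> set xs then {idx x} else {..<k})"
    have "(\<Pi>\<^sub>E x\<in>A. B x) \<subseteq> {\<chi> \<in> F. good \<chi> xs}"
    proof
      fix \<chi> assume \<chi>: "\<chi> \<in> (\<Pi>\<^sub>E x\<in>A. B x)"
      have "B x \<subseteq> {..<k}" if "x \<in> A" for x
        using idx xs(1) by (auto simp: B_def in_set_conv_nth)
      then have "\<chi> \<in> F" using \<chi> unfolding F_def by (meson PiE_mono subsetD)
      moreover have "\<chi> (xs ! i) = i" if "i < k" for i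
      proof -
        have "xs ! i \<in> set xs" using that xs(1) by simp
        then have "\<chi> (xs ! i) \<in> B (xs ! i)" using \<chi> xs(3) by blast
        then show ?thesis using \<open>xs ! i \<in> set xs\<close> idx[OF that] by (simp add: B_def)
      qed
      ultimately show "\<chi> \<in> {\<chi> \<in> F. good \<chi> xs}" by (simp add: good_def)
    qed
    then have "card (\<Pi>\<^sub>E x\<in>A. B x) \<le> card {\<chi> \<in> F. good \<chi> xs}"
      using finF by (intro card_mono) auto
    moreover have "card (\<Pi>\<^sub>E x\<in>A. B x) = (\<Prod>x\<in>A. if x \<in> set xs then 1 else k)"
      unfolding card_PiE[OF assms(1)] by (intro prod.cong) (auto simp: B_def)
    moreover have "\<dots> = k ^ card (A - set xs)"
      using assms(1) by (simp add: prod.If_cases set_diff_eq Int_def)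
    moreover have "card (A - set xs) = card A - k"
      using xs by (simp add: card_Diff_subset distinct_card)
    ultimately show ?thesis by simp
  qed
  have count: "card {x \<in> S. P x} = (\<Sum>x\<in>S. if P x then 1 else 0)" if "finite S" for S :: "'x set" and P
    using that by (simp add: sum.inter_filter[symmetric])
  show ?thesis
  proof (rule ccontr)
    assume "\<not> ?thesis"
    then have less: "k ^ k * card {xs \<in> S. good \<chi> xs} < card S" for \<chi>
      unfolding good_def using not_le by blast
    have "k ^ card A * card S = k ^ k * (\<Sum>xs\<in>S. k ^ (card A - k))"
      using kA by (simp flip: power_add)
    also have "\<dots> \<le> k ^ k * (\<Sum>xs\<in>S. card {\<chi> \<in> F. good \<chi> xs})"
      by (intro mult_le_mono2 sum_mono many)
    also have "(\<Sum>xs\<in>S. card {\<chi> \<in> F. good \<chi> xs}) = (\<Sum>\<chi>\<in>F. card {xs \<in> S. good \<chi> xs})"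
      unfolding count[OF finF] count[OF assms(2)] by (rule sum.swap)
    also have "k ^ k * \<dots> = (\<Sum>\<chi>\<in>F. k ^ k * card {xs \<in> S. good \<chi> xs})"
      by (rule sum_distrib_left)
    also have "\<dots> < (\<Sum>\<chi>\<in>F. card S)"
    proof (rule sum_strict_mono[OF finF _ less])
      show "F \<noteq> {}" using cardF assms(3) by auto
    qed
    also have "\<dots> = k ^ card A * card S" by (simp add: cardF)
    finally show False by simp
  qed
qed simp

lemma is_cycle_in_cyc_lists:
  assumes "simple_graph G" "l \<ge> 1" "is_cycle (\<lambda>x y. {x, y} \<in> snd G) l xs"
  shows "xs \<in> cyc_lists G l"
proof -
  have "xs \<in> cyc_lists (UNIV, snd G) l"
    using assms by (intro cyc_listsI) (auto simp: is_cycle_def)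
  then have xs: "length xs = l" "distinct xs" "\<And>i. i < l \<Longrightarrow> {xs ! i, xs ! (Suc i mod l)} \<in> snd G"
    by (auto simp: cyc_lists_def)
  have "xs ! i \<in> fst G" if "i < l" for i
    using xs(3)[OF that] assms(1) unfolding simple_graph_def by blast
  then have "set xs \<subseteq> fst G" using xs(1) by (auto simp: in_set_conv_nth)
  then show ?thesis using xs by (simp add: cyc_lists_def)
qed

text \<open>Only cycles carrying the colours in order are counted, for a colouring that loses no
  more than a factor \<open>k ^ k\<close>. Such a cycle, repeated periodically, is a closed sequence
  through the colour classes.\<close>

lemma cyc_lists_le_colourful:
  fixes G :: "'a ugraph"
  assumes G: "simple_graph G" and "card (fst G) = n" "cyc_lists G l = {}" "l \<ge> 1" "k \<ge> 4"
    and bound: "\<And>V :: nat \<Rightarrow> 'a set. coloured_graph (\<lambda>x y. {x, y} \<in> snd G) V k l n \<Longrightarrow>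
      card (coloured_graph.Z (\<lambda>x y. {x, y} \<in> snd G) V k) \<le> B"
  shows "card (cyc_lists G k) \<le> k ^ k * B"
proof -
  let ?adj = "\<lambda>x y. {x, y} \<in> snd G"
  have finG: "finite (fst G)" using G by (simp add: simple_graph_def)
  have "\<exists>\<chi>. card (cyc_lists G k) \<le> k ^ k * card {xs \<in> cyc_lists G k. \<forall>i<k. \<chi> (xs ! i) = i}"
    by (rule exists_colouring[OF finG finite_cyc_lists[OF G]])
      (use assms(5) in \<open>auto simp: cyc_lists_def\<close>)
  then obtain \<chi> where
    \<chi>: "card (cyc_lists G k) \<le> k ^ k * card {xs \<in> cyc_lists G k. \<forall>i<k. \<chi> (xs ! i) = i}"
    by blast
  define V where "V = (\<lambda>i. {x \<in> fst G. \<chi> x = i mod k})"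
  interpret coloured_graph ?adj V k l n
  proof
    show "?adj y x" if "?adj x y" for x y using that by (simp add: insert_commute)
    show "V i \<inter> V j = {}" if "i < j" "j < i + k" for i j
      using mod_neq_near[OF that] by (auto simp: V_def)
    show "finite (V i)" for i using finG by (simp add: V_def)
    show "card (V i) \<le> n" for i
      using card_mono[OF finG, of "V i"] assms(2) by (auto simp: V_def)
    show "\<not> is_cycle ?adj l xs" for xs
      using is_cycle_in_cyc_lists[OF G assms(4)] assms(3) by blast
  qed (fact assms(5))
  have "card {xs \<in> cyc_lists G k. \<forall>i<k. \<chi> (xs ! i) = i} \<le> card Z"
  proof (rule card_inj_on_le[OF _ _ finite_Z])
    let ?h = "\<lambda>xs i. xs ! (i mod k) :: 'a"
    have k0: "k > 0" using assms(5) by simp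
    show "inj_on ?h {xs \<in> cyc_lists G k. \<forall>i<k. \<chi> (xs ! i) = i}"
    proof (rule inj_onI)
      fix xs ys assume "xs \<in> {xs \<in> cyc_lists G k. \<forall>i<k. \<chi> (xs ! i) = i}"
        "ys \<in> {xs \<in> cyc_lists G k. \<forall>i<k. \<chi> (xs ! i) = i}" and eq: "?h xs = ?h ys"
      then have "length xs = k" "length ys = k" by (auto simp: cyc_lists_def)
      moreover have "xs ! i = ys ! i" if "i < k" for i
        using fun_cong[OF eq, of i] that by simp
      ultimately show "xs = ys" by (simp add: list_eq_iff_nth_eq)
    qed
    show "?h ` {xs \<in> cyc_lists G k. \<forall>i<k. \<chi> (xs ! i) = i} \<subseteq> Z"
    proof
      fix v assume "v \<in> ?h ` {xs \<in> cyc_lists G k. \<forall>i<k. \<chi> (xs ! i) = i}"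
      then obtain xs where xs: "length xs = k" "set xs \<subseteq> fst G"
        "\<And>i. i < k \<Longrightarrow> {xs ! i, xs ! (Suc i mod k)} \<in> snd G"
        "\<And>i. i < k \<Longrightarrow> \<chi> (xs ! i) = i" and v: "v = ?h xs"
        by (auto simp: cyc_lists_def)
      show "v \<in> Z"
        unfolding Z_def
      proof (intro CollectI allI conjI)
        fix i
        have "i mod k < k" using k0 by simp
        then show "v i \<in> V i" using xs(1,2,4) by (auto simp: v V_def)
        show "{v i, v (Suc i)} \<in> snd G"
          using xs(3)[OF \<open>i mod k < k\<close>] by (simp add: v mod_Suc_eq)
        show "v (i + k) = v i" by (simp add: v)
      qed
    qed
  qed
  also have "\<dots> \<le> B" by (rule bound) unfold_locales
  finally show ?thesis using \<chi> by (meson mult_le_mono2 order_trans)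
qed

lemma cyc_lists_le:
  assumes G: "simple_graph G" "card (fst G) = n" "cyc_lists G l = {}"
    and kl: "(even l \<and> l \<ge> 6 \<and> k \<ge> 4) \<or> (odd l \<and> odd k \<and> k \<ge> 5 \<and> k < l)"
  shows "card (cyc_lists G k) \<le>
    (k ^ k * 12 * 4 ^ (k div 2)) * l ^ ((k + 1) div 2) * n ^ (k div 2)"
proof -
  let ?r = "k div 2"
  \<comment> \<open>The constant comes from odd \<open>k\<close>: with \<open>L = 2 * l\<close>,
    \<open>6 * 2 ^ ?r * L ^ (?r + 1)\<close> equals \<open>12 * 4 ^ ?r * l ^ (?r + 1)\<close>. The
    bound for even \<open>k\<close> is smaller.\<close>
  let ?B = "12 * 4 ^ ?r * l ^ ((k + 1) div 2) * n ^ ?r"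
  let ?adj = "\<lambda>x y. {x, y} \<in> snd G"
  have pow4: "(2::nat) ^ ?r * 2 ^ ?r = 4 ^ ?r"
    using power_mult_distrib[of "2::nat" 2 ?r] by simp
  have odd_bound: "6 * 2 ^ ?r * (2 * l) ^ (?r + 1) * n ^ ?r = ?B" if "odd k"
  proof -
    have "(k + 1) div 2 = ?r + 1" using that by presburger
    then show ?thesis
      by (simp add: power_mult_distrib flip: pow4)
  qed
  have even_bound: "5 * 2 ^ ?r * (2 * l) ^ ?r * n ^ ?r \<le> ?B" if "even k"
  proof -
    have "(k + 1) div 2 = ?r" using that by presburger
    then show ?thesis
      by (simp add: power_mult_distrib flip: pow4)
  qed
  have "card (cyc_lists G k) \<le> k ^ k * ?B"
  proof (rule cyc_lists_le_colourful[OF G])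
    fix V assume "coloured_graph ?adj V k l n"
    then interpret coloured_graph ?adj V k l n .
    show "card Z \<le> ?B"
    proof (cases "even l")
      case True
      then interpret coloured_even ?adj V k l n using kl by unfold_locales auto
      show ?thesis
      proof (cases "even k")
        case True
        then show ?thesis using card_even_family even_bound kl \<open>even l\<close> by (meson order_trans)
      next
        case False
        then have "k \<ge> 5" using kl by (cases "k = 4") auto
        have "card Z \<le> 6 * 2 ^ ?r * (2 * l) ^ (?r + 1) * n ^ ?r"
          using False \<open>k \<ge> 5\<close> second_neighbours unfolding far_def by (intro card_odd_family)
        then show ?thesis unfolding odd_bound[OF False] .
      qed
    next
      case False
      then interpret coloured_odd ?adj V k l n using kl by unfold_locales auto
      have "card Z \<le> 6 * 2 ^ ?r * (2 * l) ^ (?r + 1) * n ^ ?r"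
        using False kl second_neighbours unfolding far_def by (intro card_odd_family) auto
      then show ?thesis using odd_bound False kl by metis
    qed
  qed (use kl in auto)
  then show ?thesis by (simp add: mult.assoc)
qed

section \<open>Lower bounds from blow-ups\<close>

text \<open>One vertex from each class gives a cycle, and as the classes are disjoint, the vertex
  set of the copy already reveals the choice.\<close>

lemma copies_ge_prod:
  fixes W :: "nat \<Rightarrow> 'a set"
  assumes G: "simple_graph G" and "k \<ge> 3"
    and W: "\<And>i. i < k \<Longrightarrow> W i \<subseteq> fst G"
    and disj: "\<And>i j. i < k \<Longrightarrow> j < k \<Longrightarrow> i \<noteq> j \<Longrightarrow> W i \<inter> W j = {}"
    and complete: "\<And>i x y. i < k \<Longrightarrow> x \<in> W i \<Longrightarrow> y \<in> W (Suc i mod k) \<Longrightarrow> {x, y} \<in> snd G"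
  shows "(\<Prod>i<k. card (W i)) \<le> card (copies (cycle_graph k) G)"
proof -
  have "(\<Prod>i<k. card (W i)) = card (\<Pi>\<^sub>E i\<in>{..<k}. W i)"
    by (simp add: card_PiE)
  also have "\<dots> \<le> card (copies (cycle_graph k) G)"
  proof (rule card_inj_on_le)
    let ?h = "\<lambda>\<phi>. list_cycle (map \<phi> [0..<k]) :: 'a ugraph"
    have verts: "fst (?h \<phi>) = \<phi> ` {..<k}" for \<phi>
      by (auto simp: list_cycle_def)
    have mem: "\<phi> i \<in> W i" if "\<phi> \<in> (\<Pi>\<^sub>E i\<in>{..<k}. W i)" "i < k" for \<phi> i
      using that by auto
    show "inj_on ?h (\<Pi>\<^sub>E i\<in>{..<k}. W i)"
    proof (rule inj_onI)
      fix \<phi> \<psi> assume \<phi>: "\<phi> \<in> (\<Pi>\<^sub>E i\<in>{..<k}. W i)" and \<psi>: "\<psi> \<in> (\<Pi>\<^sub>E i\<in>{..<k}. W i)"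
        and eq: "?h \<phi> = ?h \<psi>"
      show "\<phi> = \<psi>"
      proof (rule PiE_ext[OF \<phi> \<psi>])
        fix i assume "i \<in> {..<k}"
        then have i: "i < k" by simp
        have "\<phi> i \<in> \<psi> ` {..<k}" using eq i verts by (metis imageI lessThan_iff)
        then obtain j where j: "j < k" "\<phi> i = \<psi> j" by blast
        then have "\<phi> i \<in> W j" using mem[OF \<psi>] by simp
        then have "i = j" using disj[OF i j(1)] mem[OF \<phi> i] by blast
        then show "\<phi> i = \<psi> i" using j by simp
      qed
    qed
    show "?h ` (\<Pi>\<^sub>E i\<in>{..<k}. W i) \<subseteq> copies (cycle_graph k) G"
      unfolding copies_cycle_graph[OF assms(2)]
    proof (rule image_subsetI, rule imageI)
      fix \<phi> assume \<phi>: "\<phi> \<in> (\<Pi>\<^sub>E i\<in>{..<k}. W i)"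
      note mem = mem[OF \<phi>]
      have "inj_on \<phi> {..<k}"
      proof (rule inj_onI)
        fix i j assume "i \<in> {..<k}" "j \<in> {..<k}" "\<phi> i = \<phi> j"
        then show "i = j" using disj[of i j] mem[of i] mem[of j] by auto
      qed
      moreover have "Suc i mod k < k" for i using assms(2) by simp
      ultimately show "map \<phi> [0..<k] \<in> cyc_lists G k"
        using mem W complete by (force simp: cyc_lists_def distinct_map atLeast0LessThan)
    qed
    show "finite (copies (cycle_graph k) G)"
      using G assms(2) by (rule finite_copies_cycle_graph)
  qed
  finally show ?thesis .
qed

lemma prod_alternating:
  "(\<Prod>i<k. if even i then a else b) = (a :: nat) ^ ((k + 1) div 2) * b ^ (k div 2)"
proof (induction k)
  case (Suc k)
  then show ?case by (cases "even k") (auto elim!: evenE oddE)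
qed simp

text \<open>Every cycle has at most twice as many vertices as it has vertices from a vertex cover.\<close>

lemma gen_turan_ge_vertex_cover:
  assumes "k \<ge> 3" "l \<ge> 3" "2 * s < l" "s \<le> n"
  shows "(s div ((k + 1) div 2)) ^ ((k + 1) div 2) * ((n - s) div (k div 2)) ^ (k div 2)
    \<le> gen_turan n (cycle_graph k) (cycle_graph l)"
proof -
  let ?c = "(k + 1) div 2" and ?r = "k div 2"
  define p where "p = s div ?c"
  define q where "q = (n - s) div ?r"
  define G :: "nat ugraph" where
    "G = ({..<n}, {{x, y} |x y. x < n \<and> y < n \<and> x \<noteq> y \<and> (x < s \<or> y < s)})"
  have edge: "{x, y} \<in> snd G \<longleftrightarrow> x < n \<and> y < n \<and> x \<noteq> y \<and> (x < s \<or> y < s)" for x y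
    by (auto simp: G_def doubleton_eq_iff)
  have G: "simple_graph G" by (auto simp: simple_graph_def G_def)
  have free: "cyc_lists G l = {}"
  proof (rule ccontr)
    assume "cyc_lists G l \<noteq> {}"
    then obtain xs where xs: "length xs = l" "distinct xs"
      "\<And>i. i < l \<Longrightarrow> {xs ! i, xs ! (Suc i mod l)} \<in> snd G"
      by (auto simp: cyc_lists_def)
    \<comment> \<open>Of two consecutive vertices one lies in the cover, so the positions in the
      cover and their predecessors exhaust all \<open>l\<close> positions, and \<open>l\<close> is
      at most \<open>2 * s\<close>.\<close>
    define A where "A = {i. i < l \<and> xs ! i < s}"
    have finA: "finite A" by (simp add: A_def)
    have "card A \<le> card {..<s}"
      by (rule card_inj_on_le[of "\<lambda>i. xs ! i"])
        (use xs in \<open>auto simp: A_def inj_on_def nth_eq_iff_index_eq\<close>)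
    then have A: "card A \<le> s" by simp
    let ?B = "{i. i < l \<and> Suc i mod l \<in> A}"
    have "card ?B \<le> card A"
    proof (rule card_inj_on_le[of "\<lambda>i. Suc i mod l"])
      show "inj_on (\<lambda>i. Suc i mod l) ?B"
      proof (rule inj_onI)
        fix i j assume "i \<in> ?B" "j \<in> ?B" "Suc i mod l = Suc j mod l"
        then show "i = j" by (cases "Suc i = l"; cases "Suc j = l") auto
      qed
    qed (use finA in auto)
    moreover have "{..<l} \<subseteq> A \<union> ?B"
    proof
      fix i assume "i \<in> {..<l}"
      then show "i \<in> A \<union> ?B" using xs(3)[of i] assms(2) unfolding edge A_def by auto
    qed
    then have "card {..<l} \<le> card (A \<union> ?B)"
      using finA by (intro card_mono) auto
    then have "l \<le> card A + card ?B" using card_Un_le[of A ?B] by simp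
    ultimately show False using A assms(3) by linarith
  qed
  \<comment> \<open>Even positions receive blocks of the cover, odd ones blocks of the rest. For odd
    \<open>k\<close> the positions \<open>k - 1\<close> and 0 are consecutive and both even; there
    the edges inside the cover are used.\<close>
  define W where "W = (\<lambda>i. if even i then {i div 2 * p..<Suc (i div 2) * p}
    else {s + i div 2 * q..<s + Suc (i div 2) * q})"
  have Wodd: "W i \<subseteq> {s..<n}" if "i < k" "odd i" for i
  proof -
    have "Suc (i div 2) \<le> ?r" using that by presburger
    then have "Suc (i div 2) * q \<le> ?r * q" by (rule mult_le_mono1)
    also have "\<dots> \<le> n - s" by (simp add: q_def)
    finally show ?thesis using that assms(4) by (auto simp: W_def)
  qed
  have Weven: "W i \<subseteq> {..<s}" if "i < k" "even i" for i
  proof -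
    have "Suc (i div 2) \<le> ?c" using that by presburger
    then have "Suc (i div 2) * p \<le> ?c * p" by (rule mult_le_mono1)
    also have "\<dots> \<le> s" by (simp add: p_def)
    finally show ?thesis using that by (auto simp: W_def)
  qed
  have block: "{a * m..<Suc a * m} \<inter> {b * m..<Suc b * m} = {}" if "a < b" for a b m :: nat
  proof -
    have "Suc a * m \<le> b * m" using that by (intro mult_le_mono1) simp
    then show ?thesis by auto
  qed
  have block': "{s + a * m..<s + Suc a * m} \<inter> {s + b * m..<s + Suc b * m} = {}" if "a < b" for a b m :: nat
  proof -
    have "Suc a * m \<le> b * m" using that by (intro mult_le_mono1) simp
    then show ?thesis by auto
  qed
  have disj: "W i \<inter> W j = {}" if "i < k" "j < k" "i \<noteq> j" for i j
  proof (cases "even i \<longleftrightarrow> even j")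
    case True
    then have "i div 2 \<noteq> j div 2" using that(3) by presburger
    then consider "i div 2 < j div 2" | "j div 2 < i div 2" by linarith
    then show ?thesis
    proof cases
      case 1
      show ?thesis using True block[OF 1, of p] block'[OF 1, of q] unfolding W_def by (cases "even i") simp_all
    next
      case 2
      show ?thesis using True block[OF 2, of p] block'[OF 2, of q] unfolding W_def
        by (cases "even i") (simp_all add: Int_commute)
    qed
  next
    case False
    then show ?thesis using Wodd[OF that(1)] Wodd[OF that(2)] Weven[OF that(1)] Weven[OF that(2)]
      by (cases "even i") fastforce+
  qed
  have sub: "W i \<subseteq> fst G" if "i < k" for i
    using Wodd[OF that] Weven[OF that] assms(4) by (cases "even i") (force simp: G_def)+
  have "(\<Prod>i<k. card (W i)) \<le> card (copies (cycle_graph k) G)"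
  proof (rule copies_ge_prod[OF G assms(1) sub disj])
    fix i x y assume i: "i < k" and x: "x \<in> W i" and y: "y \<in> W (Suc i mod k)"
    have j: "Suc i mod k < k" "i \<noteq> Suc i mod k"
      using assms(1) i by (auto simp: mod_Suc)
    have "even i \<or> even (Suc i mod k)" using i by (auto simp: mod_Suc)
    then have "x < s \<or> y < s" using Weven i j x y by blast
    moreover have "x \<noteq> y" using disj[OF i j] x y by blast
    ultimately show "{x, y} \<in> snd G"
      using sub[OF i] sub[OF j(1)] x y unfolding edge by (auto simp: G_def)
  qed
  moreover have "(\<Prod>i<k. card (W i)) = (\<Prod>i<k. if even i then p else q)"
    by (intro prod.cong) (auto simp: W_def)
  ultimately have "p ^ ?c * q ^ ?r \<le> card (copies (cycle_graph k) G)"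
    by (simp add: prod_alternating)
  also have "\<dots> \<le> gen_turan n (cycle_graph k) (cycle_graph l)"
    using assms(1,2) G free by (intro gen_turan_cycle_ge) (simp_all add: G_def)
  finally show ?thesis unfolding p_def q_def .
qed

text \<open>Without backtracking the walk keeps its direction around the cycle, so its length is a
  multiple of \<open>k\<close>.\<close>

lemma closed_walk_on_cycle:
  fixes P :: "nat \<Rightarrow> nat"
  assumes "l \<ge> 3" "k \<ge> 3" and range: "\<And>i. P i < k" and per: "P l = P 0"
    and step: "\<And>i. P (Suc i) = Suc (P i) mod k \<or> P i = Suc (P (Suc i)) mod k"
    and nb: "\<And>i. P (Suc (Suc i)) \<noteq> P i"
    and "l \<le> k"
  shows "l = k"
proof -
  have inj: "a = b" if "a < k" "b < k" "Suc a mod k = Suc b mod k" for a b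
    using that by (cases "Suc a = k"; cases "Suc b = k") auto
  have "k dvd l"
  proof (cases "P (Suc 0) = Suc (P 0) mod k")
    case True
    have "P (Suc i) = Suc (P i) mod k" for i
    proof (induction i)
      case (Suc i)
      then show ?case using step[of "Suc i"] nb[of i] inj[OF range range] by metis
    qed (fact True)
    then have "P i = (P 0 + i) mod k" for i
      by (induction i) (use range in \<open>simp_all add: mod_Suc_eq\<close>)
    then have "(P 0 + l) mod k = P 0 mod k" using per range[of 0] by (metis mod_less)
    then show ?thesis by (metis add_diff_cancel_left' le_add1 mod_eq_dvd_iff_nat)
  next
    case False
    have down: "P i = Suc (P (Suc i)) mod k" for i
    proof (induction i)
      case 0
      then show ?case using step[of 0] False by blast
    next
      case (Suc i)
      then show ?case using step[of "Suc i"] nb[of i] by metis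
    qed
    have "P 0 = (P i + i) mod k" for i
    proof (induction i)
      case 0
      then show ?case using range by simp
    next
      case (Suc i)
      have "P 0 = (P i + i) mod k" by (fact Suc)
      also have "\<dots> = (Suc (P (Suc i)) mod k + i) mod k" by (subst down[of i]) (rule refl)
      finally show ?case by (simp add: mod_simps)
    qed
    then have "(P 0 + l) mod k = P 0 mod k" using per range[of 0] by (metis mod_less)
    then show ?thesis by (metis add_diff_cancel_left' le_add1 mod_eq_dvd_iff_nat)
  qed
  then show ?thesis using assms(1,7) by (simp add: dvd_imp_le le_antisym)
qed

text \<open>
  Every odd position of the k-cycle is blown up to q vertices. Two vertices at the same position
  have the same two neighbours, so a cycle through both has length 4; a cycle that visits every
  position at most once has length k.
\<close>

lemma gen_turan_ge_blowup:
  assumes "k \<ge> 4" "l \<ge> 5" "l \<noteq> k" "n \<ge> k * q + k"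
  shows "q ^ (k div 2) \<le> gen_turan n (cycle_graph k) (cycle_graph l)"
proof (cases "q = 0")
  case True
  then show ?thesis using assms(1) by (simp add: zero_power)
next
  case q0: False
  \<comment> \<open>Position 0 is not blown up, so no two blown-up positions are consecutive, even
    if \<open>k\<close> is odd.\<close>
  define w where "w = (\<lambda>i::nat. if odd i then q else 1)"
  define U where "U = (SIGMA i:{..<k}. {..<w i})"
  define R where "R = (\<lambda>x y :: nat \<times> nat. x \<in> U \<and> y \<in> U \<and> fst y = Suc (fst x) mod k)"
  define G :: "(nat \<times> nat) ugraph" where "G = (U, {{x, y} |x y. R x y})"
  have edge: "{x, y} \<in> snd G \<longleftrightarrow> R x y \<or> R y x" for x y
    unfolding G_def snd_conv mem_Collect_eq doubleton_eq_iff by blast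
  have Suc_ne: "Suc i mod k \<noteq> i" if "i < k" for i
    using that assms(1) by (cases "Suc i = k") auto
  have finU: "finite U" by (simp add: U_def)
  have G: "simple_graph G"
    using finU Suc_ne[symmetric] by (auto simp: simple_graph_def G_def R_def U_def card_insert_if)
  have "card U = (\<Sum>i<k. w i)" by (simp add: U_def)
  also have "\<dots> \<le> (\<Sum>i<k. q + 1)" by (intro sum_mono) (simp add: w_def)
  finally have cardU: "card U \<le> n" using assms(4) by simp
  have free: "cyc_lists G l = {}"
  proof (rule ccontr)
    assume "cyc_lists G l \<noteq> {}"
    then obtain xs where xs: "length xs = l" "distinct xs" "set xs \<subseteq> U"
      "\<And>i. i < l \<Longrightarrow> {xs ! i, xs ! (Suc i mod l)} \<in> snd G"
      by (auto simp: cyc_lists_def G_def)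
    define v where "v = (\<lambda>i. xs ! (i mod l))"
    have l0: "i mod l < l" for i using assms(2) by simp
    have vU: "v i \<in> U" for i using xs(1,3) l0 by (auto simp: v_def)
    have v_eq: "v i = v j \<longleftrightarrow> i mod l = j mod l" for i j
      using xs(1,2) l0 by (simp add: v_def nth_eq_iff_index_eq)
    have v_step: "R (v i) (v (Suc i)) \<or> R (v (Suc i)) (v i)" for i
      using xs(4)[OF l0[of i]] unfolding edge by (simp add: v_def mod_Suc_eq)
    have inj: "fst (v a) \<noteq> fst (v b)" if ab: "a < b" "b < a + l" for a b
    proof
      assume eq: "fst (v a) = fst (v b)"
      have ne: "v a \<noteq> v b" using mod_neq_near[OF ab] v_eq by blast
      let ?p = "fst (v a)"
      have pk: "?p < k" using vU[of a] by (auto simp: U_def)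
      have "odd ?p"
      proof (rule ccontr)
        assume "\<not> odd ?p"
        then have "snd (v a) = 0" "snd (v b) = 0"
          using vU[of a] vU[of b] eq by (auto simp: U_def w_def)
        then show False using ne eq by (simp add: prod_eq_iff)
      qed
      \<comment> \<open>As \<open>?p\<close> is odd, both neighbouring positions are even and hold a
        single vertex each.\<close>
      define u1 u2 where "u1 = (?p - 1, 0::nat)" and "u2 = (Suc ?p mod k, 0::nat)"
      have nb: "y = u1 \<or> y = u2" if "R (v c) y \<or> R y (v c)" "fst (v c) = ?p" for c y
      proof -
        have yU: "y \<in> U" using that(1) by (auto simp: R_def)
        have A: "fst y = Suc ?p mod k \<or> ?p = Suc (fst y) mod k"
          using that unfolding R_def by metis
        have B: "fst y = ?p - 1" if "?p = Suc (fst y) mod k"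
          using that \<open>odd ?p\<close> yU by (cases "Suc (fst y) = k") (auto simp: U_def)
        have C: "even (Suc ?p mod k)" "even (?p - 1)"
          using \<open>odd ?p\<close> pk by (auto simp: mod_Suc)
        have D: "fst y = Suc ?p mod k \<or> fst y = ?p - 1" using A B by blast
        then have "even (fst y)" using C by metis
        then have "snd y = 0" using yU by (auto simp: U_def w_def)
        with D show ?thesis
          unfolding u1_def u2_def prod_eq_iff fst_conv snd_conv by blast
      qed
      have nbrs: "v (Suc c) = u1 \<or> v (Suc c) = u2" "v (c + l - 1) = u1 \<or> v (c + l - 1) = u2"
        "v (Suc c) \<noteq> v (c + l - 1)" if "fst (v c) = ?p" for c
      proof -
        show "v (Suc c) = u1 \<or> v (Suc c) = u2" using nb[OF v_step that] .
        have "Suc (c + l - 1) = c + l" using assms(2) by simp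
        moreover have "v (c + l) = v c" by (simp add: v_def)
        ultimately show "v (c + l - 1) = u1 \<or> v (c + l - 1) = u2"
          using v_step[of "c + l - 1"] nb[of c "v (c + l - 1)"] that by (metis (no_types))
        show "v (Suc c) \<noteq> v (c + l - 1)"
          using mod_neq_near[of "Suc c" "c + l - 1" l] assms(2) v_eq by auto
      qed
      \<comment> \<open>Index \<open>b + l - 1\<close> is the predecessor of \<open>b\<close> modulo
        \<open>l\<close>. Both vertices have the neighbours \<open>u1\<close> and \<open>u2\<close>
        only, so the successor of each is the predecessor of the other; then \<open>a + 4\<close> is
        congruent to \<open>a\<close>, which is impossible for \<open>l \<ge> 5\<close>.\<close>
      have "v (Suc a) \<noteq> v (Suc b)" using mod_neq_near[of "Suc a" "Suc b" l] ab v_eq by auto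
      then have 1: "v (Suc a) = v (b + l - 1)" and 2: "v (Suc b) = v (a + l - 1)"
        using nbrs[of a] nbrs[of b] eq by metis+
      have "Suc (Suc a) mod l = Suc (b + l - 1) mod l" "Suc (Suc b) mod l = Suc (a + l - 1) mod l"
        using 1 2 unfolding v_eq by (metis mod_Suc_eq)+
      then have "Suc (Suc a) mod l = b mod l" "Suc (Suc b) mod l = a mod l"
        using assms(2) by simp_all
      then have m: "(a + 2) mod l = b mod l" "(b + 2) mod l = a mod l" by simp_all
      have "(a + 4) mod l = (a + 2 + 2) mod l" by (rule arg_cong[where f = "\<lambda>x. x mod l"]) simp
      also have "\<dots> = ((a + 2) mod l + 2) mod l" by (rule mod_add_left_eq[symmetric])
      also have "\<dots> = (b + 2) mod l" unfolding m(1) by (rule mod_add_left_eq)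
      also note m(2)
      finally have "(a + 4) mod l = a mod l" .
      then show False using mod_neq_near[of a "a + 4" l] assms(2) by simp
    qed
    define P where "P = (\<lambda>i. fst (v i))"
    have Pk: "P i < k" for i using vU[of i] by (auto simp: P_def U_def)
    have "inj_on P {..<l}"
    proof (rule inj_onI)
      fix i j assume "i \<in> {..<l}" "j \<in> {..<l}" "P i = P j"
      then show "i = j" using inj[of i j] inj[of j i] unfolding P_def
        by (cases i j rule: linorder_cases) auto
    qed
    then have "card {..<l} \<le> card {..<k}"
      using Pk by (intro card_inj_on_le) auto
    then have "l \<le> k" by simp
    have "l = k"
    proof (rule closed_walk_on_cycle[of l k P])
      show "P l = P 0" by (simp add: P_def v_def)
      show "P (Suc i) = Suc (P i) mod k \<or> P i = Suc (P (Suc i)) mod k" for i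
        using v_step[of i] by (auto simp: P_def R_def)
      show "P (Suc (Suc i)) \<noteq> P i" for i
        using inj[of i "Suc (Suc i)"] assms(2) unfolding P_def by fastforce
    qed (use assms Pk \<open>l \<le> k\<close> in auto)
    then show False using assms(3) by simp
  qed
  define W where "W = (\<lambda>i. {i} \<times> {..<w i})"
  have "(\<Prod>i<k. card (W i)) \<le> card (copies (cycle_graph k) G)"
  proof (rule copies_ge_prod[OF G])
    show "W i \<subseteq> fst G" if "i < k" for i using that by (auto simp: W_def G_def U_def)
    show "W i \<inter> W j = {}" if "i \<noteq> j" for i j using that by (auto simp: W_def)
    show "{x, y} \<in> snd G" if "i < k" "x \<in> W i" "y \<in> W (Suc i mod k)" for i x y
      using that assms(1) unfolding edge R_def by (auto simp: W_def U_def)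
  qed (use assms in auto)
  moreover have "(\<Prod>i<k. card (W i)) = (\<Prod>i<k. if even i then 1 else q)"
    by (intro prod.cong) (auto simp: W_def w_def)
  ultimately have "q ^ (k div 2) \<le> card (copies (cycle_graph k) G)"
    by (simp add: prod_alternating)
  also have "\<dots> \<le> gen_turan n (cycle_graph k) (cycle_graph l)"
    using assms(1,2) G free cardU by (intro gen_turan_cycle_ge) (simp_all add: G_def)
  finally show ?thesis .
qed

section \<open>Finite fields of characteristic two\<close>

text \<open>Over an algebraically closed field the roots with multiplicity number
  \<open>degree p\<close>, and a multiple root would also be a root of the derivative.\<close>

lemma card_roots_simple:
  fixes p :: "'a :: alg_closed_field poly"
  assumes "p \<noteq> 0" and simple: "\<And>a. poly p a = 0 \<Longrightarrow> poly (pderiv p) a \<noteq> 0"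
  shows "card {x. poly p x = 0} = degree p"
proof -
  obtain A where A: "size A = degree p" "p = smult (lead_coeff p) (\<Prod>x\<in>#A. [:-x, 1:])"
    using alg_closed_imp_factorization[OF assms(1)] by blast
  have "proots p = proots (\<Prod>x\<in>#A. [:-x, 1:])"
    using assms(1) by (subst A(2)) simp
  also have "\<dots> = A"
  proof (induction A)
    case (add x A)
    have "(\<Prod>x\<in>#A. [:-x, 1:]) \<noteq> 0" by (auto simp: prod_mset_zero_iff)
    then show ?case using add proots_mult[of "[:-x, 1:]" "\<Prod>x\<in>#A. [:-x, 1:]"]
      by (simp del: mult_pCons_left)
  qed simp
  finally have size: "size (proots p) = degree p" using A(1) by simp
  have le1: "order a p \<le> 1" for a
  proof (rule ccontr)
    assume "\<not> order a p \<le> 1"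
    then have "[:-a, 1:] ^ 2 dvd p" by (simp add: order_divides)
    then obtain r where "p = [:-a, 1:] ^ 2 * r" by (elim dvdE)
    then have r: "p = [:-a, 1:] * ([:-a, 1:] * r)" by (simp only: power2_eq_square mult.assoc)
    have "poly p a = 0" "poly (pderiv p) a = 0"
      unfolding r pderiv_mult poly_add poly_mult by simp_all
    then show False using simple by blast
  qed
  then have "proots p = mset_set (set_mset (proots p))"
  proof (intro multiset_eqI)
    fix x
    have "count (proots p) x \<le> 1" using le1[of x] assms(1) by simp
    then have "count (proots p) x = (if x \<in># proots p then 1 else 0)"
      using count_greater_zero_iff[of "proots p" x] not_in_iff[of x "proots p"] by (metis One_nat_def Suc_leI le_antisym)
    also have "\<dots> = count (mset_set (set_mset (proots p))) x"
      by (simp add: count_mset_set' del: set_count_proots)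
    finally show "count (proots p) x = count (mset_set (set_mset (proots p))) x" .
  qed
  then have "size (proots p) = card (set_mset (proots p))"
    by (metis size_mset_set)
  then show ?thesis using size assms(1) by simp
qed

text \<open>Inside an algebraic closure of the field with two elements and for
  \<open>m \<ge> 1\<close>, this is the field with \<open>2 ^ m\<close> elements, obtained without
  constructing an extension.\<close>

definition frobenius_fixed :: "nat \<Rightarrow> 'a :: monoid_mult set" where
  "frobenius_fixed m = {x. x ^ (2 ^ m) = x}"

text \<open>In characteristic two the derivative of \<open>x ^ (2 ^ m) - x\<close> is the constant
  -1, so all roots are simple.\<close>

lemma card_frobenius_fixed:
  assumes "(1 :: 'a :: alg_closed_field) + 1 = 0" "m \<ge> 1"
  shows "card (frobenius_fixed m :: 'a set) = 2 ^ m"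
proof -
  define p :: "'a poly" where "p = monom 1 (2 ^ m) - monom 1 1"
  have q: "(2::nat) ^ m > 1" using assms(2) by (intro one_less_power) auto
  have "degree (monom (1 :: 'a) 1) < degree (monom (1 :: 'a) (2 ^ m))"
    using q by (simp add: degree_monom_eq)
  then have deg: "degree p = 2 ^ m"
    unfolding p_def diff_conv_add_uminus by (subst degree_add_eq_left) (simp_all add: degree_monom_eq)
  have two: "(2 :: 'a) = 0" using assms(1) by simp
  have "(of_nat (2 ^ m) :: 'a) = 0"
    using assms(2) by (simp add: two)
  then have "pderiv p = - 1"
    using assms(2) by (simp add: p_def pderiv_diff pderiv_monom monom_0 one_pCons zero_power)
  then have "card {x. poly p x = 0} = degree p"
    using deg by (intro card_roots_simple) auto
  moreover have "{x. poly p x = 0} = frobenius_fixed m"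
    by (auto simp: p_def frobenius_fixed_def poly_monom)
  ultimately show ?thesis using deg by simp
qed

text \<open>Squaring is additive in characteristic two, hence so is its \<open>m\<close>-th iterate;
  for products and quotients nothing special is needed.\<close>

lemma frobenius_fixed_closed:
  fixes x y :: "'a :: field"
  assumes "(1 :: 'a) + 1 = 0" "x \<in> frobenius_fixed m" "y \<in> frobenius_fixed m"
  shows "x + y \<in> frobenius_fixed m" "x * y \<in> frobenius_fixed m" "x / y \<in> frobenius_fixed m"
proof -
  have two: "(2 :: 'a) = 0" using assms(1) by simp
  have sq: "w ^ (2 ^ Suc i) = (w ^ 2 ^ i)\<^sup>2" for w :: 'a and i
    by (simp only: power_Suc2 power_mult)
  have "(u + v) ^ (2 ^ m) = u ^ (2 ^ m) + v ^ (2 ^ m)" for u v :: 'a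
  proof (induction m)
    case (Suc m)
    have "(u + v) ^ (2 ^ Suc m) = ((u + v) ^ 2 ^ m)\<^sup>2" by (rule sq)
    also have "\<dots> = (u ^ 2 ^ m)\<^sup>2 + (v ^ 2 ^ m)\<^sup>2" unfolding Suc by (simp add: power2_sum two)
    also have "\<dots> = u ^ (2 ^ Suc m) + v ^ (2 ^ Suc m)" unfolding sq ..
    finally show ?case .
  qed simp
  then show "x + y \<in> frobenius_fixed m" "x * y \<in> frobenius_fixed m" "x / y \<in> frobenius_fixed m"
    using assms(2,3) by (simp_all add: frobenius_fixed_def power_mult_distrib power_divide)
qed

lemma alg_closure_bit_char: "(1 :: bit alg_closure) + 1 = 0"
proof -
  have "(1 :: bit) + 1 = 0" by simp
  then have "to_ac ((1 :: bit) + 1) = 0" by (simp only: to_ac_0)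
  then show ?thesis by (simp only: to_ac_add to_ac_1)
qed

section \<open>A dense graph without four-cycles\<close>

lemma card_Sigma_ge:
  assumes "finite A" "\<And>a. a \<in> A \<Longrightarrow> finite (B a)" "\<And>a. a \<in> A \<Longrightarrow> m \<le> card (B a)"
  shows "card A * m \<le> card (Sigma A B)"
proof -
  have "card A * m = (\<Sum>a\<in>A. m)" by simp
  also have "\<dots> \<le> (\<Sum>a\<in>A. card (B a))" by (intro sum_mono assms(3))
  also have "\<dots> = card (Sigma A B)" using assms(1,2) by (intro card_SigmaI[symmetric]) auto
  finally show ?thesis .
qed

section \<open>Walks in the polarity graph\<close>

fun walk_sum :: "'a :: field list \<Rightarrow> 'a" where
  "walk_sum (x # y # zs) = x * y + walk_sum (y # zs)"
| "walk_sum _ = 0"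

text \<open>In characteristic two the edge condition gives the next second coordinate as
  \<open>b + x * y\<close>, so the first coordinates and one starting value determine the
  walk.\<close>

fun lift_walk :: "'a :: field list \<Rightarrow> 'a \<Rightarrow> ('a \<times> 'a) list" where
  "lift_walk (x # y # zs) b = (x, b) # lift_walk (y # zs) (b + x * y)"
| "lift_walk [x] b = [(x, b)]"
| "lift_walk [] b = []"

lemma map_fst_lift_walk [simp]: "map fst (lift_walk xs b) = xs"
  by (induction xs b rule: lift_walk.induct) auto

lemma length_lift_walk [simp]: "length (lift_walk xs b) = length xs"
  by (induction xs b rule: lift_walk.induct) auto

lemma hd_lift_walk: "xs \<noteq> [] \<Longrightarrow> hd (lift_walk xs b) = (hd xs, b)"
  by (cases "(xs, b)" rule: lift_walk.cases) auto

lemma lift_walk_eq_Nil [simp]: "lift_walk xs b = [] \<longleftrightarrow> xs = []"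
  by (cases "(xs, b)" rule: lift_walk.cases) auto

lemma last_lift_walk: "xs \<noteq> [] \<Longrightarrow> last (lift_walk xs b) = (last xs, b + walk_sum xs)"
  by (induction xs b rule: lift_walk.induct) (auto simp: add.assoc)

locale char_two_subfield =
  fixes F :: "'a :: field set"
  assumes finF: "finite F" and two: "(1 :: 'a) + 1 = 0"
    and add: "x \<in> F \<Longrightarrow> y \<in> F \<Longrightarrow> x + y \<in> F"
    and mult: "x \<in> F \<Longrightarrow> y \<in> F \<Longrightarrow> x * y \<in> F"
    and divide: "x \<in> F \<Longrightarrow> y \<in> F \<Longrightarrow> x / y \<in> F"
    and zero: "0 \<in> F"
begin

lemma self_add: "x + x = (0 :: 'a)"
  using two by (metis distrib_right mult_1 mult_zero_left)

lemma minus_eq: "- x = (x :: 'a)"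
  using self_add by (metis minus_unique)

lemma add_eq_0: "x + y = 0 \<longleftrightarrow> x = (y :: 'a)"
  by (metis add_eq_0_iff minus_eq)

text \<open>The affine part of the Erdos-Renyi polarity graph: \<open>(a, b)\<close> is joined to
  the points \<open>(c, d)\<close> of the line \<open>d = a * c - b\<close>. The condition
  \<open>x \<noteq> y\<close> removes the loops at absolute points.\<close>

definition polarity :: "('a \<times> 'a) ugraph" where
  "polarity = (F \<times> F, {{x, y} |x y. x \<in> F \<times> F \<and> y \<in> F \<times> F \<and> x \<noteq> y \<and> snd x + snd y = fst x * fst y})"

lemma polarity_edge:
  "{x, y} \<in> snd polarity \<longleftrightarrow>
    x \<in> F \<times> F \<and> y \<in> F \<times> F \<and> x \<noteq> y \<and> snd x + snd y = fst x * fst y"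
proof -
  have "snd x + snd y = snd y + snd x" "fst x * fst y = fst y * fst x"
    by (simp_all add: ac_simps)
  then show ?thesis
    unfolding polarity_def snd_conv mem_Collect_eq doubleton_eq_iff by metis
qed

lemma simple_polarity: "simple_graph polarity"
  using finF by (auto simp: simple_graph_def polarity_def)

text \<open>Around a 4-cycle the alternating sum of the products vanishes, since each second
  coordinate occurs with both signs. It factors as \<open>(a 0 - a 2) * (a 1 - a 3)\<close>, so two
  opposite vertices agree in the first coordinate and then in both.\<close>

lemma polarity_C4_free: "cyc_lists polarity 4 = {}"
proof (rule ccontr)
  assume "cyc_lists polarity 4 \<noteq> {}"
  then obtain xs where xs: "length xs = 4" "distinct xs"
    "\<And>i. i < 4 \<Longrightarrow> {xs ! i, xs ! (Suc i mod 4)} \<in> snd polarity"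
    by (auto simp: cyc_lists_def)
  define a b where "a = (\<lambda>i. fst (xs ! i))" and "b = (\<lambda>i. snd (xs ! i))"
  have e: "b i + b (Suc i mod 4) = a i * a (Suc i mod 4)" if "i < 4" for i
    using xs(3)[OF that] unfolding polarity_edge a_def b_def by blast
  have m: "Suc 0 mod 4 = 1" "Suc 1 mod 4 = 2" "Suc 2 mod 4 = 3" "Suc 3 mod 4 = 0"
    by simp_all
  have e': "b 0 + b 1 = a 0 * a 1" "b 1 + b 2 = a 1 * a 2" "b 2 + b 3 = a 2 * a 3" "b 3 + b 0 = a 3 * a 0"
    using e[of 0, unfolded m] e[of 1, unfolded m] e[of 2, unfolded m] e[of 3, unfolded m] by simp_all
  have "(a 0 - a 2) * (a 1 - a 3) = a 0 * a 1 - a 1 * a 2 + a 2 * a 3 - a 3 * a 0"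
    by (simp add: algebra_simps)
  also have "\<dots> = 0" unfolding e'[symmetric] by simp
  finally have "a 0 = a 2 \<or> a 1 = a 3" by simp
  then have "(a 0 = a 2 \<and> b 0 = b 2) \<or> (a 1 = a 3 \<and> b 1 = b 3)"
    using e' by (metis add.commute add_left_cancel mult.commute)
  then have "xs ! 0 = xs ! 2 \<or> xs ! 1 = xs ! 3"
    by (auto simp: a_def b_def prod_eq_iff)
  then show False using xs(1,2) by (simp add: nth_eq_iff_index_eq)
qed

text \<open>Adding the edge conditions around a cycle cancels all second coordinates and leaves this
  equation between the first ones. Their distinctness makes every lift a cycle.\<close>

definition closed_walks :: "nat \<Rightarrow> 'a list set" where
  "closed_walks k = {xs. length xs = k \<and> distinct xs \<and> set xs \<subseteq> F \<and> walk_sum xs + last xs * hd xs = 0}"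

lemma lift_walk_in_F:
  "set xs \<subseteq> F \<Longrightarrow> b \<in> F \<Longrightarrow> set (lift_walk xs b) \<subseteq> F \<times> F"
  by (induction xs b rule: lift_walk.induct) (auto simp: add mult)

lemma lift_walk_successively:
  assumes "distinct xs" "set xs \<subseteq> F" "b \<in> F"
  shows "successively (\<lambda>x y. {x, y} \<in> snd polarity) (lift_walk xs b)"
  using assms
proof (induction xs b rule: lift_walk.induct)
  case (1 x y zs b)
  have "hd (lift_walk (y # zs) (b + x * y)) = (y, b + x * y)"
    by (simp add: hd_lift_walk)
  moreover have "b + (b + x * y) = x * y" using self_add[of b] by (simp flip: add.assoc)
  ultimately show ?case
    using 1 by (auto simp: successively_Cons polarity_edge add mult)
qed auto

text \<open>The closing condition does not involve \<open>b\<close>, so each closed walk has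
  \<open>card F\<close> lifts.\<close>

lemma card_closed_walks_le:
  assumes "k \<ge> 3"
  shows "card (closed_walks k) * card F \<le> card (cyc_lists polarity k)"
proof -
  have "card (closed_walks k) * card F = card (closed_walks k \<times> F)"
    by (simp add: card_cartesian_product)
  also have "\<dots> \<le> card (cyc_lists polarity k)"
  proof (rule card_inj_on_le)
    let ?h = "\<lambda>(xs, b). lift_walk xs b :: ('a \<times> 'a) list"
    show "inj_on ?h (closed_walks k \<times> F)"
    proof (rule inj_onI, clarify)
      fix xs b ys c assume "xs \<in> closed_walks k" "ys \<in> closed_walks k"
        and eq: "lift_walk xs b = lift_walk ys c"
      then have ne: "xs \<noteq> []" "ys \<noteq> []" using assms by (auto simp: closed_walks_def)
      show "xs = ys \<and> b = c"
        using arg_cong[OF eq, of "map fst"] arg_cong[OF eq, of hd] ne by (simp add: hd_lift_walk)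
    qed
    show "?h ` (closed_walks k \<times> F) \<subseteq> cyc_lists polarity k"
    proof clarify
      fix xs b assume xs: "xs \<in> closed_walks k" and b: "b \<in> F"
      have len: "length xs = k" "distinct xs" "set xs \<subseteq> F" "walk_sum xs + last xs * hd xs = 0"
        using xs by (auto simp: closed_walks_def)
      have ne: "xs \<noteq> []" using len(1) assms by auto
      have "last xs \<noteq> hd xs"
        using len(1,2) assms ne by (simp add: last_conv_nth hd_conv_nth nth_eq_iff_index_eq)
      moreover have "b + walk_sum xs + b = last xs * hd xs"
        using len(4) self_add[of b] by (simp add: add_eq_0 ac_simps flip: add.assoc)
      moreover have "last xs \<in> F" "hd xs \<in> F" using len(3) ne by auto
      moreover have "b + walk_sum xs \<in> F"
      proof -
        have "last (lift_walk xs b) \<in> F \<times> F"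
          using lift_walk_in_F[OF len(3) b] ne by (metis last_in_set lift_walk_eq_Nil subsetD)
        then show ?thesis using ne by (simp add: last_lift_walk)
      qed
      ultimately have "{last (lift_walk xs b), hd (lift_walk xs b)} \<in> snd polarity"
        using ne b by (simp add: polarity_edge hd_lift_walk last_lift_walk)
      moreover have "distinct (lift_walk xs b)"
        using len(2) by (metis distinct_map map_fst_lift_walk)
      ultimately show "lift_walk xs b \<in> cyc_lists polarity k"
        using len assms lift_walk_in_F[OF len(3) b] lift_walk_successively[OF len(2,3) b]
        by (intro cyc_listsI) (simp_all add: polarity_def)
    qed
  qed (rule finite_cyc_lists[OF simple_polarity])
  finally show ?thesis .
qed

section \<open>Counting closed walks with distinct entries\<close>

definition distinct_lists :: "nat \<Rightarrow> 'a list set" where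
  "distinct_lists j = {xs. length xs = j \<and> distinct xs \<and> set xs \<subseteq> F}"

lemma finite_distinct_lists: "finite (distinct_lists j)"
  by (rule finite_subset[OF _ finite_lists_length_eq[OF finF, of j]]) (auto simp: distinct_lists_def)

lemma card_minus_ge: "finite S \<Longrightarrow> card S \<le> m \<Longrightarrow> card F - m \<le> card (F - S)"
  using diff_card_le_card_Diff[of S F] by linarith

lemma card_distinct_lists:
  "j \<le> m \<Longrightarrow> (card F - m) ^ j \<le> card (distinct_lists j)"
proof (induction j)
  case 0
  have "distinct_lists 0 = {[]}" by (auto simp: distinct_lists_def)
  then show ?case by simp
next
  case (Suc j)
  have "(card F - m) ^ Suc j \<le> card (distinct_lists j) * (card F - m)"
    using Suc by simp
  also have "\<dots> \<le> card (SIGMA xs:distinct_lists j. F - set xs)"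
    using Suc.prems finF finite_distinct_lists
    by (intro card_Sigma_ge card_minus_ge) (auto simp: distinct_lists_def distinct_card)
  also have "\<dots> \<le> card (distinct_lists (Suc j))"
    by (rule card_inj_on_le[of "\<lambda>(xs, x). x # xs"])
      (auto simp: inj_on_def distinct_lists_def finite_distinct_lists[unfolded distinct_lists_def])
  finally show ?case .
qed

lemma card_quadratic_roots_le: "card {x :: 'a. x * x + x * u + v = 0} \<le> 2"
proof (cases "{x :: 'a. x * x + x * u + v = 0} = {}")
  case False
  then obtain r where r: "r * r + r * u + v = 0" by blast
  have "{x. x * x + x * u + v = 0} \<subseteq> {r, - u - r}"
  proof
    fix x assume "x \<in> {x. x * x + x * u + v = 0}"
    then have "x * x + x * u + v = 0" by simp
    then have "(x * x + x * u + v) - (r * r + r * u + v) = 0" using r by simp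
    then have "(x - r) * (x + u + r) = 0" by (simp add: algebra_simps)
    then have "x = r \<or> x + u + r = 0" by simp
    then show "x \<in> {r, - u - r}" by (auto simp: algebra_simps eq_neg_iff_add_eq_0)
  qed
  then have "card {x. x * x + x * u + v = 0} \<le> card {r, - u - r}"
    by (intro card_mono) auto
  also have "\<dots> \<le> 2" by (simp add: card_insert_if)
  finally show ?thesis .
qed simp

text \<open>
  A closed walk is built from a list p and two further entries y, x; its remaining entry z is then
  determined by a linear equation, and y and x avoid the few values for which z is a repetition.
\<close>

definition bad_y :: "'a list \<Rightarrow> 'a set" where
  "bad_y p = insert (walk_sum p / (hd p + last p)) (set p)"

text \<open>The image collects the \<open>x\<close> for which \<open>close_walk p y x\<close> is an
  entry \<open>c\<close> of \<open>p\<close>, and the quadratic those for which it is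
  \<open>x\<close> itself. Equality with \<open>y\<close> does not depend on \<open>x\<close>, since
  \<open>x * y\<close> cancels, and is excluded by \<open>bad_y\<close>. As \<open>last p\<close> is
  among the excluded values, the denominator of \<open>close_walk\<close> does not vanish.\<close>

definition bad_x :: "'a list \<Rightarrow> 'a \<Rightarrow> 'a set" where
  "bad_x p y = insert y (set p) \<union>
     (\<lambda>c. (y * hd p + walk_sum p + c * last p) / (y + c)) ` set p \<union>
     {x. x * x + x * (last p + y) + (y * hd p + walk_sum p) = 0}"

definition close_walk :: "'a list \<Rightarrow> 'a \<Rightarrow> 'a \<Rightarrow> 'a" where
  "close_walk p y x = (x * y + y * hd p + walk_sum p) / (x + last p)"

lemma walk_sum_in_F: "set p \<subseteq> F \<Longrightarrow> walk_sum p \<in> F"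
  by (induction p rule: walk_sum.induct) (auto simp: add mult zero)

lemma card_bad_y: "card (bad_y p) \<le> Suc (length p)"
  using card_length[of p] by (simp add: bad_y_def card_insert_if)

lemma finite_bad_y: "finite (bad_y p)"
  by (simp add: bad_y_def)

lemma card_bad_x: "finite (bad_x p y)" "card (bad_x p y) \<le> 2 * length p + 3"
proof -
  let ?R = "{x. x * x + x * (last p + y) + (y * hd p + walk_sum p) = 0}"
  let ?I = "(\<lambda>c. (y * hd p + walk_sum p + c * last p) / (y + c)) ` set p"
  \<comment> \<open>The bound of \<open>card_quadratic_roots_le\<close> does not imply finiteness,
    because an infinite set has \<open>card\<close> 0. Hence three roots are excluded
    directly.\<close>
  have "finite ?R"
  proof (rule ccontr)
    assume "infinite ?R"
    then obtain S where "S \<subseteq> ?R" "card S = 3" "finite S" using infinite_arbitrarily_large by blast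
    have "S \<noteq> {}" using \<open>card S = 3\<close> by auto
    then obtain r where r: "r \<in> S" by blast
    have roots: "u * u + u * (last p + y) + (y * hd p + walk_sum p) = 0" if "u \<in> S" for u
      using that \<open>S \<subseteq> ?R\<close> by blast
    have "S \<subseteq> {r, - (last p + y) - r}"
    proof
      fix x assume "x \<in> S"
      have "(x * x + x * (last p + y) + (y * hd p + walk_sum p)) -
          (r * r + r * (last p + y) + (y * hd p + walk_sum p)) = 0"
        unfolding roots[OF \<open>x \<in> S\<close>] roots[OF r] by simp
      then have "(x - r) * (x + (last p + y) + r) = 0" by (simp add: algebra_simps)
      then have "x = r \<or> x + (last p + y) + r = 0" by simp
      then show "x \<in> {r, - (last p + y) - r}" by (auto simp: algebra_simps eq_neg_iff_add_eq_0)
    qed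
    then have "card S \<le> card {r, - (last p + y) - r}" by (intro card_mono) auto
    then show False using \<open>card S = 3\<close> by (auto simp: card_insert_if split: if_splits)
  qed
  then show "finite (bad_x p y)" by (simp add: bad_x_def)
  have "card (bad_x p y) \<le> card (insert y (set p)) + card ?I + card ?R"
    unfolding bad_x_def using card_Un_le[of "insert y (set p) \<union> ?I" ?R] card_Un_le[of "insert y (set p)" ?I]
    by linarith
  also have "card ?I \<le> length p" using card_image_le[of "set p"] card_length[of p] by (meson List.finite_set order_trans)
  also have "card (insert y (set p)) \<le> Suc (length p)" using card_length[of p] by (simp add: card_insert_if)
  also have "card ?R \<le> 2" by (rule card_quadratic_roots_le)
  finally show "card (bad_x p y) \<le> 2 * length p + 3" by simp
qed

lemma close_walk_closed:
  assumes p: "p \<in> distinct_lists j" "j \<ge> 2" and y: "y \<in> F" "y \<notin> bad_y p"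
    and x: "x \<in> F" "x \<notin> bad_x p y"
  shows "close_walk p y x # x # y # p \<in> closed_walks (j + 3)"
proof -
  let ?z = "close_walk p y x" and ?h = "hd p" and ?e = "last p" and ?s = "walk_sum p"
  have p': "length p = j" "distinct p" "set p \<subseteq> F" using p(1) by (auto simp: distinct_lists_def)
  have ne: "p \<noteq> []" using p'(1) p(2) by auto
  have "?h \<noteq> ?e"
    using p' p(2) ne by (simp add: last_conv_nth hd_conv_nth nth_eq_iff_index_eq)
  then have he: "?h + ?e \<noteq> 0" by (simp add: add_eq_0)
  have eF: "?e \<in> F" "?h \<in> F" "?e \<in> set p" using p'(3) ne by auto
  have xe: "x + ?e \<noteq> 0" using x(2) eF(3) by (auto simp: add_eq_0 bad_x_def)
  have zF: "?z \<in> F"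
    unfolding close_walk_def using x y eF walk_sum_in_F[OF p'(3)] by (intro add mult divide)
  have z: "?z * (x + ?e) = x * y + y * ?h + ?s"
    using xe by (simp add: close_walk_def)
  have "?z \<noteq> y"
  proof
    assume "?z = y"
    then have "y * (x + ?e) = x * y + y * ?h + ?s" using z by simp
    then have "y * ?e = y * ?h + ?s" by (simp add: algebra_simps)
    then have "y * ?h + y * ?e = ?s" using self_add[of "y * ?h"] by (simp flip: add.assoc)
    then have "y * (?h + ?e) = ?s" by (simp add: distrib_left)
    then have "y = ?s / (?h + ?e)" using he by (simp add: eq_divide_eq)
    then show False using y(2) by (simp add: bad_y_def)
  qed
  moreover have "?z \<noteq> x"
  proof
    assume "?z = x"
    then have "x * (x + ?e) = x * y + y * ?h + ?s" using z by simp
    then have "x * (x + ?e) + (x * y + y * ?h + ?s) = 0" by (simp only: add_eq_0)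
    then have "x * x + x * (?e + y) + (y * ?h + ?s) = 0" by (simp add: algebra_simps)
    then show False using x(2) by (simp add: bad_x_def)
  qed
  moreover have "?z \<notin> set p"
  proof
    assume c: "?z \<in> set p"
    then have yc: "y + ?z \<noteq> 0" using y(2) by (auto simp: add_eq_0 bad_y_def)
    have "?z * (x + ?e) + (x * y + y * ?h + ?s) = 0" using z by (simp only: add_eq_0)
    then have "x * (y + ?z) + (y * ?h + ?s + ?z * ?e) = 0" by (simp add: algebra_simps)
    then have "x * (y + ?z) = y * ?h + ?s + ?z * ?e" by (simp only: add_eq_0)
    then have "x = (y * ?h + ?s + ?z * ?e) / (y + ?z)" using yc by (simp add: eq_divide_eq)
    then show False using x(2) c by (auto simp: bad_x_def)
  qed
  moreover have "y \<notin> set p" "x \<notin> set p" "x \<noteq> y" using x(2) y(2) by (auto simp: bad_x_def bad_y_def)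
  moreover have "walk_sum (?z # x # y # p) + ?e * ?z = 0"
  proof -
    have "walk_sum (?z # x # y # p) = ?z * x + (x * y + (y * ?h + ?s))"
      using ne by (cases p) auto
    then have "walk_sum (?z # x # y # p) + ?e * ?z = ?z * (x + ?e) + (x * y + y * ?h + ?s)"
      by (simp add: algebra_simps)
    then show ?thesis using z by (simp add: self_add)
  qed
  ultimately show ?thesis
    using p' zF x(1) y(1) ne by (simp add: closed_walks_def)
qed

text \<open>All entries but one are chosen freely, each outside at most \<open>2 * k\<close> values;
  the largest exceptional set is that of \<open>x\<close>, with at most
  \<open>2 * (k - 3) + 3\<close> elements.\<close>

lemma card_closed_walks_ge:
  assumes "k \<ge> 5"
  shows "(card F - 2 * k) ^ (k - 1) \<le> card (closed_walks k)"
proof -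
  let ?D = "distinct_lists (k - 3)" and ?m = "card F - 2 * k"
  let ?S = "SIGMA p:?D. SIGMA y:F - bad_y p. F - bad_x p y"
  have len: "length p = k - 3" if "p \<in> ?D" for p using that by (simp add: distinct_lists_def)
  have inner: "?m * ?m \<le> card (SIGMA y:F - bad_y p. F - bad_x p y)" if "p \<in> ?D" for p
  proof -
    have "?m \<le> card (F - bad_y p)"
      using card_bad_y[of p] len[OF that] assms by (intro card_minus_ge finite_bad_y) simp
    then have "?m * ?m \<le> card (F - bad_y p) * ?m" by (rule mult_le_mono1)
    also have "\<dots> \<le> card (SIGMA y:F - bad_y p. F - bad_x p y)"
    proof (rule card_Sigma_ge)
      fix y
      show "?m \<le> card (F - bad_x p y)"
        using card_bad_x[of p y] len[OF that] assms by (intro card_minus_ge) simp_all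
    qed (use finF in auto)
    finally show ?thesis .
  qed
  have "k - 1 = (k - 3) + 2" using assms by simp
  then have "?m ^ (k - 1) = ?m ^ (k - 3) * (?m * ?m)" by (simp add: power_add power2_eq_square)
  also have "\<dots> \<le> card ?D * (?m * ?m)"
    using assms by (intro mult_le_mono1 card_distinct_lists) simp
  also have "\<dots> \<le> card ?S"
    using inner finF finite_distinct_lists by (intro card_Sigma_ge) auto
  also have "\<dots> \<le> card (closed_walks k)"
  proof (rule card_inj_on_le)
    let ?h = "\<lambda>(p, y, x). close_walk p y x # x # y # p"
    show "inj_on ?h ?S" by (auto simp: inj_on_def)
    show "?h ` ?S \<subseteq> closed_walks k"
    proof clarify
      fix p y x assume "p \<in> ?D" "y \<in> F" "y \<notin> bad_y p" "x \<in> F" "x \<notin> bad_x p y"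
      then show "close_walk p y x # x # y # p \<in> closed_walks k"
        using close_walk_closed[of p "k - 3" y x] assms by simp
    qed
    show "finite (closed_walks k)"
      by (rule finite_subset[OF _ finite_lists_length_eq[OF finF, of k]]) (auto simp: closed_walks_def)
  qed
  finally show ?thesis .
qed

end

lemma gen_turan_C4_ge:
  assumes "k \<ge> 5" "m \<ge> 1" "(2 ^ m)\<^sup>2 \<le> n"
  shows "(2 ^ m - 2 * k) ^ (k - 1) * 2 ^ m \<le> k ^ k * gen_turan n (cycle_graph k) (cycle_graph 4)"
proof -
  define F :: "bit alg_closure set" where "F = frobenius_fixed m"
  have cardF: "card F = 2 ^ m"
    unfolding F_def by (rule card_frobenius_fixed[OF alg_closure_bit_char assms(2)])
  interpret char_two_subfield F
  proof
    show "finite F" using cardF by (metis card.infinite power_not_zero zero_neq_numeral)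
    show "0 \<in> F" by (simp add: F_def frobenius_fixed_def)
  qed (use frobenius_fixed_closed[OF alg_closure_bit_char] alg_closure_bit_char in \<open>auto simp: F_def\<close>)
  have "(2 ^ m - 2 * k) ^ (k - 1) * 2 ^ m \<le> card (closed_walks k) * card F"
    unfolding cardF[symmetric] by (intro mult_le_mono1 card_closed_walks_ge assms(1))
  also have "\<dots> \<le> card (cyc_lists polarity k)"
    using assms(1) by (intro card_closed_walks_le) simp
  also have "\<dots> \<le> k ^ k * card (copies (cycle_graph k) polarity)"
    using assms(1) by (intro card_cyc_lists_le_copies simple_polarity) simp
  also have "\<dots> \<le> k ^ k * gen_turan n (cycle_graph k) (cycle_graph 4)"
  proof (intro mult_le_mono2 gen_turan_cycle_ge simple_polarity polarity_C4_free)
    show "card (fst polarity) \<le> n"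
      using assms(3) by (simp add: polarity_def card_cartesian_product cardF power2_eq_square)
  qed (use assms(1) in auto)
  finally show ?thesis .
qed

section \<open>Cycles in graphs without four-cycles\<close>

locale C4_free =
  fixes G :: "'a ugraph" and n :: nat
  assumes G: "simple_graph G" and n: "card (fst G) = n" and C4: "cyc_lists G 4 = {}"
begin

lemma edge_ends: "{x, y} \<in> snd G \<Longrightarrow> x \<in> fst G \<and> y \<in> fst G \<and> x \<noteq> y"
  using G unfolding simple_graph_def by fastforce

lemma finite_verts: "finite (fst G)"
  using G by (simp add: simple_graph_def)

lemma common_neighbour_unique:
  assumes "a \<noteq> b" "{a, c} \<in> snd G" "{c, b} \<in> snd G" "{a, d} \<in> snd G" "{d, b} \<in> snd G"
  shows "c = d"
proof (rule ccontr)
  assume "c \<noteq> d"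
  then have "[a, c, b, d] \<in> cyc_lists G 4"
    using assms edge_ends[OF assms(2)] edge_ends[OF assms(3)] edge_ends[OF assms(4)] edge_ends[OF assms(5)]
    by (intro cyc_listsI) (auto simp: insert_commute)
  then show False using C4 by blast
qed

definition arcs :: "('a \<times> 'a) set" where
  "arcs = {(x, y). {x, y} \<in> snd G}"

lemma arcs_subset: "arcs \<subseteq> fst G \<times> fst G"
  using edge_ends by (auto simp: arcs_def)

lemma finite_arcs: "finite arcs"
  using arcs_subset finite_verts by (meson finite_SigmaI finite_subset)

text \<open>Pairs of neighbours of a vertex are counted: at most \<open>n\<^sup>2\<close> equal
  pairs, and at most \<open>n\<^sup>2\<close> distinct ones because two vertices have at most one
  common neighbour. The Cauchy-Schwarz inequality follows termwise from
  \<open>mult_le_sum_squares\<close>.\<close>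

lemma card_arcs: "(card arcs)\<^sup>2 \<le> 2 * n ^ 3"
proof -
  let ?V = "fst G"
  define d where "d = (\<lambda>x. card {y. {x, y} \<in> snd G})"
  have finN: "finite {y. {x, y} \<in> snd G}" for x
    by (rule finite_subset[OF _ finite_verts]) (use edge_ends in blast)
  have "arcs = (SIGMA x:?V. {y. {x, y} \<in> snd G})"
    using edge_ends by (auto simp: arcs_def)
  then have arcs: "card arcs = (\<Sum>x\<in>?V. d x)"
    using finite_verts finN by (simp add: d_def)
  let ?N = "\<lambda>x. {y. {x, y} \<in> snd G}"
  let ?T = "SIGMA x:?V. ?N x \<times> ?N x"
  let ?D = "{t \<in> ?T. fst (snd t) = snd (snd t)}" and ?O = "{t \<in> ?T. fst (snd t) \<noteq> snd (snd t)}"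
  have "(\<Sum>x\<in>?V. (d x)\<^sup>2) = card ?T"
    using finite_verts finN by (simp add: d_def card_cartesian_product power2_eq_square)
  also have "\<dots> \<le> card (?D \<union> ?O)"
    using finite_verts finN by (intro card_mono) auto
  also have "\<dots> \<le> card ?D + card ?O" by (rule card_Un_le)
  also have "card ?D \<le> card (?V \<times> ?V)"
  proof (rule card_inj_on_le[of "\<lambda>t. (fst t, fst (snd t))"])
    show "(\<lambda>t. (fst t, fst (snd t))) ` ?D \<subseteq> ?V \<times> ?V" using edge_ends by force
  qed (use finite_verts in \<open>auto simp: inj_on_def\<close>)
  also have "card ?O \<le> card (?V \<times> ?V)"
  proof (rule card_inj_on_le[of snd])
    show "inj_on snd ?O"
    proof (rule inj_onI)
      fix s t assume st: "s \<in> ?O" "t \<in> ?O" "snd s = snd t"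
      have "fst s = fst t"
        by (rule common_neighbour_unique[of "fst (snd s)" "snd (snd s)"])
          (use st in \<open>auto simp: insert_commute\<close>)
      then show "s = t" using st(3) by (simp add: prod_eq_iff)
    qed
    show "snd ` ?O \<subseteq> ?V \<times> ?V" using edge_ends by force
  qed (use finite_verts in auto)
  finally have sq: "(\<Sum>x\<in>?V. (d x)\<^sup>2) \<le> 2 * n\<^sup>2"
    using n by (simp add: card_cartesian_product power2_eq_square)
  have "(card arcs)\<^sup>2 = (\<Sum>x\<in>?V. \<Sum>y\<in>?V. d x * d y)"
    unfolding arcs power2_eq_square by (rule sum_product)
  then have "2 * (card arcs)\<^sup>2 = (\<Sum>x\<in>?V. \<Sum>y\<in>?V. 2 * (d x * d y))"
    by (simp only: sum_distrib_left)
  also have "\<dots> \<le> (\<Sum>x\<in>?V. \<Sum>y\<in>?V. (d x)\<^sup>2 + (d y)\<^sup>2)"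
    by (intro sum_mono mult_le_sum_squares)
  also have "\<dots> = 2 * (n * (\<Sum>x\<in>?V. (d x)\<^sup>2))"
    by (simp add: sum.distrib n mult_2 flip: sum_distrib_left)
  also have "\<dots> \<le> 2 * (n * (2 * n\<^sup>2))"
    by (intro mult_le_mono2 sq)
  finally show ?thesis by (simp add: power2_eq_square power3_eq_cube)
qed

lemma cyc_lists_arc: "xs \<in> cyc_lists G k \<Longrightarrow> Suc i < k \<Longrightarrow> {xs ! i, xs ! Suc i} \<in> snd G"
  unfolding cyc_lists_def by (auto dest: spec[of _ i])

lemma cyc_lists_neq: "xs \<in> cyc_lists G k \<Longrightarrow> i < k \<Longrightarrow> j < k \<Longrightarrow> i \<noteq> j \<Longrightarrow> xs ! i \<noteq> xs ! j"
  unfolding cyc_lists_def by (auto simp: nth_eq_iff_index_eq)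

lemma take_eq_nth: "take j xs = take j ys \<Longrightarrow> i < j \<Longrightarrow> xs ! i = ys ! i"
  by (metis nth_take)

text \<open>The entry \<open>j + 1\<close> is chosen freely; the entry \<open>j\<close> is then the
  unique common neighbour of \<open>j - 1\<close> and \<open>j + 1\<close>.\<close>

lemma prefix_step:
  assumes "j \<ge> 1" "j + 2 \<le> k"
  shows "card (take (j + 2) ` cyc_lists G k) \<le> card (take j ` cyc_lists G k) * n"
proof (rule card_image_fiber[where g = "\<lambda>xs. xs ! (j + 1)"])
  show "finite (cyc_lists G k)" by (rule finite_cyc_lists[OF G])
  fix xs assume "xs \<in> cyc_lists G k"
  have "(\<lambda>xs. xs ! (j + 1)) ` {ys \<in> cyc_lists G k. take j ys = take j xs} \<subseteq> fst G"
    using assms by (auto simp: cyc_lists_def)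
  then show "card ((\<lambda>xs. xs ! (j + 1)) ` {ys \<in> cyc_lists G k. take j ys = take j xs}) \<le> n"
    using card_mono[OF finite_verts] n by blast
next
  fix xs ys assume xy: "xs \<in> cyc_lists G k" "ys \<in> cyc_lists G k" "take j xs = take j ys"
    "xs ! (j + 1) = ys ! (j + 1)"
  have len: "length xs = k" "length ys = k" using xy by (auto simp: cyc_lists_def)
  have before: "xs ! i = ys ! i" if "i < j" for i using take_eq_nth[OF xy(3) that] .
  have prev: "xs ! (j - 1) = ys ! (j - 1)" using before assms by simp
  have j: "Suc (j - 1) = j" using assms by simp
  have "xs ! j = ys ! j"
  proof (rule common_neighbour_unique)
    show "xs ! (j - 1) \<noteq> xs ! (j + 1)" using cyc_lists_neq[OF xy(1)] assms by simp
    show "{xs ! (j - 1), xs ! j} \<in> snd G" using cyc_lists_arc[OF xy(1), of "j - 1"] j assms by simp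
    show "{xs ! j, xs ! (j + 1)} \<in> snd G" using cyc_lists_arc[OF xy(1), of j] assms by simp
    show "{xs ! (j - 1), ys ! j} \<in> snd G"
      unfolding prev using cyc_lists_arc[OF xy(2), of "j - 1"] j assms by simp
    show "{ys ! j, xs ! (j + 1)} \<in> snd G"
      unfolding xy(4) using cyc_lists_arc[OF xy(2), of j] assms by simp
  qed
  then have "xs ! i = ys ! i" if "i < j + 2" for i
    using before[of i] xy(4) that by (cases "i = j \<or> i = j + 1") auto
  then show "take (j + 2) xs = take (j + 2) ys"
    using len assms by (intro nth_equalityI) auto
qed

lemma prefix_steps:
  assumes "j \<ge> 1" "j + 2 * m \<le> k"
  shows "card (take (j + 2 * m) ` cyc_lists G k) \<le> card (take j ` cyc_lists G k) * n ^ m"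
  using assms(2)
proof (induction m)
  case (Suc m)
  have "card (take (j + 2 * m + 2) ` cyc_lists G k) \<le> card (take (j + 2 * m) ` cyc_lists G k) * n"
    using assms(1) Suc.prems by (intro prefix_step) auto
  also have "\<dots> \<le> card (take j ` cyc_lists G k) * n ^ m * n"
    using Suc by (intro mult_le_mono1) simp
  finally show ?case by (simp add: ac_simps)
qed simp

text \<open>The last entry is the common neighbour of the entries \<open>k - 2\<close> and 0, so it
  costs nothing.\<close>

lemma prefix_last:
  assumes "k \<ge> 3"
  shows "card (cyc_lists G k) \<le> card (take (k - 1) ` cyc_lists G k)"
proof -
  have "card ((\<lambda>xs. xs) ` cyc_lists G k) \<le> card (take (k - 1) ` cyc_lists G k) * 1"
  proof (rule card_image_fiber[where g = "\<lambda>xs. ()"])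
    show "finite (cyc_lists G k)" by (rule finite_cyc_lists[OF G])
    show "card ((\<lambda>xs. ()) ` A) \<le> 1" for A by (rule card_le_1_subset[of _ "()"]) blast
  next
    fix xs ys assume xy: "xs \<in> cyc_lists G k" "ys \<in> cyc_lists G k" "take (k - 1) xs = take (k - 1) ys"
    have len: "length xs = k" "length ys = k" using xy by (auto simp: cyc_lists_def)
    have before: "xs ! i = ys ! i" if "i < k - 1" for i using take_eq_nth[OF xy(3) that] .
    have S: "Suc (k - 2) = k - 1" "Suc (k - 1) mod k = 0" using assms by simp_all
    have close: "{zs ! (k - 1), zs ! 0} \<in> snd G" if "zs \<in> cyc_lists G k" for zs
    proof -
      have "\<forall>i<k. {zs ! i, zs ! (Suc i mod k)} \<in> snd G"
        using that unfolding cyc_lists_def by blast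
      moreover have "k - 1 < k" using assms by simp
      ultimately have "{zs ! (k - 1), zs ! (Suc (k - 1) mod k)} \<in> snd G" by blast
      then show ?thesis unfolding S(2) .
    qed
    have "xs ! (k - 1) = ys ! (k - 1)"
    proof (rule common_neighbour_unique)
      show "xs ! (k - 2) \<noteq> xs ! 0" using cyc_lists_neq[OF xy(1)] assms by simp
      show "{xs ! (k - 2), xs ! (k - 1)} \<in> snd G"
        using cyc_lists_arc[OF xy(1), of "k - 2"] S assms by simp
      show "{xs ! (k - 1), xs ! 0} \<in> snd G" using close[OF xy(1)] .
      show "{xs ! (k - 2), ys ! (k - 1)} \<in> snd G"
        using cyc_lists_arc[OF xy(2), of "k - 2"] S assms before[of "k - 2"] by simp
      show "{ys ! (k - 1), xs ! 0} \<in> snd G" using close[OF xy(2)] before[of 0] assms by simp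
    qed
    then have "xs ! i = ys ! i" if "i < k" for i
      using before[of i] that by (cases "i = k - 1") auto
    then show "xs = ys" using len by (intro nth_equalityI) auto
  qed
  then show ?thesis by simp
qed

text \<open>Even cycles are built from one vertex, odd ones from an arc, whose cost is of order
  \<open>n\<close> to the power 3/2. Squaring keeps the bound within the natural numbers.\<close>

lemma card_cyc_lists_squared:
  assumes "k \<ge> 3"
  shows "(card (cyc_lists G k))\<^sup>2 \<le> 2 * n ^ k"
proof (cases "even k")
  case True
  define m where "m = (k - 2) div 2"
  have k: "k - 1 = 1 + 2 * m" "k = 2 * m + 2" using True assms unfolding m_def by presburger+
  have "take 1 ` cyc_lists G k \<subseteq> (\<lambda>x. [x]) ` fst G"
  proof
    fix p assume "p \<in> take 1 ` cyc_lists G k"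
    then obtain xs where xs: "xs \<in> cyc_lists G k" "p = take 1 xs" by blast
    then obtain x ys where "xs = x # ys" using assms by (cases xs) (auto simp: cyc_lists_def)
    then show "p \<in> (\<lambda>x. [x]) ` fst G" using xs by (auto simp: cyc_lists_def)
  qed
  then have "card (take 1 ` cyc_lists G k) \<le> n"
    using finite_verts n by (meson card_image_le card_mono finite_imageI order_trans)
  then have "card (cyc_lists G k) \<le> n * n ^ m"
    using prefix_last[OF assms] prefix_steps[of 1 m k] k
    by (metis (no_types) diff_le_self le_refl mult_le_mono1 order_trans)
  then have "(card (cyc_lists G k))\<^sup>2 \<le> (n * n ^ m)\<^sup>2" by (rule power_mono) simp
  also have "\<dots> = n ^ k" by (simp add: k(2) power_mult_distrib power_add power2_eq_square mult_2)
  finally show ?thesis by simp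
next
  case False
  define m where "m = (k - 3) div 2"
  have k: "k - 1 = 2 + 2 * m" "k = 2 * m + 3" using False assms unfolding m_def by presburger+
  have "take 2 ` cyc_lists G k \<subseteq> (\<lambda>(x, y). [x, y]) ` arcs"
  proof
    fix p assume "p \<in> take 2 ` cyc_lists G k"
    then obtain xs where xs: "xs \<in> cyc_lists G k" "p = take 2 xs" by blast
    then have "length xs = k" by (simp add: cyc_lists_def)
    then obtain x y ys where "xs = x # y # ys"
      using assms by (metis Suc_le_length_iff numeral_3_eq_3)
    then show "p \<in> (\<lambda>(x, y). [x, y]) ` arcs"
      using xs cyc_lists_arc[OF xs(1), of 0] assms by (auto simp: arcs_def)
  qed
  then have "card (take 2 ` cyc_lists G k) \<le> card arcs"
    using finite_arcs by (meson card_image_le card_mono finite_imageI order_trans)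
  then have "card (take 2 ` cyc_lists G k) * n ^ m \<le> card arcs * n ^ m" by (rule mult_le_mono1)
  moreover have "card (take (k - 1) ` cyc_lists G k) \<le> card (take 2 ` cyc_lists G k) * n ^ m"
    using prefix_steps[of 2 m k] k by simp
  ultimately have "card (cyc_lists G k) \<le> card arcs * n ^ m"
    using prefix_last[OF assms] by linarith
  then have "(card (cyc_lists G k))\<^sup>2 \<le> (card arcs * n ^ m)\<^sup>2" by (rule power_mono) simp
  also have "\<dots> = (card arcs)\<^sup>2 * (n ^ m)\<^sup>2" by (rule power_mult_distrib)
  also have "\<dots> \<le> 2 * n ^ 3 * (n ^ m)\<^sup>2" by (intro mult_le_mono1 card_arcs)
  also have "\<dots> = 2 * n ^ k" by (simp add: k(2) power_add power_mult mult.commute flip: power_mult)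
  finally show ?thesis .
qed

end

section \<open>The order of magnitude\<close>

lemma gen_turan_C4_le:
  assumes "k \<ge> 3" "n \<ge> 1"
  shows "real (gen_turan n (cycle_graph k) (cycle_graph 4)) \<le> 2 * real n powr (real k / 2)"
proof -
  let ?b = "2 * real n powr (real k / 2)"
  have "gen_turan n (cycle_graph k) (cycle_graph 4) \<le> nat \<lfloor>?b\<rfloor>"
  proof (rule gen_turan_cycle_le)
    fix G :: "nat ugraph"
    assume G: "simple_graph G" "card (fst G) = n" "cyc_lists G 4 = {}"
    interpret C4_free G n by unfold_locales (use G in auto)
    have "(card (cyc_lists G k))\<^sup>2 \<le> 2 * n ^ k" by (rule card_cyc_lists_squared[OF assms(1)])
    then have "(real (card (cyc_lists G k)))\<^sup>2 \<le> 2 * real n ^ k"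
      by (metis (no_types) of_nat_le_iff of_nat_mult of_nat_numeral of_nat_power)
    also have "2 * real n ^ k \<le> 4 * real n ^ k" by simp
    also have "\<dots> = ?b\<^sup>2"
      using assms(2) by (simp add: power_mult_distrib powr_power powr_realpow)
    finally have "real (card (cyc_lists G k)) \<le> ?b"
      by (rule power2_le_imp_le) simp
    then show "card (cyc_lists G k) \<le> nat \<lfloor>?b\<rfloor>" by (rule le_nat_floor)
  qed (use assms in auto)
  then have "real (gen_turan n (cycle_graph k) (cycle_graph 4)) \<le> real (nat \<lfloor>?b\<rfloor>)"
    by (rule of_nat_mono)
  also have "\<dots> \<le> ?b" by (rule of_nat_floor) simp
  finally show ?thesis .
qed

lemma gen_turan_C4_ge_powr:
  assumes "k \<ge> 5" "n \<ge> 64 * k\<^sup>2"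
  shows "real n powr (real k / 2) \<le> (4 * real k) ^ k * real (gen_turan n (cycle_graph k) (cycle_graph 4))"
proof -
  let ?g = "gen_turan n (cycle_graph k) (cycle_graph 4)"
  have "k\<^sup>2 \<ge> 1" using assms(1) by (intro one_le_power) simp
  then have "n \<ge> 1" using assms(2) by linarith
  then obtain m where m: "4 ^ m \<le> n" "n < 4 ^ (m + 1)"
    using ex_power_ivl1[of 4 n] by auto
  define q :: nat where "q = 2 ^ m"
  have q2: "q\<^sup>2 = 4 ^ m" by (simp add: q_def power2_eq_square flip: power_mult_distrib)
  have qn: "q\<^sup>2 \<le> n" "n \<le> (2 * q)\<^sup>2" using m by (simp_all add: q2 power_mult_distrib)
  \<comment> \<open>This follows from \<open>n < 4 * q\<^sup>2\<close> and the assumed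
    \<open>n \<ge> 64 * k\<^sup>2\<close>; it makes \<open>q - 2 * k\<close> at least half of
    \<open>q\<close>.\<close>
  have "(4 * k)\<^sup>2 < q\<^sup>2" using m(2) assms(2) by (simp add: q2 power_mult_distrib)
  then have q: "4 * k < q" by (rule power_less_imp_less_base) simp
  then have "m \<ge> 1" using assms(1) by (cases m) (auto simp: q_def)
  then have g: "(q - 2 * k) ^ (k - 1) * q \<le> k ^ k * ?g"
    using gen_turan_C4_ge[OF assms(1)] qn(1) unfolding q_def by blast
  have "q ^ k = q ^ (k - 1) * q" using assms(1) by (cases k) (auto simp: mult.commute)
  also have "\<dots> \<le> (2 * (q - 2 * k)) ^ (k - 1) * q"
    using q by (intro mult_le_mono1 power_mono) auto
  also have "\<dots> = 2 ^ (k - 1) * ((q - 2 * k) ^ (k - 1) * q)" by (simp add: power_mult_distrib)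
  also have "\<dots> \<le> 2 ^ (k - 1) * (k ^ k * ?g)" by (intro mult_le_mono2 g)
  also have "\<dots> \<le> 2 ^ k * (k ^ k * ?g)" by (intro mult_le_mono1 power_increasing) auto
  finally have "2 ^ k * q ^ k \<le> 2 ^ k * (2 ^ k * (k ^ k * ?g))" by (rule mult_le_mono2)
  also have "\<dots> = (2 ^ k * 2 ^ k) * (k ^ k * ?g)" by (simp only: mult.assoc)
  also have "(2::nat) ^ k * 2 ^ k = 4 ^ k" using power_mult_distrib[of "2::nat" 2 k] by simp
  also have "4 ^ k * (k ^ k * ?g) = (4 * k) ^ k * ?g" by (simp add: power_mult_distrib)
  finally have nat: "(2 * q) ^ k \<le> (4 * k) ^ k * ?g" by (simp add: power_mult_distrib)
  have "real n \<le> (2 * real q)\<^sup>2"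
    using qn(2) by (metis (no_types) of_nat_le_iff of_nat_mult of_nat_numeral of_nat_power)
  then have "real n powr (real k / 2) \<le> ((2 * real q)\<^sup>2) powr (real k / 2)"
    by (intro powr_mono2) auto
  also have "\<dots> = (2 * real q) ^ k"
  proof -
    have "2 * real q > 0" using q by simp
    then have "((2 * real q)\<^sup>2) powr (real k / 2) = ((2 * real q) powr 2) powr (real k / 2)"
      by simp
    also have "\<dots> = (2 * real q) powr real k" unfolding powr_powr by simp
    finally show ?thesis using \<open>2 * real q > 0\<close> by (simp add: powr_realpow)
  qed
  also have "\<dots> \<le> (4 * real k) ^ k * real ?g"
    using nat by (metis (no_types) of_nat_le_iff of_nat_mult of_nat_numeral of_nat_power)
  finally show ?thesis .
qed

lemma mult_div_ge:
  assumes "(c :: nat) \<ge> 1" "c \<le> s"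
  shows "s \<le> 2 * c * (s div c)"
proof -
  have "s div c \<ge> 1" using assms by (simp add: div_greater_zero_iff Suc_le_eq)
  then have "c \<le> c * (s div c)" by simp
  moreover have "c * (s div c) + s mod c = s" by simp
  moreover have "s mod c < c" using assms(1) by simp
  moreover have "2 * c * (s div c) = 2 * (c * (s div c))" by simp
  ultimately show ?thesis by linarith
qed

text \<open>Up to factors depending on \<open>k\<close>, \<open>p\<close> plays the role of
  \<open>l\<close> and \<open>q\<close> that of \<open>n\<close>. A cover of size
  \<open>(l - 1) div 2\<close> has room for \<open>(k + 1) div 2\<close> vertices once
  \<open>l \<ge> k + 2\<close>; for smaller \<open>l\<close> the power of \<open>l\<close> is
  bounded in terms of \<open>k\<close>, so that \<open>p = 1\<close> suffices.\<close>

lemma gen_turan_ge_general: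
  assumes "k \<ge> 4" "l \<ge> 5" "l \<noteq> k" "l \<ge> k + 2 \<or> l \<le> k + 1" "n \<ge> 2 * l + 2 * k"
  shows "l ^ ((k + 1) div 2) * n ^ (k div 2) \<le>
    (8 * k) ^ k * gen_turan n (cycle_graph k) (cycle_graph l)"
proof -
  let ?c = "(k + 1) div 2" and ?r = "k div 2" and ?g = "gen_turan n (cycle_graph k) (cycle_graph l)"
  have cr: "?c + ?r = k" by presburger
  have bounds: "?c \<ge> 1" "?c \<le> k" "?r \<ge> 1" "?r \<le> k" using assms(1) by auto
  have "\<exists>p q. l \<le> 8 * k * p \<and> n \<le> 8 * k * q \<and> p ^ ?c * q ^ ?r \<le> ?g"
  proof (cases "l \<ge> k + 2")
    case True
    define s where "s = (l - 1) div 2"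
    have s2: "2 * s \<le> l - 1" "l - 1 \<le> 2 * s + 1" unfolding s_def by presburger+
    have cs: "?c \<le> s" unfolding s_def using True by (intro div_le_mono) simp
    \<comment> \<open>Passing from \<open>l\<close> to \<open>s\<close> costs a factor 4 and from
      \<open>n\<close> to \<open>n - s\<close> a factor 2; the rounding in
      \<open>mult_div_ge\<close> costs at most \<open>2 * k\<close>. Hence the constant
      \<open>8 * k\<close>.\<close>
    have s: "2 * s < l" "l \<le> 4 * s" "?c \<le> s" "2 * s \<le> n" "?r \<le> n - s"
      using True assms(1,5) s2 cs bounds by linarith+
    define p where "p = s div ?c"
    define q where "q = (n - s) div ?r"
    have "s \<le> 2 * ?c * p" unfolding p_def using bounds s by (intro mult_div_ge)
    also have "\<dots> \<le> 2 * k * p" using bounds by (intro mult_le_mono1) simp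
    finally have "l \<le> 8 * k * p" using s(2) by simp
    moreover have "n - s \<le> 2 * ?r * q" unfolding q_def using bounds s by (intro mult_div_ge)
    then have "n - s \<le> 2 * k * q"
      using bounds by (meson le_trans mult_le_mono1 mult_le_mono2)
    then have "n \<le> 8 * k * q" using s(4) by simp
    moreover have "p ^ ?c * q ^ ?r \<le> ?g"
      unfolding p_def q_def using assms s by (intro gen_turan_ge_vertex_cover) auto
    ultimately show ?thesis by blast
  next
    case False
    define q where "q = (n - k) div k"
    have "n - k \<le> 2 * k * q" unfolding q_def using assms by (intro mult_div_ge) auto
    then have "n \<le> 8 * k * q" using assms(5) by simp
    moreover have "l \<le> 8 * k * 1" using False assms(4,1) by simp
    moreover have "k * q + k \<le> n"
    proof -
      have "k * q \<le> n - k" unfolding q_def by simp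
      then show ?thesis using assms(5) by linarith
    qed
    then have "1 ^ ?c * q ^ ?r \<le> ?g"
      using assms by (simp add: gen_turan_ge_blowup)
    ultimately show ?thesis by blast
  qed
  then obtain p q where pq: "l \<le> 8 * k * p" "n \<le> 8 * k * q" "p ^ ?c * q ^ ?r \<le> ?g" by blast
  have "l ^ ?c * n ^ ?r \<le> (8 * k * p) ^ ?c * (8 * k * q) ^ ?r"
    by (intro mult_le_mono power_mono pq) auto
  also have "\<dots> = (8 * k) ^ (?c + ?r) * (p ^ ?c * q ^ ?r)"
    by (simp only: power_mult_distrib power_add ac_simps)
  also have "\<dots> \<le> (8 * k) ^ k * ?g" unfolding cr by (intro mult_le_mono2 pq)
  finally show ?thesis .
qed

lemma gen_turan_le_general:
  assumes "(even l \<and> l \<ge> 6 \<and> k \<ge> 4) \<or> (odd l \<and> odd k \<and> k \<ge> 5 \<and> k < l)"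
  shows "gen_turan n (cycle_graph k) (cycle_graph l) \<le>
    (k ^ k * 12 * 4 ^ (k div 2)) * l ^ ((k + 1) div 2) * n ^ (k div 2)"
proof (rule gen_turan_cycle_le)
  fix G :: "nat ugraph"
  assume "simple_graph G" "card (fst G) = n" "cyc_lists G l = {}"
  then show "card (cyc_lists G k) \<le>
      (k ^ k * 12 * 4 ^ (k div 2)) * l ^ ((k + 1) div 2) * n ^ (k div 2)"
    using assms by (rule cyc_lists_le)
qed (use assms in auto)

lemma nat_half: "nat \<lceil>real k / 2\<rceil> = (k + 1) div 2" "nat \<lfloor>real k / 2\<rfloor> = k div 2"
proof -
  show "nat \<lfloor>real k / 2\<rfloor> = k div 2"
    using floor_divide_of_nat_eq[of k 2, where ?'a = real] by simp
  have "\<lceil>real k / 2\<rceil> = int ((k + 1) div 2)"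
  proof (cases "even k")
    case True
    then show ?thesis by (auto elim!: evenE)
  next
    case False
    then obtain j where "k = 2 * j + 1" by (elim oddE)
    then show ?thesis by (intro ceiling_unique) auto
  qed
  then show "nat \<lceil>real k / 2\<rceil> = (k + 1) div 2" by simp
qed

lemma uniform_Theta_general:
  assumes "k \<ge> 4"
    and L: "\<And>l. l \<in> L \<Longrightarrow> l \<noteq> k \<and> ((even l \<and> l \<ge> 6) \<or> (odd l \<and> odd k \<and> k \<ge> 5 \<and> k < l))"
  shows "uniform_Theta L
    (\<lambda>n l. real (gen_turan n (cycle_graph k) (cycle_graph l)))
    (\<lambda>n l. real l ^ nat \<lceil>real k / 2\<rceil> * real n ^ nat \<lfloor>real k / 2\<rfloor>)"
  unfolding uniform_Theta_def nat_half
proof (rule exI, rule exI, intro conjI ballI)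
  let ?a = "1 / (8 * real k) ^ k" and ?A = "real (k ^ k * 12 * 4 ^ (k div 2))"
  let ?h = "\<lambda>n l. real l ^ ((k + 1) div 2) * real n ^ (k div 2)"
  have pos: "(8 * real k) ^ k > 0" using assms(1) by simp
  then show "0 < ?a" by simp
  have "(8 * real k) ^ k \<ge> 1" using assms(1) by (intro one_le_power) simp
  then have "?a \<le> 1" by simp
  also have "1 \<le> ?A"
  proof -
    have "k ^ k * 12 * 4 ^ (k div 2) \<noteq> 0" using assms(1) by simp
    then have "1 \<le> k ^ k * 12 * 4 ^ (k div 2)" by linarith
    then show ?thesis by (metis of_nat_1 of_nat_le_iff)
  qed
  finally show "?a \<le> ?A" .
  fix l assume l: "l \<in> L"
  show "\<forall>n\<ge>1. real (gen_turan n (cycle_graph k) (cycle_graph l)) \<le> ?A * ?h n l"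
  proof (intro allI impI)
    fix n
    have "gen_turan n (cycle_graph k) (cycle_graph l) \<le>
        (k ^ k * 12 * 4 ^ (k div 2)) * l ^ ((k + 1) div 2) * n ^ (k div 2)"
      using L[OF l] assms(1) by (intro gen_turan_le_general) auto
    then have "real (gen_turan n (cycle_graph k) (cycle_graph l)) \<le>
        real ((k ^ k * 12 * 4 ^ (k div 2)) * l ^ ((k + 1) div 2) * n ^ (k div 2))"
      by (rule of_nat_mono)
    then show "real (gen_turan n (cycle_graph k) (cycle_graph l)) \<le> ?A * ?h n l"
      by (simp add: mult.assoc)
  qed
  show "\<exists>n\<^sub>0. \<forall>n\<ge>n\<^sub>0. ?a * ?h n l \<le> real (gen_turan n (cycle_graph k) (cycle_graph l))"
  proof (intro exI allI impI)
    fix n assume "n \<ge> 2 * l + 2 * k"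
    moreover have "l \<ge> 5" "l \<noteq> k" "l \<ge> k + 2 \<or> l \<le> k + 1" using L[OF l] by auto
    ultimately have "l ^ ((k + 1) div 2) * n ^ (k div 2) \<le>
        (8 * k) ^ k * gen_turan n (cycle_graph k) (cycle_graph l)"
      using assms(1) by (intro gen_turan_ge_general)
    then have "real (l ^ ((k + 1) div 2) * n ^ (k div 2)) \<le>
        real ((8 * k) ^ k * gen_turan n (cycle_graph k) (cycle_graph l))"
      by (rule of_nat_mono)
    then have "?h n l \<le> (8 * real k) ^ k * real (gen_turan n (cycle_graph k) (cycle_graph l))"
      by simp
    then show "?a * ?h n l \<le> real (gen_turan n (cycle_graph k) (cycle_graph l))"
      using pos by (simp add: divide_le_eq mult.commute)
  qed
qed

lemma uniform_Theta_C4: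
  assumes "k \<ge> 5"
  shows "uniform_Theta {4}
    (\<lambda>n l. real (gen_turan n (cycle_graph k) (cycle_graph l)))
    (\<lambda>n l. real n powr (real k / 2))"
  unfolding uniform_Theta_def
proof (rule exI, rule exI, intro conjI ballI)
  let ?a = "1 / (4 * real k) ^ k"
  have pos: "(4 * real k) ^ k > 0" using assms by simp
  then show "0 < ?a" by simp
  have "(4 * real k) ^ k \<ge> 1" using assms by (intro one_le_power) simp
  then have "?a \<le> 1" by simp
  then show "?a \<le> 2" by linarith
  fix l :: nat assume "l \<in> {4}"
  then have l: "l = 4" by simp
  show "\<forall>n\<ge>1. real (gen_turan n (cycle_graph k) (cycle_graph l)) \<le> 2 * real n powr (real k / 2)"
    using gen_turan_C4_le[of k] assms unfolding l by simp
  show "\<exists>n\<^sub>0. \<forall>n\<ge>n\<^sub>0. ?a * real n powr (real k / 2) \<le>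
      real (gen_turan n (cycle_graph k) (cycle_graph l))"
  proof (intro exI allI impI)
    fix n assume "n \<ge> 64 * k\<^sup>2"
    then have "real n powr (real k / 2) \<le>
        (4 * real k) ^ k * real (gen_turan n (cycle_graph k) (cycle_graph l))"
      unfolding l by (rule gen_turan_C4_ge_powr[OF assms])
    then show "?a * real n powr (real k / 2) \<le> real (gen_turan n (cycle_graph k) (cycle_graph l))"
      using pos by (simp add: divide_le_eq mult.commute)
  qed
qed

theorem theorem1:
  fixes k :: nat
  shows
    "(k \<ge> 5 \<longrightarrow>
        uniform_Theta {4}
          (\<lambda>n l. real (gen_turan n (cycle_graph k) (cycle_graph l)))
          (\<lambda>n l. real n powr (real k / 2))) \<and>
     (k \<ge> 4 \<longrightarrow>
        uniform_Theta {l. l \<ge> 6 \<and> even l \<and> l \<noteq> k}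
          (\<lambda>n l. real (gen_turan n (cycle_graph k) (cycle_graph l)))
          (\<lambda>n l. real l ^ nat \<lceil>real k / 2\<rceil> * real n ^ nat \<lfloor>real k / 2\<rfloor>)) \<and>
     (odd k \<and> k \<ge> 5 \<longrightarrow>
        uniform_Theta {l. odd l \<and> k < l}
          (\<lambda>n l. real (gen_turan n (cycle_graph k) (cycle_graph l)))
          (\<lambda>n l. real l ^ nat \<lceil>real k / 2\<rceil> * real n ^ nat \<lfloor>real k / 2\<rfloor>))"
  by (intro conjI impI uniform_Theta_C4 uniform_Theta_general) auto

end
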